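(* Let $k$ be a field of characteristic $0$. Let $\mathfrak a$ be a finite dimensional Lie algebra over $k$, let $(e_1,\dots,e_n)$ be a basis of $\mathfrak a$ and let $C_{i,j}^a$ be the structure constants, $[e_i,e_j]=\sum_{a=1}^n C_{i,j}^a e_a$. Let $U_h(\mathfrak a)$ be a deformation of $U(\mathfrak a)$ given under the form $$U_h(\mathfrak a)\simeq \frac{T_{k[[h]]}\left(\bigoplus_{i=1}^n k[[h]]e_i\right)}{I},$$ where $I$ is the closure (in the $h$-adic topology) of the two-sided ideal generated by the relations $$e_i\otimes e_j-e_j\otimes e_i-g_{i,j}^{\otimes}(e_1,\dots,e_n,h),$$ where the $g_{i,j}$ satisfy $$g_{i,j}\in k[X_1,\dots,X_n][[h]],\qquad \partial_X(g_{i,j})\ge 1,\qquad g_{i,j}^{\otimes}(e_1,\dots,e_n,h)=\sum_{a=1}^n C_{i,j}^a e_a \mod h\,T_{k[[h]]}\Big(\bigoplus_{i=1}^n k[[h]]e_i\Big).$$ Make $k[[h]]$ into a $U_h(\mathfrak a)$-module (the trivial $U_h(\mathfrak a)$-module) by letting the $e_i$'s act trivially (i.e. by $0$). Then there exists a resolution of the trivial $U_h(\mathfrak a)$-module $k[[h]]$ of the form $$K_h=\left(U_h(\mathfrak a)\otimes_k\wedge^{\bullet}\mathfrak a,\ \partial_h^{\bullet}\right)$$ such that $\mathrm{Gr}\,K_h$ is the Koszul resolution of the trivial $U(\mathfrak a)[h]$-module $k[h]$.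
   Context: A deformation of $U(\mathfrak a)$ is a $k[[h]]$-algebra $U_h(\mathfrak a)$ that is topologically free as a $k[[h]]$-module (isomorphic to $V[[h]]$ for a $k$-vector space $V$) with $U_h(\mathfrak a)/hU_h(\mathfrak a)\simeq U(\mathfrak a)$ as algebras (here the class of $e_i$ corresponds to $e_i$). $T_{k[[h]]}$ denotes the tensor algebra over $k[[h]]$, understood as a topological ($h$-adically completed) algebra. For $P=\sum a_{i_1,\dots,i_n}X_1^{i_1}\cdots X_n^{i_n}\in k[X_1,\dots,X_n]$, $P^{\otimes}(e_1,\dots,e_n)=\sum a_{i_1,\dots,i_n}e_1^{\otimes i_1}\otimes\cdots\otimes e_n^{\otimes i_n}$, and for $g=\sum_{r\ge0}P_r h^r\in k[X_1,\dots,X_n][[h]]$, $g^{\otimes}(e_1,\dots,e_n,h)=\sum_{r\ge0}P_r^{\otimes}(e_1,\dots,e_n)h^r$. $\partial_X(g)$ is the lowest total degree in the $X_j$ of the monomials occurring in $g$ with nonzero coefficient. $\mathrm{Gr}$ denotes the associated graded for the $h$-adic filtration, so $\mathrm{Gr}\,U_h(\mathfrak a)\simeq U(\mathfrak a)[h]$. The Koszul resolution of the trivial $U(\mathfrak a)$-module $k$ is $(U(\mathfrak a)\otimes\wedge^\bullet\mathfrak a,\partial)$ with $$\partial(u\otimes X_1\wedge\dots\wedge X_m)=\sum_{i}(-1)^{i-1}uX_i\otimes X_1\wedge\dots\widehat{X_i}\dots\wedge X_m+\sum_{i<j}(-1)^{i+j}u\otimes[X_i,X_j]\wedge X_1\wedge\dots\widehat{X_i}\dots\widehat{X_j}\dots\wedge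 X_m,$$ and that of the trivial $U(\mathfrak a)[h]$-module $k[h]$ is obtained from it by extension of scalars from $k$ to $k[h]$. *)

theory Defs
  imports
    "HOL-Library.Poly_Mapping"
    "HOL-Library.Extended_Nat"
    "HOL-Computational_Algebra.Formal_Power_Series"
    "HOL-Algebra.QuotRing"
    "HOL-Algebra.UnivPoly"
begin

locale lie_algebra = vector_space scale
  for scale :: "'k::field \<Rightarrow> 'a::ab_group_add \<Rightarrow> 'a" +
  fixes bracket :: "'a \<Rightarrow> 'a \<Rightarrow> 'a"
  assumes bracket_add_left: "bracket (x + y) z = bracket x z + bracket y z"
    and bracket_add_right: "bracket x (y + z) = bracket x y + bracket x z"
    and bracket_scale_left: "bracket (scale c x) y = scale c (bracket x y)"
    and bracket_scale_right: "bracket x (scale c y) = scale c (bracket x y)"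
    and bracket_self: "bracket x x = 0"
    and jacobi: "bracket x (bracket y z) + bracket y (bracket z x) + bracket z (bracket x y) = 0"

text \<open>Bases are indexed by \<open>0, \<dots>, n - 1\<close> throughout.\<close>

definition finite_basis :: "('k::field \<Rightarrow> 'a::ab_group_add \<Rightarrow> 'a) \<Rightarrow> nat \<Rightarrow> (nat \<Rightarrow> 'a) \<Rightarrow> bool" where
  "finite_basis scale n e \<longleftrightarrow>
     inj_on e {..<n} \<and>
     \<not> module.dependent scale (e ` {..<n}) \<and>
     module.span scale (e ` {..<n}) = UNIV"

definition coord ::
  "('k::field \<Rightarrow> 'a::ab_group_add \<Rightarrow> 'a) \<Rightarrow> nat \<Rightarrow> (nat \<Rightarrow> 'a) \<Rightarrow> 'a \<Rightarrow> nat \<Rightarrow> 'k" where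
  "coord scale n e x i = module.representation scale (e ` {..<n}) x (e i)"

text \<open>
  Words under concatenation; lists carry no such instance of \<^class>\<open>monoid_add\<close>. With this type, the
  finitely supported functions \<open>fword \<Rightarrow>\<^sub>0 'k\<close> under convolution are the free associative algebra,
  and the empty word is \<open>0\<close>.
\<close>

datatype fword = FWord (letters: "nat list")

instantiation fword :: monoid_add
begin
definition zero_fword :: fword where "0 = FWord []"
definition plus_fword :: "fword \<Rightarrow> fword \<Rightarrow> fword" where
  "v + w = FWord (letters v @ letters w)"
instance by standard (auto simp: zero_fword_def plus_fword_def)
end

type_synonym 'k falg = "fword \<Rightarrow>\<^sub>0 'k"

definition gen :: "nat \<Rightarrow> 'k::field falg" where
  "gen i = Poly_Mapping.single (FWord [i]) 1"

definition scalar :: "'k::field \<Rightarrow> 'k falg" where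
  "scalar c = Poly_Mapping.single 0 c"

definition tensor_alg :: "nat \<Rightarrow> 'k::field falg ring" where
  "tensor_alg n = \<lparr>carrier = {t. \<forall>w\<in>Poly_Mapping.keys t. set (letters w) \<subseteq> {..<n}},
     mult = (*), one = 1, zero = 0, add = (+)\<rparr>"

text \<open>
  The \<open>h\<close>-adic completion of the tensor algebra over \<open>k[[h]]\<close> of the free module on
  \<open>e\<^sub>0, \<dots>, e\<^sub>n\<^sub>-\<^sub>1\<close>, i.e. the inverse limit of the \<open>(k[h]/h\<^sup>N)\<langle>e\<^sub>0, \<dots>, e\<^sub>n\<^sub>-\<^sub>1\<rangle>\<close>: formal power series
  in the central variable \<open>h\<close> (\<^const>\<open>fps_X\<close>) with coefficients in the free associative algebra.
\<close>

definition tensor_alg_h :: "nat \<Rightarrow> 'k::field falg fps ring" where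
  "tensor_alg_h n = \<lparr>carrier = {t. \<forall>r. fps_nth t r \<in> carrier (tensor_alg n)},
     mult = (*), one = 1, zero = 0, add = (+)\<rparr>"

definition scalar_h :: "'k::field fps \<Rightarrow> 'k falg fps" where
  "scalar_h c = Abs_fps (\<lambda>r. scalar (fps_nth c r))"

definition lie_incl ::
  "('k::field \<Rightarrow> 'a::ab_group_add \<Rightarrow> 'a) \<Rightarrow> nat \<Rightarrow> (nat \<Rightarrow> 'a) \<Rightarrow> 'a \<Rightarrow> 'k falg" where
  "lie_incl scale n e x = (\<Sum>i<n. scalar (coord scale n e x i) * gen i)"

definition env_ideal ::
  "('k::field \<Rightarrow> 'a::ab_group_add \<Rightarrow> 'a) \<Rightarrow> ('a \<Rightarrow> 'a \<Rightarrow> 'a) \<Rightarrow> nat \<Rightarrow> (nat \<Rightarrow> 'a) \<Rightarrow> 'k falg set" where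
  "env_ideal scale bracket n e = genideal (tensor_alg n)
     {lie_incl scale n e x * lie_incl scale n e y - lie_incl scale n e y * lie_incl scale n e x
        - lie_incl scale n e (bracket x y) | x y. True}"

definition env_alg ::
  "('k::field \<Rightarrow> 'a::ab_group_add \<Rightarrow> 'a) \<Rightarrow> ('a \<Rightarrow> 'a \<Rightarrow> 'a) \<Rightarrow> nat \<Rightarrow> (nat \<Rightarrow> 'a) \<Rightarrow> 'k falg set ring" where
  "env_alg scale bracket n e = tensor_alg n Quot env_ideal scale bracket n e"

definition env_class ::
  "('k::field \<Rightarrow> 'a::ab_group_add \<Rightarrow> 'a) \<Rightarrow> ('a \<Rightarrow> 'a \<Rightarrow> 'a) \<Rightarrow> nat \<Rightarrow> (nat \<Rightarrow> 'a) \<Rightarrow> 'k falg \<Rightarrow> 'k falg set" where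
  "env_class scale bracket n e t = env_ideal scale bracket n e +>\<^bsub>tensor_alg n\<^esub> t"

text \<open>
  The action of the enveloping algebra on the trivial module \<open>k\<close>: the map induced on classes by
  the algebra map killing all \<open>e\<^sub>i\<close>, i.e. by the coefficient of the empty word.
\<close>

definition env_counit :: "'k::field falg set \<Rightarrow> 'k" where
  "env_counit u = the_elem ((\<lambda>t. Poly_Mapping.lookup t 0) ` u)"

type_synonym 'k mpoly = "(nat \<Rightarrow>\<^sub>0 nat) \<Rightarrow>\<^sub>0 'k"

definition series_in_vars :: "nat \<Rightarrow> 'k::field mpoly fps \<Rightarrow> bool" where
  "series_in_vars n g \<longleftrightarrow>
     (\<forall>r. \<forall>m\<in>Poly_Mapping.keys (fps_nth g r). Poly_Mapping.keys m \<subseteq> {..<n})"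

text \<open>The order \<open>\<partial>\<^sub>X\<close>; it is \<open>\<infinity>\<close> for the zero series.\<close>

definition X_order :: "'k::field mpoly fps \<Rightarrow> enat" where
  "X_order g = (INF m\<in>(\<Union>r. Poly_Mapping.keys (fps_nth g r)).
     enat (\<Sum>i\<in>Poly_Mapping.keys m. Poly_Mapping.lookup m i))"

definition poly_tensor :: "nat \<Rightarrow> 'k::field mpoly \<Rightarrow> 'k falg" where
  "poly_tensor n P = (\<Sum>m\<in>Poly_Mapping.keys P.
     scalar (Poly_Mapping.lookup P m) *
       prod_list (map (\<lambda>i. gen i ^ Poly_Mapping.lookup m i) [0..<n]))"

definition series_tensor :: "nat \<Rightarrow> 'k::field mpoly fps \<Rightarrow> 'k falg fps" where
  "series_tensor n g = Abs_fps (\<lambda>r. poly_tensor n (fps_nth g r))"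

text \<open>The \<open>h\<close>-adic filtration of a ring, for a central element \<open>h\<close>.\<close>

definition hfilt :: "('r, 'x) ring_scheme \<Rightarrow> 'r \<Rightarrow> nat \<Rightarrow> 'r set" where
  "hfilt R h i = (\<lambda>x. (h [^]\<^bsub>R\<^esub> i) \<otimes>\<^bsub>R\<^esub> x) ` carrier R"

definition hclosure :: "('r, 'x) ring_scheme \<Rightarrow> 'r \<Rightarrow> 'r set \<Rightarrow> 'r set" where
  "hclosure R h J = {x \<in> carrier R. \<forall>N. \<exists>y\<in>J. x \<ominus>\<^bsub>R\<^esub> y \<in> hfilt R h N}"

definition def_ideal :: "nat \<Rightarrow> (nat \<Rightarrow> nat \<Rightarrow> 'k::field mpoly fps) \<Rightarrow> 'k falg fps set" where
  "def_ideal n g = hclosure (tensor_alg_h n) fps_X (genideal (tensor_alg_h n)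
     {fps_const (gen i) * fps_const (gen j) - fps_const (gen j) * fps_const (gen i)
        - series_tensor n (g i j) | i j. i < n \<and> j < n})"

definition def_alg :: "nat \<Rightarrow> (nat \<Rightarrow> nat \<Rightarrow> 'k::field mpoly fps) \<Rightarrow> 'k falg fps set ring" where
  "def_alg n g = tensor_alg_h n Quot def_ideal n g"

definition def_class ::
  "nat \<Rightarrow> (nat \<Rightarrow> nat \<Rightarrow> 'k::field mpoly fps) \<Rightarrow> 'k falg fps \<Rightarrow> 'k falg fps set" where
  "def_class n g t = def_ideal n g +>\<^bsub>tensor_alg_h n\<^esub> t"

text \<open>The map to \<open>k[[h]]\<close> induced on classes by killing all \<open>e\<^sub>i\<close>, as for \<^const>\<open>env_counit\<close>.\<close>

definition def_counit :: "'k::field falg fps set \<Rightarrow> 'k fps" where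
  "def_counit u = the_elem ((\<lambda>t. Abs_fps (\<lambda>r. Poly_Mapping.lookup (fps_nth t r) 0)) ` u)"

text \<open>
  Topological freeness: an isomorphism of \<open>k[[h]]\<close>-modules onto \<open>V[[h]]\<close>, whose elements are the
  coefficient sequences \<^typ>\<open>nat \<Rightarrow> 'v\<close>; \<open>s\<close> is the structure map from \<open>k[[h]]\<close> to the algebra.
\<close>

definition topologically_free ::
  "('k::field \<Rightarrow> 'v::ab_group_add \<Rightarrow> 'v) \<Rightarrow> ('r, 'x) ring_scheme \<Rightarrow> ('k fps \<Rightarrow> 'r) \<Rightarrow> bool" where
  "topologically_free scaleV R s \<longleftrightarrow> vector_space scaleV \<and>
     (\<exists>\<phi> :: 'r \<Rightarrow> nat \<Rightarrow> 'v. bij_betw \<phi> (carrier R) UNIV \<and>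
        (\<forall>x\<in>carrier R. \<forall>y\<in>carrier R. \<phi> (x \<oplus>\<^bsub>R\<^esub> y) = (\<lambda>r. \<phi> x r + \<phi> y r)) \<and>
        (\<forall>c. \<forall>x\<in>carrier R.
           \<phi> (s c \<otimes>\<^bsub>R\<^esub> x) = (\<lambda>r. \<Sum>i\<le>r. scaleV (fps_nth c i) (\<phi> x (r - i)))))"

definition is_deformation ::
  "('k::field \<Rightarrow> 'v::ab_group_add \<Rightarrow> 'v) \<Rightarrow> ('k \<Rightarrow> 'a::ab_group_add \<Rightarrow> 'a) \<Rightarrow> ('a \<Rightarrow> 'a \<Rightarrow> 'a) \<Rightarrow>
   nat \<Rightarrow> (nat \<Rightarrow> 'a) \<Rightarrow> (nat \<Rightarrow> nat \<Rightarrow> 'k mpoly fps) \<Rightarrow> bool" where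
  "is_deformation scaleV scale bracket n e g \<longleftrightarrow>
     topologically_free scaleV (def_alg n g) (\<lambda>c. def_class n g (scalar_h c)) \<and>
     (let R = def_alg n g; H = hfilt R (def_class n g fps_X) 1 in
        \<exists>\<theta> \<in> ring_iso (R Quot H) (env_alg scale bracket n e).
          (\<forall>i<n. \<theta> (H +>\<^bsub>R\<^esub> def_class n g (fps_const (gen i)))
                   = env_class scale bracket n e (gen i)) \<and>
          (\<forall>c. \<theta> (H +>\<^bsub>R\<^esub> def_class n g (fps_const (scalar c)))
                   = env_class scale bracket n e (scalar c)))"

text \<open>The library locale \<^locale>\<open>Module.module\<close> is restricted to commutative rings.\<close>

locale left_module = R?: ring R + M?: abelian_group M
  for R :: "('r, 'x) ring_scheme" (structure) and M :: "('r, 'm, 'y) module_scheme" (structure) +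
  assumes smult_closed: "\<lbrakk>a \<in> carrier R; x \<in> carrier M\<rbrakk> \<Longrightarrow> a \<odot>\<^bsub>M\<^esub> x \<in> carrier M"
    and smult_l_distr: "\<lbrakk>a \<in> carrier R; b \<in> carrier R; x \<in> carrier M\<rbrakk> \<Longrightarrow>
      (a \<oplus>\<^bsub>R\<^esub> b) \<odot>\<^bsub>M\<^esub> x = a \<odot>\<^bsub>M\<^esub> x \<oplus>\<^bsub>M\<^esub> b \<odot>\<^bsub>M\<^esub> x"
    and smult_r_distr: "\<lbrakk>a \<in> carrier R; x \<in> carrier M; y \<in> carrier M\<rbrakk> \<Longrightarrow>
      a \<odot>\<^bsub>M\<^esub> (x \<oplus>\<^bsub>M\<^esub> y) = a \<odot>\<^bsub>M\<^esub> x \<oplus>\<^bsub>M\<^esub> a \<odot>\<^bsub>M\<^esub> y"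
    and smult_assoc: "\<lbrakk>a \<in> carrier R; b \<in> carrier R; x \<in> carrier M\<rbrakk> \<Longrightarrow>
      (a \<otimes>\<^bsub>R\<^esub> b) \<odot>\<^bsub>M\<^esub> x = a \<odot>\<^bsub>M\<^esub> (b \<odot>\<^bsub>M\<^esub> x)"
    and smult_one: "x \<in> carrier M \<Longrightarrow> \<one>\<^bsub>R\<^esub> \<odot>\<^bsub>M\<^esub> x = x"

text \<open>Additive maps that are linear along \<open>\<psi>\<close>; linear maps are the case \<open>\<psi> = id\<close>.\<close>

definition semilinear_hom ::
  "('r, 'x) ring_scheme \<Rightarrow> ('r \<Rightarrow> 's) \<Rightarrow> ('r, 'm, 'y) module_scheme \<Rightarrow> ('s, 'p, 'z) module_scheme \<Rightarrow>
   ('m \<Rightarrow> 'p) set" where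
  "semilinear_hom R \<psi> M M' = {f \<in> carrier M \<rightarrow> carrier M'.
     (\<forall>x\<in>carrier M. \<forall>y\<in>carrier M. f (x \<oplus>\<^bsub>M\<^esub> y) = f x \<oplus>\<^bsub>M'\<^esub> f y) \<and>
     (\<forall>a\<in>carrier R. \<forall>x\<in>carrier M. f (a \<odot>\<^bsub>M\<^esub> x) = \<psi> a \<odot>\<^bsub>M'\<^esub> f x)}"

definition semilinear_iso ::
  "('r, 'x) ring_scheme \<Rightarrow> ('r \<Rightarrow> 's) \<Rightarrow> ('r, 'm, 'y) module_scheme \<Rightarrow> ('s, 'p, 'z) module_scheme \<Rightarrow>
   ('m \<Rightarrow> 'p) set" where
  "semilinear_iso R \<psi> M M' =
     {f \<in> semilinear_hom R \<psi> M M'. bij_betw f (carrier M) (carrier M')}"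

text \<open>
  Exactness of \<open>\<dots> \<rightarrow> M 2 \<rightarrow> M 1 \<rightarrow> M 0 \<rightarrow> N \<rightarrow> 0\<close>, with \<open>d m\<close> the differential from \<open>M (Suc m)\<close>
  to \<open>M m\<close>.
\<close>

definition left_resolution ::
  "('r, 'x) ring_scheme \<Rightarrow> ('r, 'q, 'z) module_scheme \<Rightarrow> (nat \<Rightarrow> ('r, 'm, 'y) module_scheme) \<Rightarrow>
   (nat \<Rightarrow> 'm \<Rightarrow> 'm) \<Rightarrow> ('m \<Rightarrow> 'q) \<Rightarrow> bool" where
  "left_resolution R N M d \<epsilon> \<longleftrightarrow>
     left_module R N \<and> (\<forall>m. left_module R (M m)) \<and>
     (\<forall>m. d m \<in> semilinear_hom R id (M (Suc m)) (M m)) \<and>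
     \<epsilon> \<in> semilinear_hom R id (M 0) N \<and>
     \<epsilon> ` carrier (M 0) = carrier N \<and>
     {x \<in> carrier (M 0). \<epsilon> x = \<zero>\<^bsub>N\<^esub>} = d 0 ` carrier (M (Suc 0)) \<and>
     (\<forall>m. {x \<in> carrier (M (Suc m)). d m x = \<zero>\<^bsub>M m\<^esub>} = d (Suc m) ` carrier (M (Suc (Suc m))))"

text \<open>
  The \<open>m\<close>-th exterior power of a space with basis \<open>e\<^sub>0, \<dots>, e\<^sub>n\<^sub>-\<^sub>1\<close> is represented by coordinates with
  respect to the basis \<open>e\<^sub>S = e\<^sub>s\<^sub>1 \<and> \<dots> \<and> e\<^sub>s\<^sub>m\<close>, for \<open>S = {s\<^sub>1 < \<dots> < s\<^sub>m}\<close>.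
\<close>

definition ext_index :: "nat \<Rightarrow> nat \<Rightarrow> nat set set" where
  "ext_index n m = {S. S \<subseteq> {..<n} \<and> card S = m}"

text \<open>
  The coordinates of \<open>x\<^sub>1 \<and> \<dots> \<and> x\<^sub>m\<close>, where vectors are given by their coordinates \<open>c\<close>; the recursion
  uses that \<open>e\<^sub>a \<and> e\<^sub>S\<close> is \<open>e\<^bsub>S \<union> {a}\<^esub>\<close> up to the sign of moving \<open>e\<^sub>a\<close> past the smaller basis vectors
  when \<open>a \<notin> S\<close>, and \<open>0\<close> otherwise.
\<close>

fun wedge :: "('a \<Rightarrow> nat \<Rightarrow> 'k::comm_ring_1) \<Rightarrow> 'a list \<Rightarrow> nat set \<Rightarrow> 'k" where
  "wedge c [] S = (if S = {} then 1 else 0)"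
| "wedge c (x # xs) S = (\<Sum>a\<in>S. (- 1) ^ card {b\<in>S. b < a} * c x a * wedge c xs (S - {a}))"

text \<open>The free left \<open>R\<close>-module \<open>R \<otimes> \<and>\<^sup>m\<close>, and its elements \<open>u \<otimes> \<omega>\<close>, for \<open>s\<close> the map from scalars to \<open>R\<close>.\<close>

definition ext_module :: "('r, 'x) ring_scheme \<Rightarrow> nat \<Rightarrow> nat \<Rightarrow> ('r, nat set \<Rightarrow> 'r) module" where
  "ext_module R n m = \<lparr>carrier = (\<Pi>\<^sub>E S\<in>ext_index n m. carrier R),
     mult = undefined, one = undefined,
     zero = (\<lambda>S\<in>ext_index n m. \<zero>\<^bsub>R\<^esub>),
     add = (\<lambda>x y. \<lambda>S\<in>ext_index n m. x S \<oplus>\<^bsub>R\<^esub> y S),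
     smult = (\<lambda>u x. \<lambda>S\<in>ext_index n m. u \<otimes>\<^bsub>R\<^esub> x S)\<rparr>"

definition ext_tensor ::
  "('r, 'x) ring_scheme \<Rightarrow> ('k \<Rightarrow> 'r) \<Rightarrow> nat \<Rightarrow> nat \<Rightarrow> 'r \<Rightarrow> (nat set \<Rightarrow> 'k) \<Rightarrow> nat set \<Rightarrow> 'r" where
  "ext_tensor R s n m u \<omega> = (\<lambda>S\<in>ext_index n m. u \<otimes>\<^bsub>R\<^esub> s (\<omega> S))"

definition ext_basis :: "('r, 'x) ring_scheme \<Rightarrow> nat \<Rightarrow> nat \<Rightarrow> nat set \<Rightarrow> nat set \<Rightarrow> 'r" where
  "ext_basis R n m S = (\<lambda>S'\<in>ext_index n m. if S' = S then \<one>\<^bsub>R\<^esub> else \<zero>\<^bsub>R\<^esub>)"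

text \<open>
  The value of the differential on \<open>u \<otimes> X\<^sub>0 \<and> \<dots> \<and> X\<^sub>m\<close>. Positions are counted from \<open>0\<close>, so the sign
  of the first sum is \<open>(-1)\<^sup>i\<close>; that of the second sum is unaffected.
\<close>

definition koszul_formula ::
  "('k::field \<Rightarrow> 'a::ab_group_add \<Rightarrow> 'a) \<Rightarrow> ('a \<Rightarrow> 'a \<Rightarrow> 'a) \<Rightarrow> nat \<Rightarrow> (nat \<Rightarrow> 'a) \<Rightarrow>
   nat \<Rightarrow> 'k falg set \<Rightarrow> 'a list \<Rightarrow> nat set \<Rightarrow> 'k falg set" where
  "koszul_formula scale bracket n e m u Xs =
     (let U = env_alg scale bracket n e;
          M = ext_module U n m;
          cls = env_class scale bracket n e;
          tens = ext_tensor U (\<lambda>c. cls (scalar c)) n m;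
          wdg = wedge (coord scale n e)
      in (\<Oplus>\<^bsub>M\<^esub> i\<in>{..m}.
            tens (u \<otimes>\<^bsub>U\<^esub> cls (lie_incl scale n e (Xs ! i)))
              (\<lambda>S. (- 1) ^ i * wdg (nths Xs (- {i})) S))
         \<oplus>\<^bsub>M\<^esub>
         (\<Oplus>\<^bsub>M\<^esub> p\<in>{(i, j). i < j \<and> j \<le> m}.
            tens u
              (\<lambda>S. (- 1) ^ (fst p + snd p) *
                wdg (bracket (Xs ! fst p) (Xs ! snd p) # nths Xs (- {fst p, snd p})) S)))"

definition koszul_diff ::
  "('k::field \<Rightarrow> 'a::ab_group_add \<Rightarrow> 'a) \<Rightarrow> ('a \<Rightarrow> 'a \<Rightarrow> 'a) \<Rightarrow> nat \<Rightarrow> (nat \<Rightarrow> 'a) \<Rightarrow>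
   nat \<Rightarrow> (nat set \<Rightarrow> 'k falg set) \<Rightarrow> nat set \<Rightarrow> 'k falg set" where
  "koszul_diff scale bracket n e m x =
     (\<Oplus>\<^bsub>ext_module (env_alg scale bracket n e) n m\<^esub> S\<in>ext_index n (Suc m).
        koszul_formula scale bracket n e m (x S) (map e (sorted_list_of_set S)))"

text \<open>
  Its extension of scalars to \<open>k[h]\<close>, on \<open>U(\<aa>)[h] \<otimes> \<and>\<^sup>m\<^sup>+\<^sup>1\<close>: the differential is applied to the
  coefficient of each power of \<open>h\<close>.
\<close>

definition koszul_diff_h ::
  "('k::field \<Rightarrow> 'a::ab_group_add \<Rightarrow> 'a) \<Rightarrow> ('a \<Rightarrow> 'a \<Rightarrow> 'a) \<Rightarrow> nat \<Rightarrow> (nat \<Rightarrow> 'a) \<Rightarrow>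
   nat \<Rightarrow> (nat set \<Rightarrow> nat \<Rightarrow> 'k falg set) \<Rightarrow> nat set \<Rightarrow> nat \<Rightarrow> 'k falg set" where
  "koszul_diff_h scale bracket n e m x =
     (\<lambda>S\<in>ext_index n m. \<lambda>i.
        koszul_diff scale bracket n e m (\<lambda>S'\<in>ext_index n (Suc m). x S' i) S)"

definition koszul_aug_h :: "(nat set \<Rightarrow> nat \<Rightarrow> 'k::field falg set) \<Rightarrow> nat \<Rightarrow> 'k" where
  "koszul_aug_h x = (\<lambda>i. env_counit (x {} i))"

definition type_ring :: "'k::field ring" where
  "type_ring = \<lparr>carrier = UNIV, mult = (*), one = 1, zero = 0, add = (+)\<rparr>"

definition trivial_poly_module :: "(nat \<Rightarrow> 'k::field falg set, nat \<Rightarrow> 'k) module" where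
  "trivial_poly_module = \<lparr>carrier = carrier (UP type_ring), mult = mult (UP type_ring),
     one = one (UP type_ring), zero = zero (UP type_ring), add = add (UP type_ring),
     smult = (\<lambda>p q. (\<lambda>i. env_counit (p i)) \<otimes>\<^bsub>UP type_ring\<^esub> q)\<rparr>"

definition trivial_def_module :: "('k::field falg fps set, 'k fps) module" where
  "trivial_def_module = \<lparr>carrier = UNIV, mult = (*), one = 1, zero = 0, add = (+),
     smult = (\<lambda>u f. def_counit u * f)\<rparr>"

definition def_ext_module ::
  "nat \<Rightarrow> (nat \<Rightarrow> nat \<Rightarrow> 'k::field mpoly fps) \<Rightarrow> nat \<Rightarrow>
   ('k falg fps set, nat set \<Rightarrow> 'k falg fps set) module" where
  "def_ext_module n g m = ext_module (def_alg n g) n m"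

definition mfilt :: "('r, 'x) ring_scheme \<Rightarrow> 'r \<Rightarrow> ('r, 'm, 'y) module_scheme \<Rightarrow> nat \<Rightarrow> 'm set" where
  "mfilt R h M i = (\<lambda>x. (h [^]\<^bsub>R\<^esub> i) \<odot>\<^bsub>M\<^esub> x) ` carrier M"

text \<open>
  The piece \<open>F\<^sub>i / F\<^sub>i\<^sub>+\<^sub>1\<close> (an abelian group written multiplicatively, as provided by the library), and
  the carrier of the direct sum of all pieces.
\<close>

definition gr_piece :: "('m, 'x) ring_scheme \<Rightarrow> (nat \<Rightarrow> 'm set) \<Rightarrow> nat \<Rightarrow> 'm set monoid" where
  "gr_piece M F i = (M\<lparr>carrier := F i\<rparr>) A_Mod F (Suc i)"

definition gr_carrier :: "('m, 'x) ring_scheme \<Rightarrow> (nat \<Rightarrow> 'm set) \<Rightarrow> (nat \<Rightarrow> 'm set) set" where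
  "gr_carrier M F = {f. (\<forall>i. f i \<in> carrier (gr_piece M F i)) \<and>
     finite {i. f i \<noteq> \<one>\<^bsub>gr_piece M F i\<^esub>}}"

text \<open>The class in degree \<open>d\<close> of an element of \<open>F\<^sub>d\<close>.\<close>

definition gr_class ::
  "('m, 'x) ring_scheme \<Rightarrow> (nat \<Rightarrow> 'm set) \<Rightarrow> nat \<Rightarrow> 'm \<Rightarrow> nat \<Rightarrow> 'm set" where
  "gr_class M F d x = (\<lambda>i. if i = d then F (Suc i) +>\<^bsub>M\<^esub> x else \<one>\<^bsub>gr_piece M F i\<^esub>)"

definition gr_ring :: "('r, 'x) ring_scheme \<Rightarrow> 'r \<Rightarrow> (nat \<Rightarrow> 'r set) ring" where
  "gr_ring R h = (let F = hfilt R h in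
     \<lparr>carrier = gr_carrier R F,
      mult = (\<lambda>f g i. finprod (gr_piece R F i)
                (\<lambda>j. rcoset_mult R (F (Suc i)) (f j) (g (i - j))) {..i}),
      one = gr_class R F 0 \<one>\<^bsub>R\<^esub>,
      zero = (\<lambda>i. \<one>\<^bsub>gr_piece R F i\<^esub>),
      add = (\<lambda>f g i. f i \<otimes>\<^bsub>gr_piece R F i\<^esub> g i)\<rparr>)"

definition gr_module ::
  "('r, 'x) ring_scheme \<Rightarrow> 'r \<Rightarrow> ('r, 'm, 'y) module_scheme \<Rightarrow> (nat \<Rightarrow> 'r set, nat \<Rightarrow> 'm set) module" where
  "gr_module R h M = (let F = mfilt R h M in
     \<lparr>carrier = gr_carrier M F,
      mult = undefined, one = undefined,
      zero = (\<lambda>i. \<one>\<^bsub>gr_piece M F i\<^esub>),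
      add = (\<lambda>f g i. f i \<otimes>\<^bsub>gr_piece M F i\<^esub> g i),
      smult = (\<lambda>a f i. finprod (gr_piece M F i)
                (\<lambda>j. \<Union>u\<in>a j. \<Union>x\<in>f (i - j). F (Suc i) +>\<^bsub>M\<^esub> (u \<odot>\<^bsub>M\<^esub> x)) {..i})\<rparr>)"

text \<open>The map induced on associated graded modules by a linear map \<open>f\<close> with values in \<open>M'\<close>.\<close>

definition gr_map ::
  "('r, 'x) ring_scheme \<Rightarrow> 'r \<Rightarrow> ('r, 'p, 'y) module_scheme \<Rightarrow> ('m \<Rightarrow> 'p) \<Rightarrow>
   (nat \<Rightarrow> 'm set) \<Rightarrow> nat \<Rightarrow> 'p set" where
  "gr_map R h M' f \<xi> = (\<lambda>i. \<Union>x\<in>\<xi> i. mfilt R h M' (Suc i) +>\<^bsub>M'\<^esub> f x)"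

text \<open>
  The canonical identification of algebras of \<open>U(\<aa>)[h]\<close> with the associated graded of the deformed
  algebra: it is determined by the images of the \<open>e\<^sub>i\<close>, of the scalars and of \<open>h\<close>.
\<close>

definition gr_alg_identification ::
  "('k::field \<Rightarrow> 'a::ab_group_add \<Rightarrow> 'a) \<Rightarrow> ('a \<Rightarrow> 'a \<Rightarrow> 'a) \<Rightarrow> nat \<Rightarrow> (nat \<Rightarrow> 'a) \<Rightarrow>
   (nat \<Rightarrow> nat \<Rightarrow> 'k mpoly fps) \<Rightarrow> ((nat \<Rightarrow> 'k falg set) \<Rightarrow> nat \<Rightarrow> 'k falg fps set set) \<Rightarrow> bool" where
  "gr_alg_identification scale bracket n e g \<psi> \<longleftrightarrow>
     (let U = env_alg scale bracket n e; P = UP U; cls = env_class scale bracket n e;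
          R = def_alg n g; h = def_class n g fps_X; F = hfilt R h
      in \<psi> \<in> ring_iso P (gr_ring R h) \<and>
         (\<forall>i<n. \<psi> (up_ring.monom P (cls (gen i)) 0)
                  = gr_class R F 0 (def_class n g (fps_const (gen i)))) \<and>
         (\<forall>c. \<psi> (up_ring.monom P (cls (scalar c)) 0)
                  = gr_class R F 0 (def_class n g (fps_const (scalar c)))) \<and>
         \<psi> (up_ring.monom P \<one>\<^bsub>U\<^esub> 1) = gr_class R F 1 h)"

text \<open>
  The associated graded of the augmented complex
  \<open>\<dots> \<rightarrow> U\<^sub>h(\<aa>) \<otimes> \<and>\<^sup>1 \<rightarrow> U\<^sub>h(\<aa>) \<otimes> \<and>\<^sup>0 \<rightarrow> k[[h]]\<close> is the augmented Koszul complex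
  \<open>\<dots> \<rightarrow> U(\<aa>)[h] \<otimes> \<and>\<^sup>1 \<rightarrow> U(\<aa>)[h] \<otimes> \<and>\<^sup>0 \<rightarrow> k[h]\<close>, under the canonical identifications
  (over \<open>U(\<aa>)[h] \<simeq> Gr U\<^sub>h(\<aa>)\<close>) which match \<open>1 \<otimes> e\<^sub>S\<close> with the class of \<open>1 \<otimes> e\<^sub>S\<close>, and \<open>1\<close> with the
  class of \<open>1\<close>.
\<close>

definition gr_is_koszul ::
  "('k::field \<Rightarrow> 'a::ab_group_add \<Rightarrow> 'a) \<Rightarrow> ('a \<Rightarrow> 'a \<Rightarrow> 'a) \<Rightarrow> nat \<Rightarrow> (nat \<Rightarrow> 'a) \<Rightarrow>
   (nat \<Rightarrow> nat \<Rightarrow> 'k mpoly fps) \<Rightarrow>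
   (nat \<Rightarrow> (nat set \<Rightarrow> 'k falg fps set) \<Rightarrow> nat set \<Rightarrow> 'k falg fps set) \<Rightarrow>
   ((nat set \<Rightarrow> 'k falg fps set) \<Rightarrow> 'k fps) \<Rightarrow> bool" where
  "gr_is_koszul scale bracket n e g d \<epsilon> \<longleftrightarrow>
     (let P = UP (env_alg scale bracket n e);
          R = def_alg n g; h = def_class n g fps_X;
          K = def_ext_module n g; N = trivial_def_module
      in \<exists>\<psi> \<Phi> \<chi>.
         gr_alg_identification scale bracket n e g \<psi> \<and>
         (\<forall>m. \<Phi> m \<in> semilinear_iso P \<psi> (ext_module P n m) (gr_module R h (K m)) \<and>
            (\<forall>S\<in>ext_index n m. \<Phi> m (ext_basis P n m S)
               = gr_class (K m) (mfilt R h (K m)) 0 (ext_basis R n m S))) \<and>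
         \<chi> \<in> semilinear_iso P \<psi> trivial_poly_module (gr_module R h N) \<and>
         \<chi> \<one>\<^bsub>trivial_poly_module\<^esub> = gr_class N (mfilt R h N) 0 1 \<and>
         (\<forall>m. \<forall>x\<in>carrier (ext_module P n (Suc m)).
            gr_map R h (K m) (d m) (\<Phi> (Suc m) x)
              = \<Phi> m (koszul_diff_h scale bracket n e m x)) \<and>
         (\<forall>x\<in>carrier (ext_module P n 0). gr_map R h N \<epsilon> (\<Phi> 0 x) = \<chi> (koszul_aug_h x)))"

end

theory Submission
  imports Defs
begin

text \<open>
  The differentials of \<open>K\<^sub>h\<close> are obtained by lifting those of the Koszul resolution of \<open>U(\<aa>)\<close> one
  degree at a time. If \<open>K\<^sub>h\<close> is already exact in degrees below \<open>m\<close>, then every cycle of the Koszul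
  complex in degree \<open>m\<close> lifts to a cycle of \<open>K\<^sub>h\<close>: for a lift \<open>z\<close>, \<open>d z = h w\<close> with \<open>d w = 0\<close> by
  torsion-freeness, hence \<open>w = d v\<close>, and \<open>z - h v\<close> is a cycle. Lifting the images of the basis
  vectors defines the next differential, and exactness of the result follows from exactness modulo
  \<open>h\<close> by successive approximation. The associated graded of \<open>K\<^sub>h\<close> is then the Koszul complex by
  construction, since \<open>h\<^sup>i M / h\<^sup>i\<^sup>+\<^sup>1 M \<simeq> M / h M\<close> for \<open>h\<close>-torsion-free \<open>M\<close>.

  Exactness of the Koszul complex of \<open>U(\<aa>)\<close> is proved together with the Poincare-Birkhoff-Witt theorem,
  by computing in the free algebra modulo relations of bounded length. On \<open>T \<otimes> \<and>\<^sup>m\<close> the Euler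
  homotopy \<open>s (w \<otimes> \<omega>) = \<Sum>\<^sub>i \<partial>\<^sub>i w \<otimes> e\<^sub>i \<and> \<omega>\<close> satisfies \<open>d s + s d = q\<close> in total degree \<open>q\<close>, modulo
  relations of length at most \<open>q - m\<close> and shorter words. In degree \<open>m = 2\<close> this shows, by induction
  on \<open>q\<close>, that a combination of relations whose terms of top length cancel is already a
  combination of shorter relations; given this, the homotopy yields exactness by induction on the
  total degree.
\<close>

section \<open>Words and derivations of the free algebra\<close>

text \<open>Over the free algebra the lifted differential d does not square to zero: its square is a
  combination of the relations \<open>rel i j\<close>. The proof turns this obstacle into its main
  tool, since in exterior degree 2 combinations of relations are themselves of the form d (d f). If
  their leading terms cancel, d f is a cycle up to lower terms, the homotopy gives f = d y up to
  lower terms, and d (d y) consists of shorter relations. The Poincare-Birkhoff-Witt theorem and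
  exactness are thus governed by the same identity. Characteristic 0 enters through division by the
  total degree q, and by 2 and 3 in sums over ordered pairs and cyclic permutations. On the side of
  the deformation, everything is read off from \<open>V[[h]]\<close>: multiplication by h is the
  shift of coefficients, hence injective, complete and separated. The trivial module exists because
  the order condition on the \<open>g i j\<close> puts all relations into the kernel of the map
  killing the generators, and this kernel is closed in the h-adic topology.\<close>

lemma fword_plus [simp]: "FWord u + FWord v = FWord (u @ v)"
  by (simp add: plus_fword_def)

lemma letters_plus [simp]: "letters (u + v) = letters u @ letters v"
  by (simp add: plus_fword_def)

lemma letters_zero [simp]: "letters 0 = []"
  by (simp add: zero_fword_def)

lemma scalar_add: "scalar (a + b) = scalar a + scalar b"
  by (simp add: scalar_def single_add)

lemma scalar_mult: "scalar (a * b) = scalar a * scalar b"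
  by (simp add: scalar_def mult_single)

lemma scalar_zero [simp]: "scalar 0 = 0"
  by (simp add: scalar_def)

lemma scalar_one [simp]: "scalar 1 = 1"
  by (simp add: scalar_def)

lemma scalar_uminus: "scalar (- a) = - scalar a"
  by (simp add: scalar_def single_uminus)

lemma scalar_sum: "scalar (\<Sum>i\<in>A. f i) = (\<Sum>i\<in>A. scalar (f i))"
  by (induction A rule: infinite_finite_induct) (auto simp: scalar_add)

lemma falg_eq_sum: "(t :: 'k::field falg) = (\<Sum>w\<in>Poly_Mapping.keys t. Poly_Mapping.single w (Poly_Mapping.lookup t w))"
proof (rule poly_mapping_eqI)
  fix k
  show "Poly_Mapping.lookup t k =
    Poly_Mapping.lookup (\<Sum>w\<in>Poly_Mapping.keys t. Poly_Mapping.single w (Poly_Mapping.lookup t w)) k"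
    by (simp add: lookup_sum lookup_single when_def sum.delta' in_keys_iff)
qed

lemma falg_induct [case_names single add]:
  fixes t :: "'k::field falg"
  assumes "\<And>w c. w \<in> Poly_Mapping.keys t \<Longrightarrow> Q (Poly_Mapping.single w c)"
    and "\<And>x y. Q x \<Longrightarrow> Q y \<Longrightarrow> Q (x + y)" and "Q 0"
  shows "Q t"
proof -
  have "Q (\<Sum>w\<in>A. Poly_Mapping.single w (Poly_Mapping.lookup t w))"
    if "finite A" "A \<subseteq> Poly_Mapping.keys t" for A
    using that by (induction A) (auto intro: assms)
  then show ?thesis
    by (subst falg_eq_sum) auto
qed

lemma scalar_commute: "t * scalar c = scalar c * (t :: 'k::field falg)"
  by (induction t rule: falg_induct) (auto simp: scalar_def mult_single algebra_simps)

lemma scalar_left_commute: "t * (scalar c * u) = scalar c * (t * (u :: 'k::field falg))"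
  by (metis mult.assoc scalar_commute)

lemma single_eq_scalar: "Poly_Mapping.single w c = scalar c * Poly_Mapping.single w (1::'k::field)"
  by (simp add: scalar_def mult_single)

section \<open>The filtration of the free algebra by word length\<close>

definition trunc :: "nat \<Rightarrow> nat \<Rightarrow> 'k::field falg set" where
  "trunc n q = {t. \<forall>w\<in>Poly_Mapping.keys t. set (letters w) \<subseteq> {..<n} \<and> length (letters w) < q}"

lemma trunc_single: "set u \<subseteq> {..<n} \<Longrightarrow> length u < q \<Longrightarrow> Poly_Mapping.single (FWord u) c \<in> trunc n q"
  by (simp add: trunc_def)

lemma trunc_zero [simp]: "0 \<in> trunc n q"
  by (simp add: trunc_def)

lemma trunc_add [intro]: "x \<in> trunc n q \<Longrightarrow> y \<in> trunc n q \<Longrightarrow> x + y \<in> trunc n q"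
  using keys_add[of x y] by (fastforce simp: trunc_def)

text \<open>The bounds are strict: factors of length at most p - 1 and r - 1 give words of length at
  most p + r - 2, which is below q as soon as p + r \<le> q + 1.\<close>

lemma trunc_mult_le:
  assumes "x \<in> trunc n p" "y \<in> trunc n r" "p + r \<le> Suc q"
  shows "x * y \<in> trunc n q"
proof -
  have "set (letters w) \<subseteq> {..<n} \<and> length (letters w) < q" if "w \<in> Poly_Mapping.keys (x * y)" for w
  proof -
    have "w \<in> {a + b | a b. a \<in> Poly_Mapping.keys x \<and> b \<in> Poly_Mapping.keys y}"
      using keys_mult that by (rule subsetD)
    then obtain a b where "w = a + b" "a \<in> Poly_Mapping.keys x" "b \<in> Poly_Mapping.keys y"
      by auto
    with assms show ?thesis by (fastforce simp: trunc_def)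
  qed
  then show ?thesis by (auto simp: trunc_def)
qed

lemma trunc_scalar: "scalar c \<in> trunc n (Suc q)"
  by (simp add: trunc_def scalar_def)

lemma trunc_one: "1 \<in> trunc n (Suc q)"
  using trunc_scalar[of 1] by simp

lemma trunc_scalar_mult [intro]: "x \<in> trunc n q \<Longrightarrow> scalar c * x \<in> trunc n q"
  by (rule trunc_mult_le[OF trunc_scalar[of c n 0]]) auto

lemma trunc_uminus [intro]: "x \<in> trunc n q \<Longrightarrow> - x \<in> trunc n q"
  using trunc_scalar_mult[of x n q "-1"] by (simp add: scalar_uminus)

lemma trunc_diff [intro]: "x \<in> trunc n q \<Longrightarrow> y \<in> trunc n q \<Longrightarrow> x - y \<in> trunc n q"
  using trunc_add[of x n q "-y"] trunc_uminus by fastforce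

lemma trunc_sum [intro]: "(\<And>i. i \<in> A \<Longrightarrow> f i \<in> trunc n q) \<Longrightarrow> (\<Sum>i\<in>A. f i) \<in> trunc n q"
  by (induction A rule: infinite_finite_induct) auto

lemma trunc_mono: "x \<in> trunc n p \<Longrightarrow> p \<le> q \<Longrightarrow> x \<in> trunc n q"
  by (fastforce simp: trunc_def)

lemma trunc_gen: "i < n \<Longrightarrow> gen i \<in> trunc n 2"
  by (simp add: trunc_def gen_def)

lemma trunc_mult_gen: "x \<in> trunc n q \<Longrightarrow> i < n \<Longrightarrow> x * gen i \<in> trunc n (Suc q)"
  by (rule trunc_mult_le[where r = 2]) (auto intro: trunc_gen)

text \<open>The strict bound makes level 0 trivial. Levels are later written as truncated
  differences such as \<open>q - m\<close>; for m \<ge> q the statements then concern 0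
  only.\<close>

lemma trunc_0 [simp]: "trunc n 0 = {0}"
proof -
  have "t = 0" if "t \<in> trunc n 0" for t :: "'k::field falg"
  proof -
    have "Poly_Mapping.keys t = {}" using that by (auto simp: trunc_def)
    then show ?thesis by simp
  qed
  then show ?thesis by auto
qed

lemma trunc_induct [consumes 1, case_names single add zero]:
  assumes "t \<in> trunc n q"
    and "\<And>u c. set u \<subseteq> {..<n} \<Longrightarrow> length u < q \<Longrightarrow> Q (Poly_Mapping.single (FWord u) c)"
    and "\<And>x y. Q x \<Longrightarrow> Q y \<Longrightarrow> Q (x + y)" and "Q 0"
  shows "Q t"
proof (induction t rule: falg_induct)
  case (single w c)
  then show ?case
    using assms(1) assms(2)[of "letters w" c] by (auto simp: trunc_def)
qed (use assms in auto)

lemma carrier_tensor_alg_eq: "(carrier (tensor_alg n) :: 'k::field falg set) = (\<Union>q. trunc n q)"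
proof (intro equalityI subsetI)
  fix t :: "'k falg" assume t: "t \<in> carrier (tensor_alg n)"
  let ?L = "(\<lambda>w. length (letters w)) ` Poly_Mapping.keys t"
  have "t \<in> trunc n (Suc (Max ?L))"
    using t Max_ge[of ?L] by (auto simp: trunc_def tensor_alg_def less_Suc_eq_le)
  then show "t \<in> (\<Union>q. trunc n q)" by blast
qed (auto simp: trunc_def tensor_alg_def)

lemma lookup_mult_gen:
  "Poly_Mapping.lookup (v * gen j) (FWord (w @ [k])) = (if j = k then Poly_Mapping.lookup v (FWord w) else 0)"
proof (induction v rule: falg_induct)
  case (single u c)
  then show ?case
    by (cases u) (auto simp: gen_def mult_single lookup_single when_def)
qed (auto simp: distrib_right lookup_add)

text \<open>The last letter of a word determines the summand it comes from, so nothing cancels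
  between the \<open>v k * gen k\<close>.\<close>

lemma trunc_coefficients:
  assumes "(\<Sum>k<n. v k * gen k) \<in> trunc n q" "k < n"
  shows "v k \<in> trunc n (q - 1)"
proof -
  have "set (letters w) \<subseteq> {..<n} \<and> length (letters w) < q - 1" if "w \<in> Poly_Mapping.keys (v k)" for w
  proof -
    obtain u where u: "w = FWord u" by (cases w)
    have "Poly_Mapping.lookup (\<Sum>k<n. v k * gen k) (FWord (u @ [k])) = Poly_Mapping.lookup (v k) w"
      using assms(2) by (simp add: lookup_sum lookup_mult_gen u)
    then have "FWord (u @ [k]) \<in> Poly_Mapping.keys (\<Sum>k<n. v k * gen k)"
      using that by (simp add: in_keys_iff)
    then show ?thesis using assms(1) u by (fastforce simp: trunc_def)
  qed
  then show ?thesis by (auto simp: trunc_def)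
qed

section \<open>The derivations dual to the generators\<close>

fun word_der :: "nat \<Rightarrow> nat list \<Rightarrow> 'k::field falg" where
  "word_der i [] = 0"
| "word_der i (x # xs) = (if x = i then Poly_Mapping.single (FWord xs) 1 else 0) + gen x * word_der i xs"

text \<open>On a word, the sum over all occurrences of the letter i of the word with that occurrence
  deleted; this is the derivation of the free algebra with value 1 on \<open>gen i\<close> and 0 on
  the other generators.\<close>

definition der :: "nat \<Rightarrow> 'k::field falg \<Rightarrow> 'k falg" where
  "der i t = (\<Sum>w\<in>Poly_Mapping.keys t. scalar (Poly_Mapping.lookup t w) * word_der i (letters w))"

lemma der_add: "der i (x + y) = der i x + der i y"
  unfolding der_def
  by (rule setsum_keys_plus_distrib) (auto simp: scalar_add distrib_right)

lemma der_zero [simp]: "der i 0 = 0"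
  by (simp add: der_def)

lemma der_single: "der i (Poly_Mapping.single (FWord u) c) = scalar c * word_der i u"
  by (simp add: der_def)

lemma der_scalar_mult: "der i (scalar c * t) = scalar c * der i t"
proof (induction t rule: falg_induct)
  case (single w d)
  then show ?case
    by (cases w) (simp add: scalar_def mult_single der_single[unfolded scalar_def] mult.assoc[symmetric])
qed (auto simp: distrib_left der_add)

lemma der_uminus: "der i (- x) = - der i x"
  using der_scalar_mult[of i "-1" x] by (simp add: scalar_uminus)

lemma der_diff: "der i (x - y) = der i x - der i y"
  using der_add[of i x "-y"] by (simp add: der_uminus)

lemma der_sum: "der i (\<Sum>k\<in>A. f k) = (\<Sum>k\<in>A. der i (f k))"
  by (induction A rule: infinite_finite_induct) (auto simp: der_add)

lemma gen_mult_single: "gen x * Poly_Mapping.single (FWord u) c = Poly_Mapping.single (FWord (x # u)) c"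
  by (simp add: gen_def mult_single)

lemma word_der_append: "word_der i (u @ v) = word_der i u * Poly_Mapping.single (FWord v) 1 + Poly_Mapping.single (FWord u) 1 * word_der i v"
  by (induction u) (auto simp: mult_single algebra_simps gen_mult_single[symmetric] zero_fword_def[symmetric])

lemma der_mult: "der i (x * y) = der i x * y + x * der i y"
proof (induction x rule: falg_induct)
  case (single w c)
  show ?case
  proof (induction y rule: falg_induct)
    case (single w' d)
    obtain u v where uv: "w = FWord u" "w' = FWord v" by (cases w, cases w')
    have "der i (Poly_Mapping.single w c * Poly_Mapping.single w' d) = scalar c * (scalar d * word_der i (u @ v))"
      by (simp add: uv mult_single der_single scalar_mult mult.assoc)
    also have "\<dots> = (scalar c * word_der i u) * (scalar d * Poly_Mapping.single w' 1)
        + (scalar c * Poly_Mapping.single w 1) * (scalar d * word_der i v)"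
      by (simp add: word_der_append uv distrib_left mult.assoc scalar_left_commute[of "word_der i u" d]
          scalar_left_commute[of "Poly_Mapping.single (FWord u) 1" d])
    also have "\<dots> = der i (Poly_Mapping.single w c) * Poly_Mapping.single w' d
        + Poly_Mapping.single w c * der i (Poly_Mapping.single w' d)"
      by (simp add: uv der_single single_eq_scalar[symmetric])
    finally show ?case .
  qed (auto simp: distrib_left der_add algebra_simps)
qed (auto simp: distrib_right der_add algebra_simps)

lemma der_gen: "der i (gen j) = (if i = j then 1 else 0)"
  by (simp add: gen_def der_single zero_fword_def[symmetric])

lemma der_mult_gen: "der i (x * gen j) = der i x * gen j + (if i = j then x else 0)"
  by (simp add: der_mult der_gen)

lemma word_der_trunc: "set u \<subseteq> {..<n} \<Longrightarrow> (word_der i u :: 'k::field falg) \<in> trunc n (length u)"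
proof (induction u)
  case (Cons x xs)
  have "(gen x * word_der i xs :: 'k falg) \<in> trunc n (Suc (length xs))"
    using Cons by (intro trunc_mult_le[OF trunc_gen]) auto
  moreover have "(Poly_Mapping.single (FWord xs) 1 :: 'k falg) \<in> trunc n (Suc (length xs))"
    using Cons by (intro trunc_single) auto
  ultimately show ?case by auto
qed simp

lemma der_trunc: "x \<in> trunc n q \<Longrightarrow> der i x \<in> trunc n (q - 1)"
proof (induction x rule: trunc_induct)
  case (single u c)
  then have "length u \<le> q - 1" by linarith
  then show ?case
    unfolding der_single by (intro trunc_scalar_mult trunc_mono[OF word_der_trunc[OF single(1)]])
qed (auto simp: der_add)

text \<open>
  Annihilation and creation operators, acting on coordinates with respect to the basis \<open>e\<^sub>S\<close> of
  the exterior algebra; the sign of moving \<open>e\<^sub>i\<close> to its place in \<open>e\<^sub>S\<close> is kept as a negation, so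
  that coefficients may lie in any abelian group.
\<close>

definition sg :: "nat \<Rightarrow> nat set \<Rightarrow> 'm::ab_group_add \<Rightarrow> 'm" where
  "sg i S x = (if even (card {b\<in>S. b < i}) then x else - x)"

definition iota :: "nat \<Rightarrow> (nat set \<Rightarrow> 'm::ab_group_add) \<Rightarrow> nat set \<Rightarrow> 'm" where
  "iota i f S = (if i \<in> S then 0 else sg i S (f (insert i S)))"

definition eps :: "nat \<Rightarrow> (nat set \<Rightarrow> 'm::ab_group_add) \<Rightarrow> nat set \<Rightarrow> 'm" where
  "eps i f S = (if i \<in> S then sg i S (f (S - {i})) else 0)"

lemma sg_insert: "j \<notin> S \<Longrightarrow> sg i (insert j S) x = (if j < i then - sg i S x else sg i S x)"
proof -
  assume j: "j \<notin> S"
  have "{b \<in> insert j S. b < i} = (if j < i then insert j {b\<in>S. b < i} else {b\<in>S. b < i})" by auto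
  moreover have "finite {b\<in>S. b < i}" by simp
  ultimately show ?thesis using j by (simp add: sg_def)
qed

lemma sg_remove: "j \<in> S \<Longrightarrow> sg i (S - {j}) x = (if j < i then - sg i S x else sg i S x)"
  using sg_insert[of j "S - {j}" i x] by (auto simp: insert_absorb split: if_splits)

lemma sg_uminus [simp]: "sg i S (- x) = - sg i S x" and sg_zero [simp]: "sg i S 0 = 0"
  and sg_sg [simp]: "sg i S (sg i S x) = x" and sg_commute: "sg i S (sg j S' x) = sg j S' (sg i S x)"
  and sg_add: "sg i S (x + y) = sg i S x + sg i S y"
  by (auto simp: sg_def)

lemma iota_iota: "iota i (iota j f) S = - iota j (iota i f) S"
proof -
  have "insert i (insert j S) = insert j (insert i S)" by auto
  then show ?thesis
    by (cases i j rule: linorder_cases) (auto simp: iota_def sg_insert sg_commute)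
qed

lemma iota_iota_fun: "iota i (iota j f) = (\<lambda>S. - iota j (iota i f) S)"
  by (rule ext) (rule iota_iota)

lemma eps_eps: "eps i (eps j f) S = - eps j (eps i f) S"
proof -
  have "S - {i} - {j} = S - {j} - {i}" by auto
  then show ?thesis
    by (cases i j rule: linorder_cases) (auto simp: eps_def sg_remove sg_commute)
qed

text \<open>For i \<noteq> j exactly one of the two composites picks up an extra sign, depending on
  which index is smaller. Together with the diagonal case these are the canonical anticommutation
  relations.\<close>

lemma iota_eps: "iota i (eps j f) S = (if i = j then f S else 0) - eps j (iota i f) S"
proof (cases "i = j")
  case True
  then show ?thesis
    by (auto simp: iota_def eps_def sg_insert sg_remove insert_absorb)
next
  case False
  then have "insert i S - {j} = insert i (S - {j})" by auto
  then show ?thesis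
    using False
    by (cases i j rule: linorder_cases)
      (auto simp: iota_def eps_def sg_insert sg_remove sg_commute)
qed

lemma eps_iota_self: "eps i (iota i f) S = (if i \<in> S then f S else 0)"
  by (auto simp: iota_def eps_def sg_remove insert_absorb)

text \<open>Signs are negations, so every additive map commutes with them. This is applied to left
  and right multiplications and to the derivations.\<close>

lemma sg_hom:
  assumes "\<And>x y. h (x + y) = h x + h y"
  shows "sg i S (h x) = h (sg i S x)"
proof -
  have "h 0 = 0" using assms[of 0 0] by simp
  then have "h (- x) = - h x" using assms[of x "-x"] by (simp add: eq_neg_iff_add_eq_0 add.commute)
  then show ?thesis by (simp add: sg_def)
qed

lemma iota_hom:
  assumes "\<And>x y. h (x + y) = h x + h y"
  shows "iota i (\<lambda>S. h (f S)) S = h (iota i f S)"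
  using assms[of 0 0] by (simp add: iota_def sg_hom[of h, OF assms])

lemma eps_hom:
  assumes "\<And>x y. h (x + y) = h x + h y"
  shows "eps i (\<lambda>S. h (f S)) S = h (eps i f S)"
  using assms[of 0 0] by (simp add: eps_def sg_hom[of h, OF assms])

lemma iota_add: "iota i (\<lambda>S. f S + g S) S = iota i f S + iota i g S"
  and eps_add: "eps i (\<lambda>S. f S + g S) S = eps i f S + eps i g S"
  by (auto simp: iota_def eps_def sg_add)

lemma iota_zero [simp]: "iota i (\<lambda>S. 0) S = 0" and eps_zero [simp]: "eps i (\<lambda>S. 0) S = 0"
  by (auto simp: iota_def eps_def)

lemma iota_uminus: "iota i (\<lambda>S. - f S) S = - iota i f S"
  and eps_uminus: "eps i (\<lambda>S. - f S) S = - eps i f S"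
  by (auto simp: iota_def eps_def)

lemma iota_sum: "iota i (\<lambda>S. \<Sum>k\<in>A. f k S) S = (\<Sum>k\<in>A. iota i (f k) S)"
  by (induction A rule: infinite_finite_induct) (auto simp: iota_add)

lemma eps_sum: "eps i (\<lambda>S. \<Sum>k\<in>A. f k S) S = (\<Sum>k\<in>A. eps i (f k) S)"
  by (induction A rule: infinite_finite_induct) (auto simp: eps_add)

lemma iota_diff: "iota i (\<lambda>S. f S - g S) S = iota i f S - iota i g S"
  using iota_add[of i f "\<lambda>S. - g S" S] by (simp add: iota_uminus)
lemma eps_diff: "eps i (\<lambda>S. f S - g S) S = eps i f S - eps i g S"
  using eps_add[of i f "\<lambda>S. - g S" S] by (simp add: eps_uminus)

lemma iota_mult_right: "iota i (\<lambda>S. f S * (x::'r::ring)) S = iota i f S * x"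
  by (rule iota_hom) (simp add: distrib_right)
lemma eps_mult_right: "eps i (\<lambda>S. f S * (x::'r::ring)) S = eps i f S * x"
  by (rule eps_hom) (simp add: distrib_right)
lemma iota_mult_left: "iota i (\<lambda>S. (x::'r::ring) * f S) S = x * iota i f S"
  by (rule iota_hom) (simp add: distrib_left)
lemma eps_mult_left: "eps i (\<lambda>S. (x::'r::ring) * f S) S = x * eps i f S"
  by (rule eps_hom) (simp add: distrib_left)

text \<open>The elements of \<open>A \<otimes> \<and>\<^sup>m\<close>, extended by 0 to all index
  sets. This keeps the operators free of side conditions on S, in contrast to
  \<open>ext_module\<close>, whose elements are undefined off the index set.\<close>

definition supp :: "nat \<Rightarrow> nat \<Rightarrow> 'm::ab_group_add set \<Rightarrow> (nat set \<Rightarrow> 'm) \<Rightarrow> bool" where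
  "supp n m A f \<longleftrightarrow> (\<forall>S. f S \<in> A) \<and> (\<forall>S. S \<notin> ext_index n m \<longrightarrow> f S = 0)"

lemma ext_index_finite: "S \<in> ext_index n m \<Longrightarrow> finite S"
  by (auto simp: ext_index_def intro: finite_subset)

lemma supp_iota:
  assumes "supp n (Suc m) A f" "0 \<in> A" "\<And>x. x \<in> A \<Longrightarrow> - x \<in> A"
  shows "supp n m A (iota i f)"
proof -
  have "S \<in> ext_index n m" if "insert i S \<in> ext_index n (Suc m)" "i \<notin> S" for S
    using that finite_insert[of i S] ext_index_finite[OF that(1)] by (auto simp: ext_index_def)
  then show ?thesis using assms
    by (auto simp: supp_def iota_def sg_def)
qed

lemma supp_eps:
  assumes "supp n m A f" "0 \<in> A" "\<And>x. x \<in> A \<Longrightarrow> - x \<in> A" "i < n"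
  shows "supp n (Suc m) A (eps i f)"
proof -
  have "S \<in> ext_index n (Suc m)" if S: "S - {i} \<in> ext_index n m" "i \<in> S" for S
  proof -
    have "card S = Suc (card (S - {i}))"
      using S(2) ext_index_finite[OF S(1)] by (intro card.remove) auto
    then show ?thesis using S assms(4) by (auto simp: ext_index_def)
  qed
  then show ?thesis using assms
    by (auto simp: supp_def eps_def sg_def)
qed

section \<open>The Chevalley-Eilenberg differential over the free algebra\<close>

lemma iota_sum_fun: "iota i (\<lambda>S. \<Sum>k\<in>A. f k S) = (\<lambda>S. \<Sum>k\<in>A. iota i (f k) S)"
  and eps_sum_fun: "eps i (\<lambda>S. \<Sum>k\<in>A. f k S) = (\<lambda>S. \<Sum>k\<in>A. eps i (f k) S)"
  by (simp_all add: fun_eq_iff iota_sum eps_sum)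

lemma iota_add_fun: "iota i (\<lambda>S. f S + g S) = (\<lambda>S. iota i f S + iota i g S)"
  and eps_add_fun: "eps i (\<lambda>S. f S + g S) = (\<lambda>S. eps i f S + eps i g S)"
  by (simp_all add: fun_eq_iff iota_add eps_add)

lemma iota_mult_right_fun: "iota i (\<lambda>S. f S * (x::'r::ring)) = (\<lambda>S. iota i f S * x)"
  and eps_mult_right_fun: "eps i (\<lambda>S. f S * (x::'r::ring)) = (\<lambda>S. eps i f S * x)"
  and iota_mult_left_fun: "iota i (\<lambda>S. (x::'r::ring) * f S) = (\<lambda>S. x * iota i f S)"
  and eps_mult_left_fun: "eps i (\<lambda>S. (x::'r::ring) * f S) = (\<lambda>S. x * eps i f S)"
  by (simp_all add: fun_eq_iff iota_mult_right eps_mult_right iota_mult_left eps_mult_left)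

lemmas iota_eps_linear = iota_sum_fun eps_sum_fun iota_add_fun eps_add_fun
  iota_mult_right_fun eps_mult_right_fun iota_mult_left_fun eps_mult_left_fun

lemma sum_swap3:
  "(\<Sum>q\<in>A. \<Sum>a\<in>B. \<Sum>r\<in>C. \<Sum>s\<in>E. G q a r s) = (\<Sum>a\<in>B. \<Sum>r\<in>C. \<Sum>s\<in>E. \<Sum>q\<in>A. G q a r s)"
proof -
  have "(\<Sum>q\<in>A. \<Sum>a\<in>B. \<Sum>r\<in>C. \<Sum>s\<in>E. G q a r s) = (\<Sum>a\<in>B. \<Sum>q\<in>A. \<Sum>r\<in>C. \<Sum>s\<in>E. G q a r s)"
    by (rule sum.swap)
  also have "\<dots> = (\<Sum>a\<in>B. \<Sum>r\<in>C. \<Sum>q\<in>A. \<Sum>s\<in>E. G q a r s)"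
    by (rule sum.cong[OF refl], rule sum.swap)
  also have "\<dots> = (\<Sum>a\<in>B. \<Sum>r\<in>C. \<Sum>s\<in>E. \<Sum>q\<in>A. G q a r s)"
    by (rule sum.cong[OF refl], rule sum.cong[OF refl], rule sum.swap)
  finally show ?thesis .
qed

lemma sum_cycle:
  "(\<Sum>p\<in>A. \<Sum>r\<in>A. \<Sum>s\<in>A. G p r s) = (\<Sum>p\<in>A. \<Sum>r\<in>A. \<Sum>s\<in>A. G r s p)"
proof -
  have "(\<Sum>p\<in>A. \<Sum>r\<in>A. \<Sum>s\<in>A. G r s p) = (\<Sum>r\<in>A. \<Sum>p\<in>A. \<Sum>s\<in>A. G r s p)"
    by (rule sum.swap)
  also have "\<dots> = (\<Sum>r\<in>A. \<Sum>s\<in>A. \<Sum>p\<in>A. G r s p)"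
    by (rule sum.cong[OF refl], rule sum.swap)
  finally show ?thesis by simp
qed

lemma sum_triple:
  "(\<Sum>p\<in>A. \<Sum>q\<in>A. \<Sum>a\<in>A. F p q a) = (\<Sum>x\<in>A \<times> A \<times> A. F (fst x) (fst (snd x)) (snd (snd x)))"
  by (simp add: sum.cartesian_product case_prod_unfold)

lemma falg_double_zero:
  assumes "x + x = (0 :: 'k::field_char_0 falg)" shows "x = 0"
proof -
  have "scalar (1/2 :: 'k) * (x + x) = scalar (1/2 + 1/2) * x"
    by (simp only: scalar_add distrib_left distrib_right)
  then show ?thesis using assms by simp
qed

lemma falg_triple_zero:
  assumes "x + x + x = (0 :: 'k::field_char_0 falg)" shows "x = 0"
proof -
  have "scalar (1/3 :: 'k) * (x + x + x) = scalar (1/3 + 1/3 + 1/3) * x"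
    by (simp only: scalar_add distrib_left distrib_right)
  then show ?thesis using assms by simp
qed

lemma falg_half: "scalar (1/2 :: 'k::field_char_0) * (x + x) = x"
proof -
  have "scalar (1/2 :: 'k) * (x + x) = scalar (1/2 + 1/2) * x"
    by (simp only: scalar_add distrib_left distrib_right)
  then show ?thesis by simp
qed

text \<open>Moving \<open>eps b\<close> to the left past two annihilators leaves one contraction for
  each of them and a term in normal order.\<close>

lemma iota_eps_cubic:
  "eps a (iota p (iota q (eps b (iota r (iota s f))))) S =
    (if q = b then eps a (iota p (iota r (iota s f))) S else 0)
    - (if p = b then eps a (iota q (iota r (iota s f))) S else 0)
    + eps a (eps b (iota p (iota q (iota r (iota s f))))) S"
proof -
  let ?g = "iota r (iota s f)"
  have "iota p (iota q (eps b ?g)) = (\<lambda>S. (if q = b then iota p ?g S else 0)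
      - (if p = b then iota q ?g S else 0) + eps b (iota p (iota q ?g)) S)"
  proof
    fix S
    have "iota q (eps b ?g) = (\<lambda>S. (if q = b then ?g S else 0) - eps b (iota q ?g) S)"
      by (simp add: fun_eq_iff iota_eps)
    then have "iota p (iota q (eps b ?g)) S
        = iota p (\<lambda>S. if q = b then ?g S else 0) S - iota p (eps b (iota q ?g)) S"
      by (simp only: iota_diff)
    moreover have "iota p (\<lambda>S. if q = b then ?g S else 0) S = (if q = b then iota p ?g S else 0)"
      by simp
    ultimately show "iota p (iota q (eps b ?g)) S = (if q = b then iota p ?g S else 0)
      - (if p = b then iota q ?g S else 0) + eps b (iota p (iota q ?g)) S"
      by (simp add: iota_eps)
  qed
  then have "eps a (iota p (iota q (eps b ?g))) S
      = eps a (\<lambda>S. if q = b then iota p ?g S else 0) S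
        - eps a (\<lambda>S. if p = b then iota q ?g S else 0) S + eps a (eps b (iota p (iota q ?g))) S"
    by (simp add: eps_add eps_diff)
  then show ?thesis by (cases "q = b"; cases "p = b") auto
qed

text \<open>One operator passes two others with which it anticommutes, so the two signs
  cancel.\<close>

lemma iota_cycle: "iota r (iota s (iota p f)) = iota p (iota r (iota s f))"
proof -
  have "iota r (iota s (iota p f)) S = iota p (iota r (iota s f)) S" for S
    by (simp only: iota_iota_fun[of s p] iota_uminus iota_iota[of r p] minus_minus)
  then show ?thesis by (rule ext)
qed

lemma iota4_swap: "iota p (iota q (iota r (iota s f))) = iota r (iota s (iota p (iota q f)))"
proof -
  have "iota q (iota r (iota s f)) = iota r (iota s (iota q f))"
    by (simp add: iota_cycle)
  then show ?thesis by (simp add: iota_cycle)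
qed

section \<open>Subspaces and filtrations of the free algebra\<close>

definition linset :: "'k::field falg set \<Rightarrow> bool" where
  "linset B \<longleftrightarrow> 0 \<in> B \<and> (\<forall>x\<in>B. \<forall>y\<in>B. x + y \<in> B) \<and> (\<forall>c. \<forall>x\<in>B. scalar c * x \<in> B)"

lemma linset_zero: "linset B \<Longrightarrow> 0 \<in> B"
  and linset_add: "linset B \<Longrightarrow> x \<in> B \<Longrightarrow> y \<in> B \<Longrightarrow> x + y \<in> B"
  and linset_scalar: "linset B \<Longrightarrow> x \<in> B \<Longrightarrow> scalar c * x \<in> B"
  by (auto simp: linset_def)

lemma linset_uminus: "linset B \<Longrightarrow> x \<in> B \<Longrightarrow> - x \<in> B"
  using linset_scalar[of B x "-1"] by (simp add: scalar_uminus)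

lemma linset_diff: "linset B \<Longrightarrow> x \<in> B \<Longrightarrow> y \<in> B \<Longrightarrow> x - y \<in> B"
  using linset_add[of B x "- y"] linset_uminus[of B y] by simp

lemma linset_sum: "linset B \<Longrightarrow> (\<And>i. i \<in> A \<Longrightarrow> f i \<in> B) \<Longrightarrow> (\<Sum>i\<in>A. f i) \<in> B"
  by (induction A rule: infinite_finite_induct) (auto intro: linset_zero linset_add)

lemma linset_iota: "linset B \<Longrightarrow> (\<And>S. f S \<in> B) \<Longrightarrow> iota i f S \<in> B"
  and linset_eps: "linset B \<Longrightarrow> (\<And>S. f S \<in> B) \<Longrightarrow> eps i f S \<in> B"
  by (auto simp: iota_def eps_def sg_def intro: linset_zero linset_uminus)

lemma linset_trunc: "linset (trunc n q)"
  by (auto simp: linset_def)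

lemma linset_supp_iota: "linset A \<Longrightarrow> supp n (Suc m) A f \<Longrightarrow> supp n m A (iota i f)"
  and linset_supp_eps: "linset A \<Longrightarrow> supp n m A f \<Longrightarrow> i < n \<Longrightarrow> supp n (Suc m) A (eps i f)"
  by (auto intro: supp_iota supp_eps linset_zero linset_uminus)

lemma linset_supp_sum:
  "linset A \<Longrightarrow> (\<And>k. k \<in> K \<Longrightarrow> supp n m A (f k)) \<Longrightarrow> supp n m A (\<lambda>S. \<Sum>k\<in>K. f k S)"
  by (auto simp: supp_def intro: linset_sum)

text \<open>Abstracts what words of bounded length and relations of bounded length have in common,
  so that one degree count for the differential serves both. Level 0 has to vanish because of the
  truncated differences in the levels.\<close>

definition filt :: "nat \<Rightarrow> (nat \<Rightarrow> 'k::field falg set) \<Rightarrow> bool" where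
  "filt n A \<longleftrightarrow> A 0 = {0} \<and> (\<forall>q. linset (A q)) \<and> (\<forall>q. A q \<subseteq> A (Suc q)) \<and>
     (\<forall>q. \<forall>x\<in>A q. \<forall>i<n. x * gen i \<in> A (Suc q))"

lemma filt_mono: "filt n A \<Longrightarrow> x \<in> A p \<Longrightarrow> p \<le> q \<Longrightarrow> x \<in> A q"
  unfolding filt_def by (metis lift_Suc_mono_le subsetD)

lemma filt_gen:
  assumes "filt n A" "x \<in> A (q - Suc m)" "i < n"
  shows "x * gen i \<in> A (q - m)"
proof (cases "m < q")
  case True
  then have "Suc (q - Suc m) = q - m" by simp
  then show ?thesis using assms unfolding filt_def by metis
next
  case False
  \<comment> \<open>Here \<open>q - Suc m\<close> is truncated to 0.\<close>
  then have "x = 0" using assms unfolding filt_def by auto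
  then show ?thesis using assms unfolding filt_def by (auto intro: linset_zero)
qed

lemma filt_trunc: "filt n (trunc n)"
  unfolding filt_def using linset_trunc by (auto intro: trunc_mono trunc_mult_gen)

text \<open>The computations in the free algebra are made from structure constants alone. Both laws
  are assumed for arbitrary indices, so rewriting with them under sums has no side
  conditions.\<close>

locale lie_constants =
  fixes n :: nat and c :: "nat \<Rightarrow> nat \<Rightarrow> nat \<Rightarrow> 'k::field_char_0"
  assumes antisym: "c p q a = - c q p a"
    and jacobi_constants:
      "(\<Sum>b<n. c p b a * c r s b + c r b a * c s p b + c s b a * c p r b) = 0"
begin

definition rel :: "nat \<Rightarrow> nat \<Rightarrow> 'k falg" where
  "rel i j = gen i * gen j - gen j * gen i - (\<Sum>a<n. scalar (c i j a) * gen a)"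

definition koszul_lin :: "(nat set \<Rightarrow> 'k falg) \<Rightarrow> nat set \<Rightarrow> 'k falg" where
  "koszul_lin f = (\<lambda>S. \<Sum>i<n. iota i f S * gen i)"

text \<open>The sum runs over ordered pairs. Exchanging p and q changes the sign of the constant and
  of the product of annihilators, so every pair is counted twice; hence the factor 1/2.\<close>

definition koszul_bracket :: "(nat set \<Rightarrow> 'k falg) \<Rightarrow> nat set \<Rightarrow> 'k falg" where
  "koszul_bracket f = (\<lambda>S. \<Sum>p<n. \<Sum>q<n. \<Sum>a<n. scalar (c p q a / 2) * eps a (iota p (iota q f)) S)"

text \<open>A lift of the Koszul differential to the free algebra. It is left linear, and it is a
  differential only modulo the relations.\<close>

definition koszul_free :: "(nat set \<Rightarrow> 'k falg) \<Rightarrow> nat set \<Rightarrow> 'k falg" where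
  "koszul_free f = (\<lambda>S. koszul_lin f S + koszul_bracket f S)"

definition euler_htpy :: "(nat set \<Rightarrow> 'k falg) \<Rightarrow> nat set \<Rightarrow> 'k falg" where
  "euler_htpy f = (\<lambda>S. \<Sum>i<n. eps i (\<lambda>S. der i (f S)) S)"

lemma rel_swap: "rel j i = - rel i j"
proof -
  have "(\<Sum>a<n. scalar (c j i a) * gen a) = - (\<Sum>a<n. scalar (c i j a) * gen a)"
    by (subst antisym) (simp add: scalar_uminus sum_negf)
  then show ?thesis by (simp add: rel_def)
qed

text \<open>The product of operators is invariant under cyclic permutations of p, r, s. Averaging
  over the three rotations turns the products of constants into the Jacobi sum.\<close>

lemma koszul_bracket_cubic_zero:
  "(\<Sum>p<n. \<Sum>q<n. \<Sum>a<n. \<Sum>r<n. \<Sum>s<n. scalar (c p q a / 2) * (scalar (c r s q / 2) *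
     eps a (iota p (iota r (iota s f))) S)) = 0" (is "?E = 0")
proof -
  define Y where "Y a p r s = eps a (iota p (iota r (iota s f))) S" for a p r s
  define H where "H a p r s = (\<Sum>q<n. scalar (c p q a / 2) * (scalar (c r s q / 2) * Y a p r s))" for a p r s
  have cyc: "Y a r s p = Y a p r s" for a p r s
    by (simp add: Y_def iota_cycle[of r s p])
  have "?E = (\<Sum>p<n. \<Sum>a<n. \<Sum>r<n. \<Sum>s<n. H a p r s)"
    unfolding H_def Y_def by (rule sum.cong[OF refl], rule sum_swap3)
  also have "\<dots> = (\<Sum>a<n. \<Sum>p<n. \<Sum>r<n. \<Sum>s<n. H a p r s)"
    by (rule sum.swap)
  finally have E: "?E = (\<Sum>a<n. \<Sum>p<n. \<Sum>r<n. \<Sum>s<n. H a p r s)" .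
  have "(\<Sum>p<n. \<Sum>r<n. \<Sum>s<n. H a p r s) = 0" for a
  proof -
    let ?T = "\<Sum>p<n. \<Sum>r<n. \<Sum>s<n. H a p r s"
    have 1: "?T = (\<Sum>p<n. \<Sum>r<n. \<Sum>s<n. H a r s p)" by (rule sum_cycle)
    also have 2: "\<dots> = (\<Sum>p<n. \<Sum>r<n. \<Sum>s<n. H a s p r)"
      by (rule sum_cycle[of "\<lambda>p r s. H a r s p"])
    finally have 3: "?T = (\<Sum>p<n. \<Sum>r<n. \<Sum>s<n. H a s p r)" .
    have "H a p r s + H a r s p + H a s p r = 0" for p r s
    proof -
      have "H a p r s + H a r s p + H a s p r
          = (\<Sum>q<n. scalar ((c p q a * c r s q + c r q a * c s p q + c s q a * c p r q) / 4) * Y a p r s)"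
        by (simp add: H_def cyc cyc[of a r s p] mult.assoc[symmetric] scalar_mult[symmetric]
            sum.distrib[symmetric] distrib_right[symmetric] scalar_add[symmetric] add_divide_distrib[symmetric])
      also have "\<dots> = scalar ((\<Sum>q<n. c p q a * c r s q + c r q a * c s p q + c s q a * c p r q) / 4) * Y a p r s"
        by (simp only: sum_distrib_right[symmetric] scalar_sum[symmetric] sum_divide_distrib[symmetric])
      finally show ?thesis by (simp only: jacobi_constants) simp
    qed
    then have "(\<Sum>p<n. \<Sum>r<n. \<Sum>s<n. H a p r s + H a r s p + H a s p r) = 0" by simp
    then have "?T + (\<Sum>p<n. \<Sum>r<n. \<Sum>s<n. H a r s p) + (\<Sum>p<n. \<Sum>r<n. \<Sum>s<n. H a s p r) = 0"
      by (simp only: sum.distrib)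
    then have "?T + ?T + ?T = 0" using 1 3 by simp
    then show ?thesis by (rule falg_triple_zero)
  qed
  then show ?thesis using E by simp
qed

text \<open>Normal ordering leaves two contractions and a quartic term. Each contraction is, up to
  sign, the Jacobi expression \<open>E\<close>; the quartic term is odd under exchange of the two
  brackets.\<close>

lemma koszul_bracket_koszul_bracket: "koszul_bracket (koszul_bracket f) S = 0"
proof -
  define al where "al p q a = (scalar (c p q a / 2) :: 'k falg)" for p q a
  define Y where "Y a p r s = eps a (iota p (iota r (iota s f))) S" for a p r s
  define Z where "Z a b p q r s = eps a (eps b (iota p (iota q (iota r (iota s f))))) S" for a b p q r s
  define E where "E = (\<Sum>p<n. \<Sum>q<n. \<Sum>a<n. \<Sum>r<n. \<Sum>s<n. al p q a * (al r s q * Y a p r s))"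
  have E0: "E = 0" unfolding E_def al_def Y_def by (rule koszul_bracket_cubic_zero)
  have "koszul_bracket (koszul_bracket f) S = (\<Sum>p<n. \<Sum>q<n. \<Sum>a<n. al p q a * (\<Sum>r<n. \<Sum>s<n. \<Sum>b<n. al r s b *
      eps a (iota p (iota q (eps b (iota r (iota s f))))) S))"
    unfolding koszul_bracket_def al_def by (simp only: iota_eps_linear)
  also have "\<dots> = (\<Sum>p<n. \<Sum>q<n. \<Sum>a<n. \<Sum>r<n. \<Sum>s<n. \<Sum>b<n.
      (if q = b then al p q a * (al r s b * Y a p r s) else 0)
      - (if p = b then al p q a * (al r s b * Y a q r s) else 0) + al p q a * (al r s b * Z a b p q r s))"
    unfolding sum_distrib_left iota_eps_cubic Y_def Z_def
    by (intro sum.cong refl) (simp add: algebra_simps)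
  also have "\<dots> = (\<Sum>p<n. \<Sum>q<n. \<Sum>a<n. \<Sum>r<n. \<Sum>s<n. al p q a * (al r s q * Y a p r s))
      - (\<Sum>p<n. \<Sum>q<n. \<Sum>a<n. \<Sum>r<n. \<Sum>s<n. al p q a * (al r s p * Y a q r s))
      + (\<Sum>p<n. \<Sum>q<n. \<Sum>a<n. \<Sum>r<n. \<Sum>s<n. \<Sum>b<n. al p q a * (al r s b * Z a b p q r s))"
    by (simp add: sum.distrib sum_subtractf)
  also have "(\<Sum>p<n. \<Sum>q<n. \<Sum>a<n. \<Sum>r<n. \<Sum>s<n. al p q a * (al r s p * Y a q r s)) = - E"
  proof -
    have "al q p a = - al p q a" for p q a
      by (subst al_def, subst antisym) (simp add: al_def scalar_uminus)
    note anti = this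
    have "(\<Sum>p<n. \<Sum>q<n. \<Sum>a<n. \<Sum>r<n. \<Sum>s<n. al p q a * (al r s p * Y a q r s))
        = (\<Sum>p<n. \<Sum>q<n. \<Sum>a<n. \<Sum>r<n. \<Sum>s<n. al q p a * (al r s q * Y a p r s))"
      by (rule sum.swap)
    also have "\<dots> = (\<Sum>p<n. \<Sum>q<n. \<Sum>a<n. \<Sum>r<n. \<Sum>s<n. - (al p q a * (al r s q * Y a p r s)))"
      by (intro sum.cong refl) (subst anti, simp)
    finally show ?thesis by (simp add: E_def sum_negf)
  qed
  also have "(\<Sum>p<n. \<Sum>q<n. \<Sum>a<n. \<Sum>r<n. \<Sum>s<n. \<Sum>b<n. al p q a * (al r s b * Z a b p q r s)) = 0"
    (is "?Q = 0")
  proof -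
    define F where "F x y = al (fst x) (fst (snd x)) (snd (snd x)) * (al (fst y) (fst (snd y)) (snd (snd y)) *
        Z (snd (snd x)) (snd (snd y)) (fst x) (fst (snd x)) (fst y) (fst (snd y)))" for x y
    let ?N = "{..<n} \<times> {..<n} \<times> {..<n}"
    have F: "F y x = - F x y" for x y
    proof -
      \<comment> \<open>Exchanging the brackets moves two pairs of annihilators past each other,
        which costs no sign, and transposes the two creation operators, which costs one.\<close>
      have "Z b a r s p q = - Z a b p q r s" for a b p q r s
        unfolding Z_def by (subst eps_eps) (simp add: iota4_swap[of r s p q])
      note anti = this
      have comm: "al p q a * (al r s b * z) = al r s b * (al p q a * z)" for p q a r s b z
        unfolding al_def by (rule scalar_left_commute)
      show ?thesis
        unfolding F_def by (subst anti, unfold mult_minus_right, subst comm, rule refl)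
    qed
    have "(\<Sum>x\<in>?N. \<Sum>y\<in>?N. F y x) = (\<Sum>x\<in>?N. \<Sum>y\<in>?N. - F x y)"
      by (intro sum.cong refl) (rule F)
    then have "(\<Sum>x\<in>?N. \<Sum>y\<in>?N. F y x) = - (\<Sum>x\<in>?N. \<Sum>y\<in>?N. F x y)"
      by (simp only: sum_negf)
    moreover have "(\<Sum>x\<in>?N. \<Sum>y\<in>?N. F y x) = (\<Sum>x\<in>?N. \<Sum>y\<in>?N. F x y)"
      by (rule sum.swap)
    moreover have "?Q = (\<Sum>x\<in>?N. \<Sum>y\<in>?N. F x y)"
      unfolding F_def by (subst sum_triple[symmetric])+ simp
    ultimately have "?Q = - ?Q" by (simp only:)
    then have "?Q + ?Q = 0" by (simp only: eq_neg_iff_add_eq_0)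
    then show ?thesis by (rule falg_double_zero)
  qed
  finally show ?thesis using E0 by (simp add: E_def)
qed

lemma koszul_bracket_add: "koszul_bracket (\<lambda>S. f S + g S) S = koszul_bracket f S + koszul_bracket g S"
  unfolding koszul_bracket_def by (simp only: iota_eps_linear distrib_left sum.distrib)

lemma koszul_lin_add: "koszul_lin (\<lambda>S. f S + g S) S = koszul_lin f S + koszul_lin g S"
  unfolding koszul_lin_def by (simp only: iota_eps_linear distrib_right sum.distrib)

lemma koszul_free_add: "koszul_free (\<lambda>S. f S + g S) S = koszul_free f S + koszul_free g S"
  by (simp add: koszul_free_def koszul_lin_add koszul_bracket_add)

lemma koszul_free_mult_left: "koszul_free (\<lambda>S. u * f S) S = u * koszul_free f S"
proof -
  have "koszul_lin (\<lambda>S. u * f S) S = u * koszul_lin f S"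
    by (simp add: koszul_lin_def iota_eps_linear sum_distrib_left mult.assoc)
  moreover have "koszul_bracket (\<lambda>S. u * f S) S = u * koszul_bracket f S"
    by (simp add: koszul_bracket_def iota_eps_linear sum_distrib_left scalar_left_commute[of u])
  ultimately show ?thesis by (simp add: koszul_free_def distrib_left)
qed

lemma koszul_free_zero: "koszul_free (\<lambda>S. 0) S = 0"
  using koszul_free_mult_left[of 0 "\<lambda>S. 0" S] by simp

lemma koszul_free_uminus: "koszul_free (\<lambda>S. - f S) S = - koszul_free f S"
  using koszul_free_mult_left[of "-1" f S] by simp

lemma koszul_free_diff: "koszul_free (\<lambda>S. f S - g S) S = koszul_free f S - koszul_free g S"
  using koszul_free_add[of f "\<lambda>S. - g S" S] koszul_free_uminus[of g S] by simp

text \<open>The double right multiplication yields commutators, since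
  \<open>iota i (iota j f)\<close> is antisymmetric in i and j; the mixed terms supply the linear
  part of \<open>rel\<close> through the anticommutator of \<open>iota i\<close> with
  \<open>eps a\<close>; the Jacobi identity removes the rest.\<close>

lemma koszul_free_koszul_free: "koszul_free (koszul_free f) S = - (\<Sum>i<n. \<Sum>j<n. scalar (1/2) * (iota i (iota j f) S * rel i j))"
proof -
  define v where "v i j = iota i (iota j f) S" for i j
  have anti: "v j i = - v i j" for i j unfolding v_def by (rule iota_iota)
  have a: "koszul_lin (koszul_lin f) S = (\<Sum>i<n. \<Sum>j<n. v i j * (gen j * gen i))" (is "_ = ?T")
    by (simp add: koszul_lin_def v_def iota_eps_linear sum_distrib_right mult.assoc)
  have "?T = (\<Sum>i<n. \<Sum>j<n. v j i * (gen i * gen j))" by (rule sum.swap)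
  also have "\<dots> = (\<Sum>i<n. \<Sum>j<n. - v i j * (gen i * gen j))"
    by (intro sum.cong refl) (subst anti, rule refl)
  finally have "?T + ?T = (\<Sum>i<n. \<Sum>j<n. v i j * (gen j * gen i)) + (\<Sum>i<n. \<Sum>j<n. - v i j * (gen i * gen j))"
    by simp
  also have "\<dots> = (\<Sum>i<n. \<Sum>j<n. v i j * (gen j * gen i - gen i * gen j))"
    by (simp add: sum.distrib[symmetric] algebra_simps)
  finally have "?T + ?T = \<dots>" .
  then have T: "?T = scalar (1/2) * (\<Sum>i<n. \<Sum>j<n. v i j * (gen j * gen i - gen i * gen j))"
    using falg_half[of ?T] by simp
  \<comment> \<open>\<open>Z\<close> pairs the two orders of \<open>iota i\<close> and
    \<open>eps a\<close>, so that only the term with i = a survives.\<close>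
  define Z where "Z i p q a = scalar (c p q a / 2) * ((iota i (eps a (iota p (iota q f))) S
      + eps a (iota p (iota q (iota i f))) S) * gen i)" for i p q a
  have "koszul_lin (koszul_bracket f) S = (\<Sum>i<n. \<Sum>p<n. \<Sum>q<n. \<Sum>a<n. scalar (c p q a / 2) *
      (iota i (eps a (iota p (iota q f))) S * gen i))"
    by (simp add: koszul_lin_def koszul_bracket_def iota_eps_linear sum_distrib_right mult.assoc)
  moreover have "koszul_bracket (koszul_lin f) S = (\<Sum>p<n. \<Sum>q<n. \<Sum>a<n. \<Sum>i<n. scalar (c p q a / 2) *
      (eps a (iota p (iota q (iota i f))) S * gen i))"
    by (simp add: koszul_lin_def koszul_bracket_def iota_eps_linear sum_distrib_left)
  ultimately have "koszul_lin (koszul_bracket f) S + koszul_bracket (koszul_lin f) S = (\<Sum>p<n. \<Sum>q<n. \<Sum>a<n. \<Sum>i<n. Z i p q a)"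
    unfolding Z_def by (subst (asm) sum_swap3) (simp add: sum.distrib[symmetric] distrib_left distrib_right)
  also have "\<dots> = (\<Sum>p<n. \<Sum>q<n. \<Sum>a<n. scalar (c p q a / 2) * (v p q * gen a))"
  proof (intro sum.cong refl)
    fix p q a assume "a \<in> {..<n}"
    have "Z i p q a = (if i = a then scalar (c p q a / 2) * (v p q * gen a) else 0)" for i
      by (simp add: Z_def iota_eps v_def iota_cycle[of p q i])
    then show "(\<Sum>i<n. Z i p q a) = scalar (c p q a / 2) * (v p q * gen a)"
      using \<open>a \<in> _\<close> by simp
  qed
  also have "\<dots> = scalar (1/2) * (\<Sum>p<n. \<Sum>q<n. v p q * (\<Sum>a<n. scalar (c p q a) * gen a))"
    by (unfold sum_distrib_left, intro sum.cong refl)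
      (simp add: mult.assoc[symmetric] scalar_mult[symmetric] scalar_commute[of "v _ _"])
  finally have b: "koszul_lin (koszul_bracket f) S + koszul_bracket (koszul_lin f) S = \<dots>" .
  have "koszul_free (koszul_free f) S = koszul_lin (koszul_lin f) S + (koszul_lin (koszul_bracket f) S + koszul_bracket (koszul_lin f) S) + koszul_bracket (koszul_bracket f) S"
    unfolding koszul_free_def[of "koszul_free f"] by (simp add: koszul_free_def[of f] koszul_lin_add koszul_bracket_add)
  also have "\<dots> = scalar (1/2) * (\<Sum>i<n. \<Sum>j<n. v i j * (gen j * gen i - gen i * gen j)
      + v i j * (\<Sum>a<n. scalar (c i j a) * gen a))"
    by (simp add: koszul_bracket_koszul_bracket a T b distrib_left sum.distrib)
  also have "\<dots> = scalar (1/2) * (\<Sum>i<n. \<Sum>j<n. - (v i j * rel i j))"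
    by (simp add: rel_def algebra_simps)
  finally show ?thesis by (simp add: v_def sum_negf sum_distrib_left)
qed

end

section \<open>The Euler homotopy and the filtered relations\<close>

context lie_constants
begin

text \<open>An identity in the free algebra itself. The Leibniz rule for the right factor
  \<open>gen i\<close> and the anticommutation of \<open>iota i\<close> with \<open>eps j\<close>
  make the mixed second-order terms cancel. What remains counts letters and exterior degree; the
  bracket terms have lost a letter and become negligible later.\<close>

lemma euler_exact:
  "koszul_free (euler_htpy f) S + euler_htpy (koszul_free f) S = (\<Sum>i<n. der i (f S) * gen i) + (\<Sum>i<n. eps i (iota i f) S)
     + koszul_bracket (euler_htpy f) S + euler_htpy (koszul_bracket f) S"
proof -
  have der_iota: "der i (iota j f S) = iota j (\<lambda>S. der i (f S)) S" for i j S
    by (rule iota_hom[symmetric]) (rule der_add)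
  have "koszul_lin (euler_htpy f) S = (\<Sum>i<n. \<Sum>j<n. iota i (eps j (\<lambda>S. der j (f S))) S * gen i)"
    by (simp add: koszul_lin_def euler_htpy_def iota_eps_linear sum_distrib_right)
  also have "\<dots> = (\<Sum>i<n. \<Sum>j<n. (if i = j then der j (f S) * gen i else 0)
      - eps j (iota i (\<lambda>S. der j (f S))) S * gen i)"
    by (intro sum.cong refl) (simp add: iota_eps left_diff_distrib)
  also have "\<dots> = (\<Sum>i<n. der i (f S) * gen i)
      - (\<Sum>i<n. \<Sum>j<n. eps j (iota i (\<lambda>S. der j (f S))) S * gen i)"
    by (simp add: sum_subtractf)
  finally have 1: "koszul_lin (euler_htpy f) S = \<dots>" .
  have "euler_htpy (koszul_lin f) S = (\<Sum>j<n. eps j (\<lambda>S. \<Sum>i<n. der j (iota i f S) * gen i + (if j = i then iota i f S else 0)) S)"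
    by (simp add: euler_htpy_def koszul_lin_def der_sum der_mult_gen)
  also have "\<dots> = (\<Sum>j<n. \<Sum>i<n. eps j (iota i (\<lambda>S. der j (f S))) S * gen i + eps j (\<lambda>S. if j = i then iota i f S else 0) S)"
    unfolding der_iota by (simp only: iota_eps_linear)
  also have "\<dots> = (\<Sum>j<n. \<Sum>i<n. eps j (iota i (\<lambda>S. der j (f S))) S * gen i)
      + (\<Sum>j<n. \<Sum>i<n. if j = i then eps j (iota j f) S else 0)"
    unfolding sum.distrib[symmetric] by (intro sum.cong refl) auto
  also have "(\<Sum>j<n. \<Sum>i<n. eps j (iota i (\<lambda>S. der j (f S))) S * gen i)
      = (\<Sum>i<n. \<Sum>j<n. eps j (iota i (\<lambda>S. der j (f S))) S * gen i)"
    by (rule sum.swap)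
  finally have 2: "euler_htpy (koszul_lin f) S = (\<Sum>i<n. \<Sum>j<n. eps j (iota i (\<lambda>S. der j (f S))) S * gen i)
      + (\<Sum>j<n. eps j (iota j f) S)"
    by simp
  have "euler_htpy (koszul_free f) S = euler_htpy (koszul_lin f) S + euler_htpy (koszul_bracket f) S"
    by (simp add: euler_htpy_def koszul_free_def der_add eps_add_fun sum.distrib)
  then show ?thesis using 1 2 by (simp add: koszul_free_def)
qed

text \<open>\<open>eps i (iota i f)\<close> projects onto the basis vectors that contain i, so the
  sum is the number operator of the exterior algebra.\<close>

lemma sum_eps_iota:
  assumes "S \<subseteq> {..<n}"
  shows "(\<Sum>i<n. eps i (iota i f) S) = scalar (of_nat (card S)) * f S"
proof -
  have "(\<Sum>i<n. eps i (iota i f) S) = (\<Sum>i\<in>{..<n} \<inter> S. f S)"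
    unfolding eps_iota_self by (rule sum.inter_restrict[symmetric]) simp
  also have "{..<n} \<inter> S = S" using assms by auto
  also have "(\<Sum>i\<in>S. f S) = scalar (of_nat (card S)) * f S"
    by (simp add: scalar_def single_of_nat)
  finally show ?thesis .
qed

text \<open>
  The relations \<open>u\<cdot>r\<cdot>v\<close> of word length less than \<open>q\<close>. The Poincare-Birkhoff-Witt theorem is the
  statement that no further relation of length less than \<open>q\<close> arises from longer ones.
\<close>

inductive_set relid :: "nat \<Rightarrow> 'k falg set" for q where
  relid_zero: "0 \<in> relid q"
| relid_step: "x \<in> relid q \<Longrightarrow> i < n \<Longrightarrow> j < n \<Longrightarrow> set u \<subseteq> {..<n} \<Longrightarrow> set v \<subseteq> {..<n} \<Longrightarrow>
    length u + length v + 2 < q \<Longrightarrow>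
    x + Poly_Mapping.single (FWord u) a * rel i j * Poly_Mapping.single (FWord v) 1 \<in> relid q"

lemma relid_add:
  assumes "x \<in> relid q" "y \<in> relid q" shows "x + y \<in> relid q"
  using assms(2)
proof (induction y rule: relid.induct)
  case (relid_step y i j u v a)
  then show ?case
    using relid.relid_step[of "x + y" q i j u v a] by (simp add: add.assoc)
qed (simp add: assms)

lemma relid_word:
  "i < n \<Longrightarrow> j < n \<Longrightarrow> set u \<subseteq> {..<n} \<Longrightarrow> set v \<subseteq> {..<n} \<Longrightarrow> length u + length v + 2 < q \<Longrightarrow>
    Poly_Mapping.single (FWord u) a * rel i j * Poly_Mapping.single (FWord v) 1 \<in> relid q"
  using relid_step[OF relid_zero, of i j u v q a] by simp

lemma scalar_mult_single: "scalar d * Poly_Mapping.single w a = Poly_Mapping.single w (d * a)"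
  by (simp add: scalar_def mult_single)

lemma relid_scalar: "x \<in> relid q \<Longrightarrow> scalar d * x \<in> relid q"
proof (induction x rule: relid.induct)
  case (relid_step x i j u v a)
  then show ?case
    using relid_add[OF relid_step.IH relid_word[of i j u v q "d * a"]]
    by (simp add: distrib_left mult.assoc[symmetric] scalar_mult_single)
qed (auto intro: relid_zero)

lemma linset_relid: "linset (relid q)"
  by (auto simp: linset_def intro: relid_zero relid_add relid_scalar)

lemma relid_mono: "x \<in> relid p \<Longrightarrow> p \<le> q \<Longrightarrow> x \<in> relid q"
  by (induction x rule: relid.induct) (auto intro: relid_zero relid_step)

lemma relid_mult_gen: "x \<in> relid q \<Longrightarrow> k < n \<Longrightarrow> x * gen k \<in> relid (Suc q)"
proof (induction x rule: relid.induct)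
  case (relid_step x i j u v a)
  have "Poly_Mapping.single (FWord u) a * rel i j * Poly_Mapping.single (FWord (v @ [k])) 1 \<in> relid (Suc q)"
    using relid_step by (intro relid_word) auto
  then show ?case
    using relid_step by (auto simp: distrib_right mult.assoc gen_def mult_single intro: relid_add)
qed (auto intro: relid_zero)

lemma relid_0: "relid 0 = {0}"
proof -
  have "x = 0" if "x \<in> relid 0" for x using that by (induction x rule: relid.induct) auto
  then show ?thesis by (auto intro: relid_zero)
qed

lemma filt_relid: "filt n relid"
  unfolding filt_def by (auto simp: relid_0 linset_relid intro: relid_mono relid_mult_gen)

lemma relid_words:
  assumes "x \<in> trunc n p" "y \<in> trunc n r" "p + r < q" "i < n" "j < n"
  shows "x * rel i j * y \<in> relid q"
  using assms(1)
proof (induction x rule: trunc_induct)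
  case (single u a)
  show ?case
    using assms(2)
  proof (induction y rule: trunc_induct)
    case (single v b)
    have "Poly_Mapping.single (FWord u) (b * a) * rel i j * Poly_Mapping.single (FWord v) 1 \<in> relid q"
      using single \<open>length u < p\<close> \<open>set u \<subseteq> _\<close> assms by (intro relid_word) auto
    moreover have "Poly_Mapping.single (FWord u) a * rel i j * Poly_Mapping.single (FWord v) b
      = scalar b * (Poly_Mapping.single (FWord u) a * rel i j * Poly_Mapping.single (FWord v) 1)"
      by (subst single_eq_scalar[of "FWord v"]) (rule scalar_left_commute)
    ultimately show ?case
      by (simp add: mult.assoc[symmetric] scalar_mult_single)
  qed (auto simp: distrib_left intro: relid_zero relid_add)
qed (auto simp: distrib_right intro: relid_zero relid_add)

lemma relid_trunc_rel: "x \<in> trunc n (q - 2) \<Longrightarrow> i < n \<Longrightarrow> j < n \<Longrightarrow> x * rel i j \<in> relid q"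
proof (induction x rule: trunc_induct)
  case (single u a)
  then show ?case using relid_word[of i j u "[]" q a] by (simp flip: zero_fword_def)
qed (auto simp: distrib_right intro: relid_zero relid_add)

text \<open>In a generator \<open>u r v\<close> either v is empty, and the generator contributes to
  \<open>w\<close>, or its last letter k can be split off, and what is left is a shorter generator
  contributing to \<open>t k\<close>.\<close>

lemma relid_decomposition:
  assumes "x \<in> relid q"
  shows "\<exists>w t. (\<forall>i j. w i j \<in> trunc n (q - 2)) \<and> (\<forall>k. t k \<in> relid (q - 1)) \<and>
    x = (\<Sum>i<n. \<Sum>j<n. w i j * rel i j) + (\<Sum>k<n. t k * gen k)"
  using assms
proof (induction x rule: relid.induct)
  case relid_zero
  show ?case by (intro exI[of _ "\<lambda>_ _. 0"] exI[of _ "\<lambda>_. 0"]) (auto intro: relid.relid_zero)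
next
  case (relid_step x i j u v a)
  then obtain w t where wt: "\<forall>i j. w i j \<in> trunc n (q - 2)" "\<forall>k. t k \<in> relid (q - 1)"
    "x = (\<Sum>i<n. \<Sum>j<n. w i j * rel i j) + (\<Sum>k<n. t k * gen k)" by blast
  let ?u = "Poly_Mapping.single (FWord u) a"
  show ?case
  proof (cases v rule: rev_cases)
    case Nil
    define w' where "w' k l = w k l + (if k = i then if l = j then ?u else 0 else 0)" for k l
    have "?u \<in> trunc n (q - 2)" using relid_step Nil by (intro trunc_single) auto
    then have "\<forall>k l. w' k l \<in> trunc n (q - 2)" using wt(1) by (auto simp: w'_def)
    moreover have "(\<Sum>k<n. \<Sum>l<n. w' k l * rel k l) = (\<Sum>i<n. \<Sum>j<n. w i j * rel i j) + ?u * rel i j"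
    proof -
      have "w' k l * rel k l = w k l * rel k l + (if k = i then if l = j then ?u * rel i j else 0 else 0)" for k l
        by (auto simp: w'_def distrib_right)
      then have "(\<Sum>k<n. \<Sum>l<n. w' k l * rel k l) = (\<Sum>k<n. \<Sum>l<n. w k l * rel k l)
          + (\<Sum>k<n. \<Sum>l<n. if k = i then if l = j then ?u * rel i j else 0 else 0)"
        by (simp only: sum.distrib)
      also have "(\<Sum>k<n. \<Sum>l<n. if k = i then if l = j then ?u * rel i j else 0 else 0)
          = (\<Sum>k<n. if k = i then \<Sum>l<n. if l = j then ?u * rel i j else 0 else 0)"
        by (intro sum.cong refl) auto
      finally show ?thesis using relid_step by simp
    qed
    ultimately show ?thesis
      using wt Nil by (intro exI[of _ w'] exI[of _ t]) (simp add: add_ac flip: zero_fword_def)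
  next
    case (snoc v' k)
    define y where "y = ?u * rel i j * Poly_Mapping.single (FWord v') 1"
    define t' where "t' l = t l + (if l = k then y else 0)" for l
    have "y \<in> relid (q - 1)" unfolding y_def using relid_step snoc by (intro relid_word) auto
    then have "\<forall>l. t' l \<in> relid (q - 1)" using wt(2) by (auto simp: t'_def intro: relid_add)
    moreover have "(\<Sum>l<n. t' l * gen l) = (\<Sum>l<n. t l * gen l) + y * gen k"
    proof -
      have "t' l * gen l = t l * gen l + (if l = k then y * gen k else 0)" for l
        by (auto simp: t'_def distrib_right)
      then show ?thesis using relid_step snoc by (simp add: sum.distrib)
    qed
    moreover have "?u * rel i j * Poly_Mapping.single (FWord v) 1 = y * gen k"
      by (simp add: y_def snoc gen_def mult_single mult.assoc)
    ultimately show ?thesis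
      using wt by (intro exI[of _ w] exI[of _ t']) (simp add: add_ac)
  qed
qed

text \<open>Level q of \<open>relid\<close> concerns words of length at most q - 1; adding
  \<open>trunc n (q - 1)\<close> ignores everything below that top length. Statements on leading
  terms are made modulo this space.\<close>

definition relid_lower :: "nat \<Rightarrow> 'k falg set" where
  "relid_lower q = {x + y | x y. x \<in> relid q \<and> y \<in> trunc n (q - 1)}"

lemma relid_lowerI: "x \<in> relid q \<Longrightarrow> y \<in> trunc n (q - 1) \<Longrightarrow> x + y \<in> relid_lower q"
  by (auto simp: relid_lower_def)

lemma relid_lower_relid: "x \<in> relid q \<Longrightarrow> x \<in> relid_lower q"
  and relid_lower_trunc: "y \<in> trunc n (q - 1) \<Longrightarrow> y \<in> relid_lower q"
  using relid_lowerI[of x q 0] relid_lowerI[of 0 q y] relid_zero by auto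

lemma linset_relid_lower: "linset (relid_lower q)"
  unfolding linset_def
proof (intro conjI ballI allI)
  show "0 \<in> relid_lower q" by (rule relid_lower_relid[OF relid_zero])
next
  fix x y assume "x \<in> relid_lower q" "y \<in> relid_lower q"
  then obtain a b a' b' where "x = a + b" "y = a' + b'" "a \<in> relid q" "a' \<in> relid q"
    "b \<in> trunc n (q - 1)" "b' \<in> trunc n (q - 1)"
    by (auto simp: relid_lower_def)
  then show "x + y \<in> relid_lower q"
    using relid_lowerI[of "a + a'" q "b + b'"] by (auto simp: relid_add add_ac)
next
  fix d x assume "x \<in> relid_lower q"
  then show "scalar d * x \<in> relid_lower q"
    by (auto simp: relid_lower_def distrib_left) (metis relid_scalar trunc_scalar_mult)
qed

text \<open>A derivation with scalar values on the generators kills their commutators, so only the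
  linear part contributes.\<close>

lemma der_rel: "i < n \<Longrightarrow> der i (rel j k) = - scalar (c j k i)"
proof -
  assume "i < n"
  have "der i (\<Sum>a<n. scalar (c j k a) * gen a) = (\<Sum>a<n. if a = i then scalar (c j k a) else 0)"
    unfolding der_sum by (intro sum.cong refl) (simp add: der_scalar_mult der_gen)
  then show ?thesis
    using \<open>i < n\<close> by (simp add: rel_def der_diff der_mult der_gen)
qed

text \<open>By the Leibniz rule the derivative of \<open>u r v\<close> either deletes a letter of u
  or v, leaving a relation one letter shorter, or falls on r and leaves a multiple of the word
  \<open>u v\<close>, which lies below the leading length of the new level.\<close>

lemma der_relid: "x \<in> relid q \<Longrightarrow> i < n \<Longrightarrow> der i x \<in> relid_lower (q - 1)"
proof (induction x rule: relid.induct)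
  case (relid_step x j k u v a)
  let ?u = "Poly_Mapping.single (FWord u) a" and ?v = "Poly_Mapping.single (FWord v) (1::'k)"
  have u: "der i ?u \<in> trunc n (length u)" "?u \<in> trunc n (Suc (length u))"
    unfolding der_single using relid_step by (auto intro!: trunc_scalar_mult word_der_trunc trunc_single)
  have v: "der i ?v \<in> trunc n (length v)" "?v \<in> trunc n (Suc (length v))"
    unfolding der_single using relid_step by (auto intro!: trunc_scalar_mult word_der_trunc trunc_single)
  have "der i ?u * rel j k * ?v \<in> relid (q - 1)"
    by (rule relid_words[OF u(1) v(2)]) (use relid_step in auto)
  moreover have "?u * rel j k * der i ?v \<in> relid (q - 1)"
    by (rule relid_words[OF u(2) v(1)]) (use relid_step in auto)
  moreover have "- (scalar (c j k i) * (?u * ?v)) \<in> trunc n (q - 1 - 1)"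
    by (intro trunc_uminus trunc_scalar_mult trunc_mult_le[OF u(2) v(2)]) (use relid_step in auto)
  ultimately have "der i ?u * rel j k * ?v + ?u * rel j k * der i ?v - scalar (c j k i) * (?u * ?v)
      \<in> relid_lower (q - 1)"
    unfolding diff_conv_add_uminus by (blast intro: relid_lowerI relid_add)
  moreover have "der i (?u * rel j k * ?v)
      = der i ?u * rel j k * ?v + ?u * rel j k * der i ?v - scalar (c j k i) * (?u * ?v)"
    using relid_step.prems
    by (simp add: der_mult der_rel algebra_simps scalar_left_commute[of ?u])
  ultimately show ?case
    using relid_step by (simp add: der_add linset_add[OF linset_relid_lower])
qed (auto intro: linset_zero[OF linset_relid_lower])

lemma der_relid_lower: "x \<in> relid_lower q \<Longrightarrow> i < n \<Longrightarrow> der i x \<in> relid_lower (q - 1)"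
  using der_relid relid_lower_trunc[OF der_trunc]
  by (fastforce simp: relid_lower_def[of q] der_add intro: linset_add[OF linset_relid_lower])

text \<open>Modulo commutators and shorter words, \<open>\<Sum>\<^sub>i \<partial>\<^sub>i(t) e\<^sub>i\<close> counts the letters of \<open>t\<close>.\<close>

lemma sum_der_gen_word:
  "set u \<subseteq> {..<n} \<Longrightarrow> (\<Sum>i<n. der i (Poly_Mapping.single (FWord u) 1) * gen i)
     - scalar (of_nat (length u)) * Poly_Mapping.single (FWord u) 1 \<in> relid_lower (Suc (length u))"
proof (induction u rule: rev_induct)
  case Nil
  then show ?case by (auto simp: der_single intro: linset_zero[OF linset_relid_lower])
next
  case (snoc k u)
  let ?u = "Poly_Mapping.single (FWord u) (1::'k)" and ?q = "Suc (length (u @ [k]))"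
  have k: "k < n" using snoc.prems by simp
  have us: "Poly_Mapping.single (FWord (u @ [k])) 1 = ?u * gen k" by (simp add: gen_def mult_single)
  have du: "der i ?u \<in> trunc n (length u)" for i
    unfolding der_single using snoc.prems by (auto intro!: trunc_scalar_mult word_der_trunc)
  obtain a b where ab: "(\<Sum>i<n. der i ?u * gen i) - scalar (of_nat (length u)) * ?u = a + b"
    "a \<in> relid (Suc (length u))" "b \<in> trunc n (length u)"
    using snoc by (auto simp: relid_lower_def)
  \<comment> \<open>The factor \<open>gen i\<close> arrives to the right of the new letter k;
    bringing k back to the right end costs a relation and a bracket.\<close>
  have "der i (?u * gen k) * gen i = der i ?u * gen i * gen k + (der i ?u * rel k i
      + der i ?u * (\<Sum>a<n. scalar (c k i a) * gen a)) + (if i = k then ?u * gen k else 0)" for i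
    by (simp add: der_mult_gen rel_def algebra_simps)
  then have "(\<Sum>i<n. der i (?u * gen k) * gen i) = (\<Sum>i<n. der i ?u * gen i) * gen k
      + (\<Sum>i<n. der i ?u * rel k i + der i ?u * (\<Sum>a<n. scalar (c k i a) * gen a)) + ?u * gen k"
    using k by (simp add: sum.distrib sum_distrib_right)
  also have "(\<Sum>i<n. der i ?u * gen i) = scalar (of_nat (length u)) * ?u + (a + b)"
    using ab(1) by (simp add: algebra_simps)
  finally have "(\<Sum>i<n. der i (?u * gen k) * gen i) - scalar (of_nat (length (u @ [k]))) * (?u * gen k)
    = (a * gen k + b * gen k) + (\<Sum>i<n. der i ?u * rel k i + der i ?u * (\<Sum>a<n. scalar (c k i a) * gen a))"
    by (simp add: scalar_add algebra_simps)
  moreover have "a * gen k + b * gen k \<in> relid_lower ?q"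
    using relid_mult_gen[OF ab(2) k] trunc_mult_gen[OF ab(3) k] by (intro relid_lowerI) auto
  moreover have "der i ?u * rel k i + der i ?u * (\<Sum>a<n. scalar (c k i a) * gen a) \<in> relid_lower ?q"
    if "i < n" for i
  proof (rule relid_lowerI)
    show "der i ?u * rel k i \<in> relid ?q"
      using du[of i] that k by (intro relid_trunc_rel) auto
    have "(\<Sum>a<n. scalar (c k i a) * gen a) \<in> trunc n 2"
      by (auto intro!: trunc_scalar_mult trunc_gen)
    then show "der i ?u * (\<Sum>a<n. scalar (c k i a) * gen a) \<in> trunc n (?q - 1)"
      by (intro trunc_mult_le[OF du]) auto
  qed
  ultimately show ?case
    unfolding us using linset_relid_lower by (metis (no_types, lifting) linset_add linset_sum lessThan_iff)
qed

lemma relid_lower_mono: "x \<in> relid_lower p \<Longrightarrow> p \<le> q \<Longrightarrow> x \<in> relid_lower q"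
  by (auto simp: relid_lower_def) (metis diff_le_mono relid_mono trunc_mono)

text \<open>Only words of the top length p - 1 need the right eigenvalue; for shorter ones the error
  is a multiple of the word itself, which \<open>relid_lower\<close> absorbs.\<close>

lemma sum_der_gen:
  assumes "t \<in> trunc n p"
  shows "(\<Sum>i<n. der i t * gen i) - scalar (of_nat p - 1) * t \<in> relid_lower p"
  using assms
proof (induction t rule: trunc_induct)
  case (single u a)
  let ?u = "Poly_Mapping.single (FWord u) (1::'k)" and ?l = "of_nat (length u) :: 'k"
  have "(\<Sum>i<n. der i ?u * gen i) - scalar ?l * ?u \<in> relid_lower p"
    using relid_lower_mono[OF sum_der_gen_word[OF single(1)]] single(2) by simp
  moreover have "scalar (?l - (of_nat p - 1)) * ?u \<in> relid_lower p"
  proof (cases "Suc (length u) = p")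
    case True
    then have "?l - (of_nat p - 1) = 0" by (auto simp flip: True)
    then show ?thesis by (simp only: scalar_zero mult_zero_left) (rule linset_zero[OF linset_relid_lower])
  next
    case False
    then show ?thesis
      using single by (intro relid_lower_trunc trunc_scalar_mult trunc_single) auto
  qed
  ultimately have "((\<Sum>i<n. der i ?u * gen i) - scalar ?l * ?u) + scalar (?l - (of_nat p - 1)) * ?u \<in> relid_lower p"
    by (rule linset_add[OF linset_relid_lower])
  then have "(\<Sum>i<n. der i ?u * gen i) - scalar (of_nat p - 1) * ?u \<in> relid_lower p"
    by (simp add: scalar_add scalar_uminus diff_conv_add_uminus distrib_right del: add_uminus_conv_diff)
  then have "scalar a * ((\<Sum>i<n. der i ?u * gen i) - scalar (of_nat p - 1) * ?u) \<in> relid_lower p"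
    by (rule linset_scalar[OF linset_relid_lower])
  then show ?case
    unfolding single_eq_scalar[of _ a] der_scalar_mult
    by (simp add: right_diff_distrib sum_distrib_left mult.assoc scalar_left_commute[of "scalar a"])
next
  case (add x y)
  then show ?case
    using linset_add[OF linset_relid_lower add] by (simp add: der_add algebra_simps sum.distrib)
qed (auto intro: linset_zero[OF linset_relid_lower])

end

section \<open>The Poincare-Birkhoff-Witt theorem and exactness\<close>

lemma linset_UNIV: "linset UNIV"
  by (simp add: linset_def)

lemma sg_empty: "sg i {} x = x"
  by (simp add: sg_def)

lemma sg_singleton: "sg i {j} x = (if j < i then - x else x)"
  using sg_insert[of j "{}" i x] by (simp add: sg_empty)

lemma lookup_gen_zero: "Poly_Mapping.lookup (gen k) 0 = 0"
  by (simp add: gen_def lookup_single zero_fword_def)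

lemma lookup_mult_zero:
  "Poly_Mapping.lookup (y * z) 0 = Poly_Mapping.lookup y 0 * Poly_Mapping.lookup (z :: 'k::field falg) 0"
proof (induction y rule: falg_induct)
  case (single w c)
  show ?case
  proof (induction z rule: falg_induct)
    case (single w' d)
    then show ?case by (cases w, cases w') (auto simp: mult_single lookup_single zero_fword_def when_def)
  qed (auto simp: distrib_left lookup_add)
qed (auto simp: distrib_right lookup_add)

context lie_constants
begin

section \<open>Behaviour of the operators with respect to total degree\<close>

lemma koszul_bracket_linset: "linset B \<Longrightarrow> (\<And>S. f S \<in> B) \<Longrightarrow> koszul_bracket f S \<in> B"
  unfolding koszul_bracket_def by (intro linset_sum linset_scalar linset_eps linset_iota)

lemma euler_htpy_linset: "linset B \<Longrightarrow> (\<And>S i. i < n \<Longrightarrow> der i (f S) \<in> B) \<Longrightarrow> euler_htpy f S \<in> B"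
  unfolding euler_htpy_def by (intro linset_sum linset_eps) auto

text \<open>Level \<open>q - m\<close> in exterior degree m stands for total degree below q: the
  linear part trades an exterior factor for a letter, the bracket part only loses an exterior
  factor.\<close>

lemma koszul_free_filt:
  assumes A: "filt n A" and f: "\<And>S. f S \<in> A (q - Suc m)"
  shows "koszul_free f S \<in> A (q - m)"
proof -
  have lin: "linset (A p)" for p using A by (simp add: filt_def)
  have "koszul_lin f S \<in> A (q - m)"
    unfolding koszul_lin_def
    by (intro linset_sum[OF lin] filt_gen[OF A] linset_iota[OF lin] f) simp
  moreover have "koszul_bracket f S \<in> A (q - m)"
    by (intro koszul_bracket_linset[OF lin] filt_mono[OF A f]) simp
  ultimately show ?thesis unfolding koszul_free_def by (rule linset_add[OF lin])
qed

lemma supp_koszul_free: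
  assumes "supp n (Suc m) UNIV f"
  shows "supp n m UNIV (koszul_free f)"
proof -
  note iota = linset_supp_iota[OF linset_UNIV] and eps = linset_supp_eps[OF linset_UNIV]
  show ?thesis
  proof (cases m)
    \<comment> \<open>From exterior degree 1 the bracket cannot remove two vectors, so it is shown
      to vanish separately; counting degrees would pass through a negative one.\<close>
    case 0
    have i0: "S \<in> ext_index n 0" if "iota i f S \<noteq> 0" for i S
      using iota[OF assms] that 0 by (auto simp: supp_def)
    have e0: "eps a (iota p (iota q f)) S = 0" for a p q S
    proof -
      have "S' \<in> ext_index n 0" if "iota q f S' \<noteq> 0" for S'
        using iota[OF assms] that 0 by (auto simp: supp_def)
      then have "iota q f (insert p S') = 0" for S'
        using ext_index_finite[of "insert p S'" n 0] by (fastforce simp: ext_index_def)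
      then have "iota p (iota q f) = (\<lambda>S. 0)" by (auto simp: iota_def[of p])
      then show ?thesis by simp
    qed
    have "koszul_free f S = 0" if "S \<notin> ext_index n 0" for S
    proof -
      have "iota i f S = 0" for i using that i0 by blast
      then show ?thesis using e0 by (simp add: koszul_free_def koszul_lin_def koszul_bracket_def)
    qed
    then show ?thesis using 0 by (simp add: supp_def)
  next
    case (Suc l)
    have "supp n m UNIV (\<lambda>S. iota i f S * gen i)" for i
      using iota[OF assms, of i] by (auto simp: supp_def)
    then have 1: "supp n m UNIV (koszul_lin f)"
      unfolding koszul_lin_def by (intro linset_supp_sum[OF linset_UNIV])
    have "supp n m UNIV (\<lambda>S. scalar (c p q a / 2) * eps a (iota p (iota q f)) S)" if "a < n" for p q a
    proof -
      have "supp n l UNIV (iota p (iota q f))" using assms Suc iota by blast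
      from eps[OF this that] show ?thesis using Suc by (auto simp: supp_def)
    qed
    then have 2: "supp n m UNIV (koszul_bracket f)"
      unfolding koszul_bracket_def by (intro linset_supp_sum[OF linset_UNIV]) auto
    show ?thesis using 1 2 by (auto simp: koszul_free_def supp_def)
  qed
qed

lemma supp_euler_htpy:
  assumes "supp n m UNIV f"
  shows "supp n (Suc m) UNIV (euler_htpy f)"
proof -
  have "supp n m UNIV (\<lambda>S. der i (f S))" for i using assms by (auto simp: supp_def)
  then show ?thesis
    unfolding euler_htpy_def by (intro linset_supp_sum[OF linset_UNIV] linset_supp_eps[OF linset_UNIV]) auto
qed

lemma koszul_free_empty: "koszul_free f {} = (\<Sum>k<n. f {k} * gen k)"
  by (simp add: koszul_free_def koszul_lin_def koszul_bracket_def eps_def iota_def sg_def)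

lemma koszul_free_koszul_free_relid:
  assumes "\<And>S. f S \<in> trunc n (q - 2)" shows "koszul_free (koszul_free f) S \<in> relid q"
  unfolding koszul_free_koszul_free
  by (intro linset_uminus[OF linset_relid] linset_sum[OF linset_relid] relid_scalar
      relid_trunc_rel linset_iota[OF linset_trunc] assms) auto

text \<open>The eigenvalue q is the sum of the letter count \<open>q - m\<close> from
  \<open>sum_der_gen\<close> and the exterior degree m from \<open>sum_eps_iota\<close>. The two
  bracket terms fall below the top length because of the derivative in
  \<open>euler_htpy\<close>.\<close>

lemma euler:
  assumes "supp n m (trunc n (Suc q - m)) f"
  shows "scalar (of_nat q) * f S - koszul_free (euler_htpy f) S - euler_htpy (koszul_free f) S \<in> relid_lower (Suc q - m)"
proof (cases "m \<le> q")
  case False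
  then have "f = (\<lambda>S. 0)" using assms by (auto simp: supp_def)
  moreover from this have "euler_htpy f = (\<lambda>S. 0)" by (simp add: euler_htpy_def)
  ultimately show ?thesis
    by (simp add: koszul_free_zero euler_htpy_def linset_zero[OF linset_relid_lower])
next
  case True
  let ?p = "Suc q - m"
  have f: "f S \<in> trunc n ?p" for S using assms by (simp add: supp_def)
  have q: "of_nat q = (of_nat ?p - 1 + of_nat m :: 'k)"
    using True by (simp add: of_nat_diff Suc_diff_le)
  have deg: "(\<Sum>i<n. eps i (iota i f) S) = scalar (of_nat m) * f S"
  proof (cases "S \<in> ext_index n m")
    case True
    then show ?thesis using sum_eps_iota[of S f] by (auto simp: ext_index_def)
  next
    case False
    then have "f S = 0" using assms by (simp add: supp_def)
    then show ?thesis by (simp add: eps_iota_self cong: if_cong)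
  qed
  have euler_htpy: "euler_htpy f S \<in> trunc n (?p - 1)" for S
    by (intro euler_htpy_linset[OF linset_trunc] der_trunc f)
  have "koszul_bracket (euler_htpy f) S \<in> relid_lower ?p"
    by (intro relid_lower_trunc koszul_bracket_linset[OF linset_trunc] euler_htpy)
  moreover have "euler_htpy (koszul_bracket f) S \<in> relid_lower ?p"
    by (intro relid_lower_trunc euler_htpy_linset[OF linset_trunc] der_trunc koszul_bracket_linset[OF linset_trunc] f)
  ultimately have "- (((\<Sum>i<n. der i (f S) * gen i) - scalar (of_nat ?p - 1) * f S)
      + (koszul_bracket (euler_htpy f) S + euler_htpy (koszul_bracket f) S)) \<in> relid_lower ?p"
    using sum_der_gen[OF f]
    by (intro linset_uminus[OF linset_relid_lower] linset_add[OF linset_relid_lower]) auto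
  moreover have "scalar (of_nat q) * f S - koszul_free (euler_htpy f) S - euler_htpy (koszul_free f) S
      = - (((\<Sum>i<n. der i (f S) * gen i) - scalar (of_nat ?p - 1) * f S)
      + (koszul_bracket (euler_htpy f) S + euler_htpy (koszul_bracket f) S))"
    using euler_exact[of f S] unfolding deg q scalar_add distrib_right
    by (simp add: algebra_simps)
  ultimately show ?thesis by simp
qed

text \<open>The homotopy applied to d f is negligible by assumption, so d of the homotopy of f is q
  times f up to lower terms, and characteristic 0 permits division by q. The assumption is put on
  the derivatives of d f, the form in which both applications provide it.\<close>

lemma euler_preimage:
  assumes f: "supp n m (trunc n (Suc q - m)) f" and q: "0 < q"
    and cycle: "\<And>S i. i < n \<Longrightarrow> der i (koszul_free f S) \<in> relid_lower (Suc q - m)"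
  obtains y where "supp n (Suc m) (trunc n (q - m)) y"
    and "\<And>S. f S - koszul_free y S \<in> relid_lower (Suc q - m)"
proof
  define y where "y = (\<lambda>S. scalar (1 / of_nat q) * euler_htpy f S)"
  have "supp n m UNIV f" using f by (simp add: supp_def)
  then have "supp n (Suc m) UNIV (euler_htpy f)" by (rule supp_euler_htpy)
  moreover have "euler_htpy f S \<in> trunc n (Suc q - m - 1)" for S
    using f by (intro euler_htpy_linset[OF linset_trunc] der_trunc) (simp add: supp_def)
  ultimately show "supp n (Suc m) (trunc n (q - m)) y"
    by (auto simp: supp_def y_def)
  fix S
  have "euler_htpy (koszul_free f) S \<in> relid_lower (Suc q - m)"
    by (rule euler_htpy_linset[OF linset_relid_lower cycle])
  then have "scalar (of_nat q) * f S - koszul_free (euler_htpy f) S \<in> relid_lower (Suc q - m)"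
    using linset_add[OF linset_relid_lower euler[OF f, of S], of "euler_htpy (koszul_free f) S"] by simp
  then have "scalar (1 / of_nat q) * (scalar (of_nat q) * f S - koszul_free (euler_htpy f) S) \<in> relid_lower (Suc q - m)"
    by (rule linset_scalar[OF linset_relid_lower])
  moreover have "scalar (1 / of_nat q) * (scalar (of_nat q) * f S) = f S"
    using q by (simp add: mult.assoc[symmetric] scalar_mult[symmetric])
  ultimately show "f S - koszul_free y S \<in> relid_lower (Suc q - m)"
    by (simp add: right_diff_distrib y_def koszul_free_mult_left)
qed

text \<open>Strictness of the filtration of the ideal: long words may cancel in a combination of
  relations, but the result is then a combination of shorter relations already. The induction
  hypothesis is applied to the coefficients in front of the last letters.\<close>

theorem relid_Suc_trunc: "x \<in> relid (Suc q) \<Longrightarrow> x \<in> trunc n q \<Longrightarrow> x \<in> relid q"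
proof (induction q arbitrary: x)
  case 0
  then show ?case by (simp add: relid_zero)
next
  case (Suc q)
  obtain w t where w: "\<And>i j. w i j \<in> trunc n q" and t: "\<And>k. t k \<in> relid (Suc q)"
    and x: "x = (\<Sum>i<n. \<Sum>j<n. w i j * rel i j) + (\<Sum>k<n. t k * gen k)"
    using relid_decomposition[OF Suc.prems(1)] by auto
  \<comment> \<open>Since \<open>rel\<close> is antisymmetric, only the antisymmetric part of w
    matters; it is stored in exterior degree 2, where \<open>Min\<close> and \<open>Max\<close>
    recover i < j from the set.\<close>
  define f where "f S = (if S \<in> ext_index n 2 then w (Min S) (Max S) - w (Max S) (Min S) else 0)" for S
  have f: "supp n 2 (trunc n (Suc (Suc q) - 2)) f"
    using w by (auto simp: supp_def f_def)
  have ff: "iota i (iota j f) {} = w j i - w i j" if "i < n" "j < n" for i j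
  proof (cases i j rule: linorder_cases)
    case less
    then have "f {j, i} = w i j - w j i" using that by (auto simp: f_def ext_index_def)
    then show ?thesis using less by (simp add: iota_def sg_singleton sg_empty)
  next
    case equal
    then show ?thesis by (simp add: iota_def)
  next
    case greater
    then have "f {j, i} = w j i - w i j" using that by (auto simp: f_def ext_index_def)
    then show ?thesis using greater by (simp add: iota_def sg_singleton sg_empty)
  qed
  \<comment> \<open>At the empty set, d multiplies the components at singletons by their letters.
    The sum of the \<open>w i j * rel i j\<close> is thus \<open>d (d f)\<close>, and it acquires
    last letters like the other part of x.\<close>
  have ww: "(\<Sum>k<n. koszul_free f {k} * gen k) = (\<Sum>i<n. \<Sum>j<n. w i j * rel i j)" (is "_ = ?W")
  proof -
    have "(\<Sum>k<n. koszul_free f {k} * gen k) = koszul_free (koszul_free f) {}" by (simp add: koszul_free_empty)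
    also have "\<dots> = - (\<Sum>i<n. \<Sum>j<n. scalar (1/2) * ((w j i - w i j) * rel i j))"
      unfolding koszul_free_koszul_free using ff by simp
    also have "\<dots> = scalar (1/2) * (?W - (\<Sum>i<n. \<Sum>j<n. w j i * rel i j))"
      by (simp add: sum_distrib_left algebra_simps sum_subtractf)
    also have "(\<Sum>i<n. \<Sum>j<n. w j i * rel i j) = (\<Sum>i<n. \<Sum>j<n. - (w i j * rel i j))"
      by (subst sum.swap) (intro sum.cong refl, subst rel_swap, simp)
    finally show ?thesis using falg_half[of ?W] by (simp add: sum_negf)
  qed
  define v where "v k = koszul_free f {k} + t k" for k
  have xv: "x = (\<Sum>k<n. v k * gen k)"
    by (simp add: x v_def ww[symmetric] distrib_right sum.distrib)
  \<comment> \<open>The length bound on x passes to the coefficients of the last letters. Hence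
    \<open>d f\<close> agrees with \<open>- t\<close> on singletons up to words of length below q,
    so it is a combination of relations to leading order.\<close>
  have v: "v k \<in> trunc n q" if "k < n" for k
    using trunc_coefficients[of v n "Suc q" k] Suc.prems(2) that by (simp add: xv)
  have "koszul_free f S \<in> relid_lower (Suc q)" for S
  proof (cases "\<exists>k<n. S = {k}")
    case True
    then obtain k where k: "k < n" "S = {k}" by blast
    have "- t k + v k \<in> relid_lower (Suc q)"
      using v[OF k(1)] by (intro relid_lowerI linset_uminus[OF linset_relid] t) simp
    then show ?thesis by (simp add: k v_def)
  next
    case False
    have "supp n 1 UNIV (koszul_free f)" by (rule supp_koszul_free) (use f in \<open>auto simp: supp_def numeral_2_eq_2\<close>)
    moreover have "S \<notin> ext_index n 1"
      using False by (auto simp: ext_index_def card_1_singleton_iff)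
    ultimately have "koszul_free f S = 0" by (simp add: supp_def)
    then show ?thesis by (simp add: linset_zero[OF linset_relid_lower])
  qed
  then have "der i (koszul_free f S) \<in> relid_lower (Suc (Suc q) - 2)" if "i < n" for i S
    using der_relid_lower[of _ "Suc q" i] that by simp
  \<comment> \<open>The homotopy is used in total degree q + 1, which is positive, and exterior
    degree 2.\<close>
  then obtain y where y: "supp n 3 (trunc n (Suc q - 2)) y"
    and fy: "\<And>S. f S - koszul_free y S \<in> relid_lower q"
    using euler_preimage[OF f] by (auto simp: numeral_3_eq_3 numeral_2_eq_2)
  obtain j w' where jw: "\<And>S. f S - koszul_free y S = j S + w' S" "\<And>S. j S \<in> relid q" "\<And>S. w' S \<in> trunc n (q - 1)"
    using fy unfolding relid_lower_def by (auto simp: choice_iff) metis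
  have kf: "koszul_free f S = koszul_free (koszul_free y) S + (koszul_free j S + koszul_free w' S)" for S
  proof -
    have "f = (\<lambda>S. koszul_free y S + (j S + w' S))" by (simp add: jw(1)[symmetric])
    then have "koszul_free f S = koszul_free (\<lambda>S. koszul_free y S + (j S + w' S)) S" by (rule arg_cong)
    then show ?thesis by (simp only: koszul_free_add)
  qed
  \<comment> \<open>Subtracting \<open>d w'\<close> leaves relations of level q + 1 whose words are
    nevertheless short, which is the situation of the induction hypothesis.\<close>
  have "v k - koszul_free w' {k} \<in> relid q" if "k < n" for k
  proof (rule Suc.IH)
    have "koszul_free (koszul_free y) {k} + koszul_free j {k} + t k \<in> relid (Suc q)"
      using y jw koszul_free_filt[OF filt_relid, of j "Suc q" 0] t
      by (intro relid_add koszul_free_koszul_free_relid) (auto simp: supp_def)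
    then show "v k - koszul_free w' {k} \<in> relid (Suc q)"
      by (simp add: v_def kf algebra_simps)
    show "v k - koszul_free w' {k} \<in> trunc n q"
      using v[OF that] koszul_free_filt[OF filt_trunc, of w' q 0] jw by (intro trunc_diff) auto
  qed
  then have "(\<Sum>k<n. (v k - koszul_free w' {k}) * gen k) \<in> relid (Suc q)"
    by (intro linset_sum[OF linset_relid] relid_mult_gen) auto
  \<comment> \<open>The subtracted terms add up to \<open>d (d w')\<close>, which consists of
    relations that are short because w' is.\<close>
  moreover have "koszul_free (koszul_free w') {} \<in> relid (Suc q)"
    using jw(3) by (intro koszul_free_koszul_free_relid) simp
  ultimately have "(\<Sum>k<n. (v k - koszul_free w' {k}) * gen k) + koszul_free (koszul_free w') {} \<in> relid (Suc q)"
    by (rule relid_add)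
  then show ?case
    by (simp add: xv koszul_free_empty left_diff_distrib sum_subtractf)
qed

lemma rel_lookup_zero: "Poly_Mapping.lookup (rel i j) 0 = 0"
  by (simp add: rel_def lookup_minus lookup_sum lookup_gen_zero lookup_mult_zero)

lemma relid_lookup_zero: "x \<in> relid q \<Longrightarrow> Poly_Mapping.lookup x 0 = 0"
  by (induction x rule: relid.induct) (auto simp: lookup_add lookup_mult_zero rel_lookup_zero)

text \<open>The last hypothesis is the augmentation: a nonzero constant in exterior degree 0 is a
  cycle but no boundary. The levels of y and of the remainder are recorded because the induction on
  total degree adds up such corrections.\<close>

theorem relid_exact:
  assumes "supp n m (trunc n (q - m)) x"
    and "\<And>S. koszul_free x S \<in> relid (Suc q - m)"
    and "m = 0 \<Longrightarrow> Poly_Mapping.lookup (x {}) 0 = 0"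
  shows "\<exists>y. supp n (Suc m) (trunc n (q - Suc m)) y \<and> (\<forall>S. x S - koszul_free y S \<in> relid (q - m))"
  using assms
proof (induction q arbitrary: x)
  case 0
  then have "x S = 0" for S by (simp add: supp_def)
  then show ?case
    by (intro exI[of _ "\<lambda>S. 0"]) (simp add: koszul_free_zero supp_def relid_zero)
next
  case (Suc q)
  show ?case
  proof (cases "q = 0")
    \<comment> \<open>In total degree 0 the homotopy would divide by 0. Only a constant in exterior
      degree 0 is left, and the augmentation kills it.\<close>
    case True
    have "x S = 0" for S
    proof (cases "S \<in> ext_index n m")
      case S: True
      have xS: "x S \<in> trunc n (1 - m)" using Suc.prems(1) True by (simp add: supp_def)
      show ?thesis
      proof (cases m)
        case 0
        then have "S = {}" using S ext_index_finite[OF S] by (auto simp: ext_index_def)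
        then have "Poly_Mapping.lookup (x S) 0 = 0" using Suc.prems(3) 0 by simp
        moreover have "w = 0" if "w \<in> Poly_Mapping.keys (x S)" for w
          using xS 0 that by (cases w) (auto simp: trunc_def zero_fword_def)
        ultimately show ?thesis by (intro poly_mapping_eqI) (metis in_keys_iff lookup_zero)
      qed (use xS in simp)
    qed (use Suc.prems(1) in \<open>simp add: supp_def\<close>)
    then show ?thesis
      by (intro exI[of _ "\<lambda>S. 0"]) (simp add: koszul_free_zero supp_def relid_zero)
  next
    case False
    have "der i (koszul_free x S) \<in> relid_lower (Suc q - m)" if "i < n" for i S
    proof -
      have "der i (koszul_free x S) \<in> relid_lower (Suc (Suc q) - m - 1)"
        by (intro der_relid Suc.prems(2) that)
      then show ?thesis by simp
    qed
    then obtain y0 where y0: "supp n (Suc m) (trunc n (q - m)) y0"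
      and xy: "\<And>S. x S - koszul_free y0 S \<in> relid_lower (Suc q - m)"
      using euler_preimage[OF Suc.prems(1)] False by blast
    have sxy: "x S - koszul_free y0 S = 0" if "S \<notin> ext_index n m" for S
      using Suc.prems(1) supp_koszul_free[of m y0] y0 that by (simp add: supp_def)
    \<comment> \<open>The lower part b is made to vanish off the index set, so that the new element
      is again supported in exterior degree m.\<close>
    have "\<exists>a b. x S - koszul_free y0 S = a + b \<and> a \<in> relid (Suc q - m) \<and> b \<in> trunc n (q - m) \<and>
        (S \<notin> ext_index n m \<longrightarrow> b = 0)" for S
    proof (cases "S \<in> ext_index n m")
      case True
      then show ?thesis using xy[of S] by (auto simp: relid_lower_def)
    next
      case False
      then show ?thesis using sxy[OF False] relid_zero by (intro exI[of _ 0]) auto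
    qed
    then obtain j x' where jx: "\<And>S. x S - koszul_free y0 S = j S + x' S" "\<And>S. j S \<in> relid (Suc q - m)"
      "\<And>S. x' S \<in> trunc n (q - m)" "\<And>S. S \<notin> ext_index n m \<Longrightarrow> x' S = 0"
      by metis
    have x': "x' = (\<lambda>S. x S - (koszul_free y0 S + j S))" using jx(1) by (simp add: fun_eq_iff algebra_simps)
    have "koszul_free (koszul_free y0) S \<in> relid (Suc (Suc q) - m)" for S
      using y0 by (intro koszul_free_koszul_free_relid) (simp add: supp_def)
    moreover have "koszul_free j S \<in> relid (Suc (Suc q) - m)" for S
      using jx(2) by (intro koszul_free_filt[OF filt_relid]) simp
    moreover have "koszul_free x' S = koszul_free x S - (koszul_free (koszul_free y0) S + koszul_free j S)" for S
      by (simp add: x' koszul_free_diff koszul_free_add)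
    ultimately have 1: "koszul_free x' S \<in> relid (Suc (Suc q) - m)" for S
      using Suc.prems(2) by (simp add: relid_add linset_diff[OF linset_relid])
    have 2: "koszul_free x' S \<in> trunc n (Suc q - m)" for S
      using jx(3) by (intro koszul_free_filt[OF filt_trunc]) simp
    \<comment> \<open>So far \<open>d x'\<close> is a relation one level too high; its words are
      short, and \<open>relid_Suc_trunc\<close> brings it down. This is where exactness depends on
      the Poincare-Birkhoff-Witt theorem.\<close>
    have "koszul_free x' S \<in> relid (Suc q - m)" for S
    proof (cases "m \<le> Suc q")
      case True
      then have "koszul_free x' S \<in> relid (Suc (Suc q - m))" using 1[of S] by (simp add: Suc_diff_le)
      then show ?thesis using 2 by (rule relid_Suc_trunc)
    next
      case False
      then show ?thesis using 2[of S] by (simp add: relid_zero)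
    qed
    moreover have "supp n m (trunc n (q - m)) x'"
      using jx by (simp add: supp_def)
    moreover have "Poly_Mapping.lookup (x' {}) 0 = 0" if "m = 0"
      using Suc.prems(3) that relid_lookup_zero[OF jx(2)]
      by (simp add: x' lookup_minus lookup_add koszul_free_empty lookup_sum lookup_mult_zero lookup_gen_zero)
    ultimately obtain y' where y': "supp n (Suc m) (trunc n (q - Suc m)) y'"
      "\<And>S. x' S - koszul_free y' S \<in> relid (q - m)"
      using Suc.IH[of x'] by blast
    have "supp n (Suc m) (trunc n (Suc q - Suc m)) (\<lambda>S. y0 S + y' S)"
      using y0 y'(1) by (auto simp: supp_def intro!: trunc_add elim!: allE intro: trunc_mono[of _ n "q - Suc m"])
    moreover have "x S - koszul_free (\<lambda>S. y0 S + y' S) S \<in> relid (Suc q - m)" for S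
    proof -
      have "x S - koszul_free (\<lambda>S. y0 S + y' S) S = j S + (x' S - koszul_free y' S)"
        using jx(1)[of S] by (simp add: koszul_free_add algebra_simps)
      then show ?thesis
        using jx(2) relid_mono[OF y'(2)] by (auto intro: relid_add)
    qed
    ultimately show ?thesis by blast
  qed
qed

end

section \<open>Reductions modulo h\<close>

lemma finsum_additive:
  assumes "abelian_group M" "abelian_group L"
    and f: "f \<in> carrier M \<rightarrow> carrier L"
    and add: "\<And>x y. x \<in> carrier M \<Longrightarrow> y \<in> carrier M \<Longrightarrow> f (x \<oplus>\<^bsub>M\<^esub> y) = f x \<oplus>\<^bsub>L\<^esub> f y"
    and g: "g \<in> A \<rightarrow> carrier M"
  shows "f (finsum M g A) = finsum L (\<lambda>i. f (g i)) A" and "f \<zero>\<^bsub>M\<^esub> = \<zero>\<^bsub>L\<^esub>"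
proof -
  interpret M: abelian_group M by fact
  interpret L: abelian_group L by fact
  have "f \<zero>\<^bsub>M\<^esub> \<in> carrier L" using f by auto
  moreover have "f \<zero>\<^bsub>M\<^esub> \<oplus>\<^bsub>L\<^esub> f \<zero>\<^bsub>M\<^esub> = f \<zero>\<^bsub>M\<^esub>"
    using add[of "\<zero>\<^bsub>M\<^esub>" "\<zero>\<^bsub>M\<^esub>"] by simp
  ultimately show z: "f \<zero>\<^bsub>M\<^esub> = \<zero>\<^bsub>L\<^esub>"
    by (metis L.add.r_cancel_one)
  show "f (finsum M g A) = finsum L (\<lambda>i. f (g i)) A"
    using g
  proof (induction A rule: infinite_finite_induct)
    case (insert a A)
    then have "g a \<in> carrier M" "g \<in> A \<rightarrow> carrier M" by auto
    moreover have "(\<lambda>i. f (g i)) \<in> A \<rightarrow> carrier L" "f (g a) \<in> carrier L"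
      using f calculation by auto
    ultimately show ?case
      using insert add by (simp add: M.finsum_insert L.finsum_insert M.finsum_closed)
  qed (auto simp: z)
qed

text \<open>
  An abelian group with an injective endomorphism \<open>\<eta>\<close>, to be thought of as multiplication by
  \<open>h\<close>, and its reduction \<open>p : M \<rightarrow> M / \<eta> M\<close>.
\<close>

locale hred = M: abelian_group M + C: abelian_group C
  for M :: "('m, 'x) ring_scheme" and \<eta> :: "'m \<Rightarrow> 'm" and p :: "'m \<Rightarrow> 'c"
    and C :: "('c, 'y) ring_scheme" +
  assumes eta_closed: "x \<in> carrier M \<Longrightarrow> \<eta> x \<in> carrier M"
    and eta_add: "x \<in> carrier M \<Longrightarrow> y \<in> carrier M \<Longrightarrow> \<eta> (x \<oplus>\<^bsub>M\<^esub> y) = \<eta> x \<oplus>\<^bsub>M\<^esub> \<eta> y"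
    and eta_inj: "x \<in> carrier M \<Longrightarrow> y \<in> carrier M \<Longrightarrow> \<eta> x = \<eta> y \<Longrightarrow> x = y"
    and p_closed: "x \<in> carrier M \<Longrightarrow> p x \<in> carrier C"
    and p_add: "x \<in> carrier M \<Longrightarrow> y \<in> carrier M \<Longrightarrow> p (x \<oplus>\<^bsub>M\<^esub> y) = p x \<oplus>\<^bsub>C\<^esub> p y"
    and p_surj: "c \<in> carrier C \<Longrightarrow> \<exists>x\<in>carrier M. p x = c"
    and p_zero_iff: "x \<in> carrier M \<Longrightarrow> p x = \<zero>\<^bsub>C\<^esub> \<longleftrightarrow> (\<exists>y\<in>carrier M. x = \<eta> y)"
begin

lemma eta_zero: "\<eta> \<zero>\<^bsub>M\<^esub> = \<zero>\<^bsub>M\<^esub>"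
  by (rule finsum_additive(2)[OF M.abelian_group_axioms M.abelian_group_axioms, of _ "\<lambda>_. \<zero>\<^bsub>M\<^esub>" "{}"])
    (auto simp: eta_closed eta_add)

lemma p_zero: "p \<zero>\<^bsub>M\<^esub> = \<zero>\<^bsub>C\<^esub>"
  using p_zero_iff[of "\<zero>\<^bsub>M\<^esub>"] eta_zero by force

lemma p_eta: "x \<in> carrier M \<Longrightarrow> p (\<eta> x) = \<zero>\<^bsub>C\<^esub>"
  using p_zero_iff[of "\<eta> x"] eta_closed by blast

lemma p_minus: "x \<in> carrier M \<Longrightarrow> p (\<ominus>\<^bsub>M\<^esub> x) = \<ominus>\<^bsub>C\<^esub> p x"
  using p_add[of "\<ominus>\<^bsub>M\<^esub> x" x] p_zero p_closed
  by (simp add: M.l_neg C.minus_equality)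

lemma eta_minus: "x \<in> carrier M \<Longrightarrow> \<eta> (\<ominus>\<^bsub>M\<^esub> x) = \<ominus>\<^bsub>M\<^esub> \<eta> x"
  using eta_add[of "\<ominus>\<^bsub>M\<^esub> x" x] eta_zero eta_closed
  by (simp add: M.l_neg M.minus_equality)

lemma p_eq_iff:
  assumes "x \<in> carrier M" "y \<in> carrier M"
  shows "p x = p y \<longleftrightarrow> (\<exists>z\<in>carrier M. x = \<eta> z \<oplus>\<^bsub>M\<^esub> y)"
proof
  assume "p x = p y"
  then have "p (x \<ominus>\<^bsub>M\<^esub> y) = \<zero>\<^bsub>C\<^esub>"
    using assms by (simp add: a_minus_def p_add p_minus p_closed C.r_neg)
  then obtain z where z: "z \<in> carrier M" "x \<ominus>\<^bsub>M\<^esub> y = \<eta> z"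
    using p_zero_iff assms by blast
  have "x = (x \<ominus>\<^bsub>M\<^esub> y) \<oplus>\<^bsub>M\<^esub> y"
    using assms by (simp add: a_minus_def M.a_assoc M.l_neg)
  then show "\<exists>z\<in>carrier M. x = \<eta> z \<oplus>\<^bsub>M\<^esub> y" using z by auto
next
  assume "\<exists>z\<in>carrier M. x = \<eta> z \<oplus>\<^bsub>M\<^esub> y"
  then show "p x = p y"
    using assms by (auto simp: p_add p_eta eta_closed p_closed)
qed

end

text \<open>Convergence without limits: \<open>t i\<close> stands for the series of the
  \<open>(\<eta> ^^ j) (y (i + j))\<close> and is described by its recursion. Separatedness is
  expressed by chains of successive quotients; as \<open>\<eta>\<close> is injective, this says that
  the images of its powers intersect in 0.\<close>

locale hcomplete = hred +
  assumes complete: "y \<in> UNIV \<rightarrow> carrier M \<Longrightarrow>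
      \<exists>t\<in>UNIV \<rightarrow> carrier M. \<forall>i::nat. t i = y i \<oplus>\<^bsub>M\<^esub> \<eta> (t (Suc i))"
    and separated: "x \<in> UNIV \<rightarrow> carrier M \<Longrightarrow> (\<And>i::nat. x i = \<eta> (x (Suc i))) \<Longrightarrow> x 0 = \<zero>\<^bsub>M\<^esub>"

definition lifts_kernel ::
  "('m, 'x) ring_scheme \<Rightarrow> ('m \<Rightarrow> 'c) \<Rightarrow> ('c, 'y) ring_scheme \<Rightarrow> ('l, 'u) ring_scheme \<Rightarrow>
    ('e, 'v) ring_scheme \<Rightarrow> ('m \<Rightarrow> 'l) \<Rightarrow> ('c \<Rightarrow> 'e) \<Rightarrow> bool" where
  "lifts_kernel M p C L E f \<delta> \<longleftrightarrow>
    (\<forall>c\<in>carrier C. \<delta> c = \<zero>\<^bsub>E\<^esub> \<longrightarrow> (\<exists>x\<in>carrier M. p x = c \<and> f x = \<zero>\<^bsub>L\<^esub>))"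

locale hmap = M: hred M \<eta> p C + L: hred L \<eta>' p' E
  for M :: "('m, 'x) ring_scheme" and \<eta> :: "'m \<Rightarrow> 'm" and p :: "'m \<Rightarrow> 'c" and C :: "('c, 'y) ring_scheme"
    and L :: "('l, 'u) ring_scheme" and \<eta>' :: "'l \<Rightarrow> 'l" and p' :: "'l \<Rightarrow> 'e" and E :: "('e, 'v) ring_scheme" +
  fixes f :: "'m \<Rightarrow> 'l" and \<delta> :: "'c \<Rightarrow> 'e"
  assumes f_closed: "x \<in> carrier M \<Longrightarrow> f x \<in> carrier L"
    and f_add: "x \<in> carrier M \<Longrightarrow> y \<in> carrier M \<Longrightarrow> f (x \<oplus>\<^bsub>M\<^esub> y) = f x \<oplus>\<^bsub>L\<^esub> f y"
    and f_eta: "x \<in> carrier M \<Longrightarrow> f (\<eta> x) = \<eta>' (f x)"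
    and f_p: "x \<in> carrier M \<Longrightarrow> p' (f x) = \<delta> (p x)"
begin

lemma f_zero: "f \<zero>\<^bsub>M\<^esub> = \<zero>\<^bsub>L\<^esub>"
  by (rule finsum_additive(2)[OF M.M.abelian_group_axioms L.M.abelian_group_axioms, of _ "\<lambda>_. \<zero>\<^bsub>M\<^esub>" "{}"])
    (auto simp: f_closed f_add)

lemma f_minus: "x \<in> carrier M \<Longrightarrow> f (\<ominus>\<^bsub>M\<^esub> x) = \<ominus>\<^bsub>L\<^esub> f x"
  using f_add[of "\<ominus>\<^bsub>M\<^esub> x" x] f_zero f_closed
  by (simp add: M.M.l_neg L.M.minus_equality)

text \<open>The hypothesis isolates what the correction of a lift uses. It is met in two ways: for
  the augmentation by surjectivity, for a differential by exactness one step below.\<close>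

lemma lifts_kernelI:
  assumes "\<And>x w. x \<in> carrier M \<Longrightarrow> w \<in> carrier L \<Longrightarrow> f x = \<eta>' w \<Longrightarrow> \<exists>v\<in>carrier M. f v = w"
  shows "lifts_kernel M p C L E f \<delta>"
  unfolding lifts_kernel_def
proof (intro ballI impI)
  fix c assume c: "c \<in> carrier C" "\<delta> c = \<zero>\<^bsub>E\<^esub>"
  obtain x where x: "x \<in> carrier M" "p x = c" using M.p_surj c by blast
  then have "p' (f x) = \<zero>\<^bsub>E\<^esub>" using c f_p by simp
  then obtain w where w: "w \<in> carrier L" "f x = \<eta>' w"
    using L.p_zero_iff x f_closed by blast
  then obtain v where v: "v \<in> carrier M" "f v = w" using assms x by blast
  have "f (x \<oplus>\<^bsub>M\<^esub> \<ominus>\<^bsub>M\<^esub> \<eta> v) = \<zero>\<^bsub>L\<^esub>"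
    using x v w by (simp add: f_add f_minus M.eta_closed f_eta L.eta_closed L.M.r_neg)
  moreover have "p (x \<oplus>\<^bsub>M\<^esub> \<ominus>\<^bsub>M\<^esub> \<eta> v) = c"
    using x v c by (simp add: M.p_add M.p_minus M.p_eta M.eta_closed)
  ultimately show "\<exists>x\<in>carrier M. p x = c \<and> f x = \<zero>\<^bsub>L\<^esub>"
    using x v M.eta_closed by (intro bexI[of _ "x \<oplus>\<^bsub>M\<^esub> \<ominus>\<^bsub>M\<^esub> \<eta> v"]) auto
qed

end

text \<open>
  Exactness lifts from the reductions: successive approximations of a preimage converge by
  completeness of the source, and separatedness of the target identifies the limit.
\<close>

lemma exact_lift:
  assumes d: "hmap M' \<eta>' p' C' M \<eta> p C d \<delta>" and f: "hmap M \<eta> p C L \<eta>'' p'' E f \<delta>'"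
    and M': "hcomplete M' \<eta>' p' C'" and M: "hcomplete M \<eta> p C"
    and exact: "\<And>c. c \<in> carrier C \<Longrightarrow> \<delta>' c = \<zero>\<^bsub>E\<^esub> \<Longrightarrow> \<exists>b\<in>carrier C'. \<delta> b = c"
    and fd: "\<And>y. y \<in> carrier M' \<Longrightarrow> f (d y) = \<zero>\<^bsub>L\<^esub>"
    and x: "x \<in> carrier M" "f x = \<zero>\<^bsub>L\<^esub>"
  shows "\<exists>y\<in>carrier M'. d y = x"
proof -
  interpret M': hcomplete M' \<eta>' p' C' by fact
  interpret M: hcomplete M \<eta> p C by fact
  interpret d: hmap M' \<eta>' p' C' M \<eta> p C d \<delta> by fact
  interpret f: hmap M \<eta> p C L \<eta>'' p'' E f \<delta>' by fact
  let ?K = "\<lambda>x. x \<in> carrier M \<and> f x = \<zero>\<^bsub>L\<^esub>"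
  \<comment> \<open>One approximation: a preimage modulo \<open>\<eta>\<close> is subtracted, and
    injectivity of \<open>\<eta>''\<close> keeps the quotient of the remainder in the kernel of
    f.\<close>
  have step: "\<exists>x' y. ?K x' \<and> y \<in> carrier M' \<and> x = d y \<oplus>\<^bsub>M\<^esub> \<eta> x'" if x: "?K x" for x
  proof -
    have "\<delta>' (p x) = \<zero>\<^bsub>E\<^esub>" using x f.f_p[of x] f.L.p_zero by simp
    then obtain b where b: "b \<in> carrier C'" "\<delta> b = p x" using exact x M.p_closed by blast
    then obtain y where y: "y \<in> carrier M'" "p' y = b" using M'.p_surj by blast
    then have "p x = p (d y)" using d.f_p b by simp
    then obtain x' where x': "x' \<in> carrier M" "x = \<eta> x' \<oplus>\<^bsub>M\<^esub> d y"
      using M.p_eq_iff x y d.f_closed by blast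
    have "f x = \<eta>'' (f x') \<oplus>\<^bsub>L\<^esub> \<zero>\<^bsub>L\<^esub>"
      using x' y fd by (simp add: f.f_add f.f_eta M.eta_closed d.f_closed)
    then have "\<eta>'' (f x') = \<eta>'' \<zero>\<^bsub>L\<^esub>"
      using x x' by (simp add: f.L.eta_zero f.L.eta_closed f.f_closed)
    then have "f x' = \<zero>\<^bsub>L\<^esub>" using x' f.L.eta_inj f.f_closed by blast
    then show ?thesis
      using x' y by (intro exI[of _ x'] exI[of _ y]) (auto simp: M.M.a_comm M.eta_closed d.f_closed)
  qed
  obtain xs where xs: "xs 0 = x" "\<And>i. ?K (xs i)"
    "\<And>i. \<exists>y. y \<in> carrier M' \<and> xs i = d y \<oplus>\<^bsub>M\<^esub> \<eta> (xs (Suc i))"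
  proof -
    have "\<exists>g. g 0 = x \<and> (\<forall>i. ?K (g i) \<and> (\<exists>y. y \<in> carrier M' \<and> g i = d y \<oplus>\<^bsub>M\<^esub> \<eta> (g (Suc i))))"
    proof -
      have "\<exists>g. \<forall>i. (?K (g i) \<and> (i = 0 \<longrightarrow> g i = x)) \<and>
          (\<exists>y. y \<in> carrier M' \<and> g i = d y \<oplus>\<^bsub>M\<^esub> \<eta> (g (Suc i)))"
      proof (rule dependent_nat_choice, goal_cases)
        case 1
        then show ?case using x by blast
      next
        case (2 x i)
        then obtain x' y where "?K x'" "y \<in> carrier M'" "x = d y \<oplus>\<^bsub>M\<^esub> \<eta> x'"
          using step by blast
        then show ?case by blast
      qed
      then show ?thesis by blast
    qed
    then show ?thesis using that by blast
  qed
  obtain ys where ys: "\<And>i. ys i \<in> carrier M'" "\<And>i. xs i = d (ys i) \<oplus>\<^bsub>M\<^esub> \<eta> (xs (Suc i))"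
    using xs(3) by metis
  obtain t where t: "\<And>i. t i \<in> carrier M'" "\<And>i. t i = ys i \<oplus>\<^bsub>M'\<^esub> \<eta>' (t (Suc i))"
    using M'.complete[of ys] ys by blast
  \<comment> \<open>The defect of the limit is \<open>\<eta>\<close> times the next defect, so
    separatedness makes it vanish.\<close>
  define u where "u i = xs i \<oplus>\<^bsub>M\<^esub> \<ominus>\<^bsub>M\<^esub> d (t i)" for i
  have "u i = \<eta> (u (Suc i))" for i
  proof -
    have c: "d (ys i) \<in> carrier M" "\<eta> (xs (Suc i)) \<in> carrier M" "\<eta> (d (t (Suc i))) \<in> carrier M"
      using ys(1) t(1) xs(2) by (auto simp: d.f_closed M.eta_closed)
    have "d (t i) = d (ys i) \<oplus>\<^bsub>M\<^esub> \<eta> (d (t (Suc i)))"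
      by (subst t(2)) (simp add: d.f_add d.f_eta t(1) ys(1) M'.eta_closed)
    then have "u i = (d (ys i) \<oplus>\<^bsub>M\<^esub> \<eta> (xs (Suc i))) \<oplus>\<^bsub>M\<^esub> \<ominus>\<^bsub>M\<^esub> (d (ys i) \<oplus>\<^bsub>M\<^esub> \<eta> (d (t (Suc i))))"
      unfolding u_def by (subst ys(2)) simp
    also have "\<dots> = \<eta> (xs (Suc i)) \<oplus>\<^bsub>M\<^esub> \<ominus>\<^bsub>M\<^esub> \<eta> (d (t (Suc i)))"
      using c M.M.a_lcomm[of "\<eta> (xs (Suc i))" "\<ominus>\<^bsub>M\<^esub> d (ys i)" "\<ominus>\<^bsub>M\<^esub> \<eta> (d (t (Suc i)))"]
      by (simp add: M.M.minus_add M.M.a_assoc M.M.r_neg2)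
    also have "\<dots> = \<eta> (u (Suc i))"
      using t(1) xs(2) by (simp add: u_def M.eta_add M.eta_minus d.f_closed)
    finally show ?thesis .
  qed
  moreover have "u \<in> UNIV \<rightarrow> carrier M" using xs(2) t(1) by (auto simp: u_def d.f_closed)
  ultimately have "u 0 = \<zero>\<^bsub>M\<^esub>" using M.separated by blast
  then have "xs 0 = d (t 0)"
    using xs(2)[of 0] t(1)[of 0] by (metis u_def d.f_closed M.M.minus_equality M.M.minus_minus M.M.a_inv_closed)
  then show ?thesis using t(1) xs(1) by metis
qed

section \<open>Free modules on the exterior basis and their linear maps\<close>

lemma ext_module_simps:
  "carrier (ext_module R n m) = (\<Pi>\<^sub>E S\<in>ext_index n m. carrier R)"
  "\<zero>\<^bsub>ext_module R n m\<^esub> = (\<lambda>S\<in>ext_index n m. \<zero>\<^bsub>R\<^esub>)"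
  "x \<oplus>\<^bsub>ext_module R n m\<^esub> y = (\<lambda>S\<in>ext_index n m. x S \<oplus>\<^bsub>R\<^esub> y S)"
  "u \<odot>\<^bsub>ext_module R n m\<^esub> x = (\<lambda>S\<in>ext_index n m. u \<otimes>\<^bsub>R\<^esub> x S)"
  by (simp_all add: ext_module_def)

lemma PiE_ext_index_mem: "x \<in> ext_index n m \<rightarrow>\<^sub>E carrier R \<Longrightarrow> S \<in> ext_index n m \<Longrightarrow> x S \<in> carrier R"
  by (rule PiE_mem)

lemma finite_ext_index [simp]: "finite (ext_index n m)"
  by (rule finite_subset[of _ "Pow {..<n}"]) (auto simp: ext_index_def)

lemma abelian_group_ext_module:
  assumes "abelian_group R" shows "abelian_group (ext_module R n m)"
proof -
  interpret R: abelian_group R by fact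
  show ?thesis
  proof (rule abelian_groupI)
    fix x assume "x \<in> carrier (ext_module R n m)"
    then show "\<exists>y\<in>carrier (ext_module R n m). y \<oplus>\<^bsub>ext_module R n m\<^esub> x = \<zero>\<^bsub>ext_module R n m\<^esub>"
      by (intro bexI[of _ "\<lambda>S\<in>ext_index n m. \<ominus>\<^bsub>R\<^esub> x S"])
        (auto simp: ext_module_simps R.l_neg PiE_ext_index_mem intro!: restrict_ext)
  qed (auto simp: ext_module_simps R.a_ac PiE_ext_index_mem PiE_restrict cong: restrict_cong )
qed

lemma left_module_ext_module:
  assumes "ring R" shows "left_module R (ext_module R n m)"
proof -
  interpret R: ring R by fact
  interpret E: abelian_group "ext_module R n m"
    by (rule abelian_group_ext_module) (rule R.abelian_group_axioms)
  show ?thesis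
    by (intro left_module.intro left_module_axioms.intro R.ring_axioms E.abelian_group_axioms)
      (auto simp: ext_module_simps PiE_ext_index_mem R.l_distr R.r_distr R.m_assoc PiE_restrict
        cong: restrict_cong)
qed

lemma finsum_ext_module_apply:
  assumes "abelian_group R" "F \<in> A \<rightarrow> carrier (ext_module R n m)" "S \<in> ext_index n m"
  shows "finsum (ext_module R n m) F A S = finsum R (\<lambda>i. F i S) A"
  by (rule finsum_additive(1)[OF abelian_group_ext_module, where f = "\<lambda>x. x S"])
    (use assms in \<open>auto simp: ext_module_simps\<close>)

lemma ext_module_eqI:
  assumes "x \<in> carrier (ext_module R n m)" "y \<in> carrier (ext_module R n m)"
    and "\<And>S. S \<in> ext_index n m \<Longrightarrow> x S = y S"
  shows "x = y"
  using assms unfolding ext_module_simps by (rule PiE_ext)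

lemma ext_basis_closed: "ring R \<Longrightarrow> ext_basis R n m S \<in> carrier (ext_module R n m)"
  by (auto simp: ext_basis_def ext_module_simps ring.ring_simprules)

lemma ext_module_expand:
  assumes "ring R" and x: "x \<in> carrier (ext_module R n m)"
  shows "x = finsum (ext_module R n m) (\<lambda>S. x S \<odot>\<^bsub>ext_module R n m\<^esub> ext_basis R n m S) (ext_index n m)"
    (is "_ = finsum ?M ?F ?I")
proof -
  interpret R: ring R by fact
  interpret M: left_module R ?M by (rule left_module_ext_module) fact
  have F: "?F \<in> ?I \<rightarrow> carrier ?M"
    using x M.smult_closed[OF _ ext_basis_closed[OF R.ring_axioms]]
    by (auto simp: ext_module_simps(1) PiE_ext_index_mem)
  show ?thesis
  proof (rule ext_module_eqI[OF x])
    show "finsum ?M ?F ?I \<in> carrier ?M" by (rule M.finsum_closed[OF F])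
    fix T assume T: "T \<in> ?I"
    have "finsum ?M ?F ?I T = (\<Oplus>\<^bsub>R\<^esub>S\<in>?I. if T = S then x S else \<zero>\<^bsub>R\<^esub>)"
      unfolding finsum_ext_module_apply[OF R.abelian_group_axioms F T]
      by (rule R.finsum_cong') (use x T in \<open>auto simp: ext_module_simps ext_basis_def PiE_ext_index_mem\<close>)
    also have "\<dots> = x T"
      using x T by (intro R.finsum_singleton) (auto simp: ext_module_simps PiE_ext_index_mem)
    finally show "x T = finsum ?M ?F ?I T" by simp
  qed
qed

text \<open>Addition, \<open>\<eta>\<close> and p act on coordinates, so witnesses are chosen in
  each coordinate and assembled.\<close>

lemma hcomplete_ext_module:
  assumes "hcomplete R \<eta> p U"
  shows "hcomplete (ext_module R n m) (\<lambda>x. \<lambda>S\<in>ext_index n m. \<eta> (x S))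
    (\<lambda>x. \<lambda>S\<in>ext_index n m. p (x S)) (ext_module U n m)"
proof -
  interpret R: hcomplete R \<eta> p U by fact
  let ?I = "ext_index n m"
  note mem = PiE_ext_index_mem
  have intros: "hred_axioms (ext_module R n m) (\<lambda>x. \<lambda>S\<in>?I. \<eta> (x S)) (\<lambda>x. \<lambda>S\<in>?I. p (x S)) (ext_module U n m)"
  proof
    fix x assume "x \<in> carrier (ext_module R n m)"
    then show "(\<lambda>S\<in>?I. \<eta> (x S)) \<in> carrier (ext_module R n m)"
      and "(\<lambda>S\<in>?I. p (x S)) \<in> carrier (ext_module U n m)"
      by (auto simp: ext_module_simps mem R.eta_closed R.p_closed)
  next
    fix x y assume xy: "x \<in> carrier (ext_module R n m)" "y \<in> carrier (ext_module R n m)"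
    show "(\<lambda>S\<in>?I. \<eta> ((x \<oplus>\<^bsub>ext_module R n m\<^esub> y) S))
        = (\<lambda>S\<in>?I. \<eta> (x S)) \<oplus>\<^bsub>ext_module R n m\<^esub> (\<lambda>S\<in>?I. \<eta> (y S))"
      and "(\<lambda>S\<in>?I. p ((x \<oplus>\<^bsub>ext_module R n m\<^esub> y) S))
        = (\<lambda>S\<in>?I. p (x S)) \<oplus>\<^bsub>ext_module U n m\<^esub> (\<lambda>S\<in>?I. p (y S))"
      using xy by (auto simp: ext_module_simps mem R.eta_add R.p_add cong: restrict_cong)
    show "x = y" if "(\<lambda>S\<in>?I. \<eta> (x S)) = (\<lambda>S\<in>?I. \<eta> (y S))"
    proof (rule ext_module_eqI[OF xy])
      fix S assume S: "S \<in> ?I"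
      then have "\<eta> (x S) = \<eta> (y S)" using fun_cong[OF that, of S] by simp
      then show "x S = y S" using R.eta_inj xy S by (auto simp: ext_module_simps mem)
    qed
  next
    fix c assume c: "c \<in> carrier (ext_module U n m)"
    then have "\<forall>S\<in>?I. \<exists>x. x \<in> carrier R \<and> p x = c S"
      using R.p_surj by (auto simp: ext_module_simps mem)
    then obtain x where x: "\<And>S. S \<in> ?I \<Longrightarrow> x S \<in> carrier R \<and> p (x S) = c S" by metis
    show "\<exists>x\<in>carrier (ext_module R n m). (\<lambda>S\<in>?I. p (x S)) = c"
      using c x by (intro bexI[of _ "restrict x ?I"])
        (auto simp: ext_module_simps PiE_restrict cong: restrict_cong)
  next
    fix x assume x: "x \<in> carrier (ext_module R n m)"
    show "(\<lambda>S\<in>?I. p (x S)) = \<zero>\<^bsub>ext_module U n m\<^esub> \<longleftrightarrow>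
      (\<exists>y\<in>carrier (ext_module R n m). x = (\<lambda>S\<in>?I. \<eta> (y S)))" (is "?l \<longleftrightarrow> ?r")
    proof
      assume l: ?l
      have "\<exists>y. y \<in> carrier R \<and> x S = \<eta> y" if "S \<in> ?I" for S
        using fun_cong[OF l, of S] that x R.p_zero_iff[of "x S"] by (auto simp: ext_module_simps mem)
      then obtain y where y: "\<And>S. S \<in> ?I \<Longrightarrow> y S \<in> carrier R \<and> x S = \<eta> (y S)" by metis
      have "x = (\<lambda>S\<in>?I. \<eta> (restrict y ?I S))"
        using x y by (intro ext_module_eqI[OF x]) (auto simp: ext_module_simps R.eta_closed)
      then show ?r using y by (intro bexI[of _ "restrict y ?I"]) (auto simp: ext_module_simps)
    next
      assume ?r
      then show ?l
        by (auto simp: ext_module_simps mem R.p_eta cong: restrict_cong)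
    qed
  qed
  show ?thesis
  proof (intro hcomplete.intro hred.intro intros abelian_group_ext_module R.M.abelian_group_axioms
      R.C.abelian_group_axioms hcomplete_axioms.intro)
    fix y :: "nat \<Rightarrow> nat set \<Rightarrow> 'a" assume y: "y \<in> UNIV \<rightarrow> carrier (ext_module R n m)"
    have "\<exists>t. (\<forall>i. t i \<in> carrier R) \<and> (\<forall>i. t i = y i S \<oplus>\<^bsub>R\<^esub> \<eta> (t (Suc i)))" if "S \<in> ?I" for S
    proof -
      have "(\<lambda>i. y i S) \<in> UNIV \<rightarrow> carrier R"
        using y that mem[of _ n m R S] by (auto simp: ext_module_simps Pi_iff)
      from R.complete[OF this] obtain t where t: "t \<in> UNIV \<rightarrow> carrier R"
        "\<forall>i. t i = y i S \<oplus>\<^bsub>R\<^esub> \<eta> (t (Suc i))" by (elim bexE)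
      have "\<forall>i. t i \<in> carrier R" using t(1) by blast
      with t(2) show ?thesis by blast
    qed
    then obtain t where t: "\<And>S i. S \<in> ?I \<Longrightarrow> t S i \<in> carrier R"
        "\<And>S i. S \<in> ?I \<Longrightarrow> t S i = y i S \<oplus>\<^bsub>R\<^esub> \<eta> (t S (Suc i))"
      by metis
    show "\<exists>t\<in>UNIV \<rightarrow> carrier (ext_module R n m). \<forall>i. t i = y i \<oplus>\<^bsub>ext_module R n m\<^esub> (\<lambda>S\<in>?I. \<eta> (t (Suc i) S))"
    proof (intro bexI[of _ "\<lambda>i. \<lambda>S\<in>?I. t S i"] allI)
      fix i
      show "(\<lambda>S\<in>?I. t S i) = y i \<oplus>\<^bsub>ext_module R n m\<^esub> (\<lambda>S\<in>?I. \<eta> ((\<lambda>S\<in>?I. t S (Suc i)) S))"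
        unfolding ext_module_simps
      proof (rule restrict_ext)
        fix S assume S: "S \<in> ?I"
        show "t S i = y i S \<oplus>\<^bsub>R\<^esub> (\<lambda>S\<in>?I. \<eta> ((\<lambda>S\<in>?I. t S (Suc i)) S)) S"
          unfolding restrict_apply'[OF S] by (rule t(2)[OF S])
      qed
    qed (use t(1) in \<open>auto simp: ext_module_simps\<close>)
  next
    fix x :: "nat \<Rightarrow> nat set \<Rightarrow> 'a"
    assume x: "x \<in> UNIV \<rightarrow> carrier (ext_module R n m)" and e: "\<And>i. x i = (\<lambda>S\<in>?I. \<eta> (x (Suc i) S))"
    show "x 0 = \<zero>\<^bsub>ext_module R n m\<^esub>"
    proof (rule ext_module_eqI)
      fix S assume S: "S \<in> ?I"
      have "x i S = \<eta> (x (Suc i) S)" for i using fun_cong[OF e[of i], of S] S by simp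
      moreover have "(\<lambda>i. x i S) \<in> UNIV \<rightarrow> carrier R"
        using x S mem[of _ n m R S] by (auto simp: ext_module_simps Pi_iff)
      ultimately have "x 0 S = \<zero>\<^bsub>R\<^esub>" using R.separated[of "\<lambda>i. x i S"] by blast
      then show "x 0 S = \<zero>\<^bsub>ext_module R n m\<^esub> S" using S by (simp add: ext_module_simps)
    qed (use x in \<open>auto simp: ext_module_simps\<close>)
  qed
qed

lemma semilinear_homD:
  assumes "f \<in> semilinear_hom R \<psi> M L"
  shows "x \<in> carrier M \<Longrightarrow> f x \<in> carrier L"
    and "x \<in> carrier M \<Longrightarrow> y \<in> carrier M \<Longrightarrow> f (x \<oplus>\<^bsub>M\<^esub> y) = f x \<oplus>\<^bsub>L\<^esub> f y"
    and "a \<in> carrier R \<Longrightarrow> x \<in> carrier M \<Longrightarrow> f (a \<odot>\<^bsub>M\<^esub> x) = \<psi> a \<odot>\<^bsub>L\<^esub> f x"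
  using assms by (auto simp: semilinear_hom_def)

lemma (in left_module) smult_zero_right: "a \<in> carrier R \<Longrightarrow> a \<odot>\<^bsub>M\<^esub> \<zero>\<^bsub>M\<^esub> = \<zero>\<^bsub>M\<^esub>"
  using smult_r_distr[of a "\<zero>\<^bsub>M\<^esub>" "\<zero>\<^bsub>M\<^esub>"] smult_closed[of a "\<zero>\<^bsub>M\<^esub>"]
  by (metis M.add.r_cancel_one M.r_zero M.zero_closed)

lemma (in left_module) smult_finsum:
  assumes "a \<in> carrier R" "g \<in> A \<rightarrow> carrier M"
  shows "a \<odot>\<^bsub>M\<^esub> finsum M g A = finsum M (\<lambda>i. a \<odot>\<^bsub>M\<^esub> g i) A"
  by (rule finsum_additive(1)[OF M.abelian_group_axioms M.abelian_group_axioms])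
    (use assms in \<open>auto simp: smult_closed smult_r_distr\<close>)

lemma linear_extension:
  assumes "left_module R M" and y: "\<And>S. S \<in> ext_index n m \<Longrightarrow> y S \<in> carrier M"
  shows "(\<lambda>x. finsum M (\<lambda>S. x S \<odot>\<^bsub>M\<^esub> y S) (ext_index n m)) \<in> semilinear_hom R id (ext_module R n m) M"
proof -
  interpret M: left_module R M by fact
  note mem = PiE_ext_index_mem
  have c: "(\<lambda>S. x S \<odot>\<^bsub>M\<^esub> y S) \<in> ext_index n m \<rightarrow> carrier M" if "x \<in> carrier (ext_module R n m)" for x
    using that y by (auto simp: ext_module_simps mem intro!: M.smult_closed)
  show ?thesis
    unfolding semilinear_hom_def
  proof (intro CollectI conjI ballI)
    show "(\<lambda>x. finsum M (\<lambda>S. x S \<odot>\<^bsub>M\<^esub> y S) (ext_index n m)) \<in> carrier (ext_module R n m) \<rightarrow> carrier M"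
      using c by (auto intro!: M.finsum_closed)
  next
    fix x x' assume x: "x \<in> carrier (ext_module R n m)" "x' \<in> carrier (ext_module R n m)"
    have "finsum M (\<lambda>S. (x \<oplus>\<^bsub>ext_module R n m\<^esub> x') S \<odot>\<^bsub>M\<^esub> y S) (ext_index n m)
        = finsum M (\<lambda>S. x S \<odot>\<^bsub>M\<^esub> y S \<oplus>\<^bsub>M\<^esub> x' S \<odot>\<^bsub>M\<^esub> y S) (ext_index n m)"
      using x y by (intro M.finsum_cong')
        (auto simp: ext_module_simps mem M.smult_l_distr intro!: M.smult_closed M.a_closed)
    then show "finsum M (\<lambda>S. (x \<oplus>\<^bsub>ext_module R n m\<^esub> x') S \<odot>\<^bsub>M\<^esub> y S) (ext_index n m)
        = finsum M (\<lambda>S. x S \<odot>\<^bsub>M\<^esub> y S) (ext_index n m) \<oplus>\<^bsub>M\<^esub> finsum M (\<lambda>S. x' S \<odot>\<^bsub>M\<^esub> y S) (ext_index n m)"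
      using c x by (simp add: M.finsum_addf)
  next
    fix a x assume x: "a \<in> carrier R" "x \<in> carrier (ext_module R n m)"
    have "finsum M (\<lambda>S. (a \<odot>\<^bsub>ext_module R n m\<^esub> x) S \<odot>\<^bsub>M\<^esub> y S) (ext_index n m)
        = finsum M (\<lambda>S. a \<odot>\<^bsub>M\<^esub> (x S \<odot>\<^bsub>M\<^esub> y S)) (ext_index n m)"
      using x y by (intro M.finsum_cong')
        (auto simp: ext_module_simps mem M.smult_assoc intro!: M.smult_closed)
    then show "finsum M (\<lambda>S. (a \<odot>\<^bsub>ext_module R n m\<^esub> x) S \<odot>\<^bsub>M\<^esub> y S) (ext_index n m)
        = id a \<odot>\<^bsub>M\<^esub> finsum M (\<lambda>S. x S \<odot>\<^bsub>M\<^esub> y S) (ext_index n m)"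
      using c x by (simp add: M.smult_finsum)
  qed
qed

lemma semilinear_hom_expand:
  assumes "left_module R M" and f: "f \<in> semilinear_hom R id (ext_module R n m) M"
    and x: "x \<in> carrier (ext_module R n m)"
  shows "f x = finsum M (\<lambda>S. x S \<odot>\<^bsub>M\<^esub> f (ext_basis R n m S)) (ext_index n m)"
proof -
  interpret M: left_module R M by fact
  interpret E: left_module R "ext_module R n m" by (rule left_module_ext_module) (rule M.ring_axioms)
  note b = ext_basis_closed[OF M.ring_axioms, of n m]
  have xS: "x S \<in> carrier R" if "S \<in> ext_index n m" for S
    using x that by (simp add: ext_module_simps PiE_ext_index_mem)
  have "f x = f (finsum (ext_module R n m) (\<lambda>S. x S \<odot>\<^bsub>ext_module R n m\<^esub> ext_basis R n m S) (ext_index n m))"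
    using ext_module_expand[OF M.ring_axioms x] by simp
  also have "\<dots> = finsum M (\<lambda>S. f (x S \<odot>\<^bsub>ext_module R n m\<^esub> ext_basis R n m S)) (ext_index n m)"
    by (rule finsum_additive(1)[OF E.abelian_group_axioms M.abelian_group_axioms])
      (use semilinear_homD[OF f] xS b in \<open>auto simp: E.smult_closed\<close>)
  also have "\<dots> = finsum M (\<lambda>S. x S \<odot>\<^bsub>M\<^esub> f (ext_basis R n m S)) (ext_index n m)"
    by (rule M.finsum_cong') (use semilinear_homD[OF f] xS b in \<open>auto simp: M.smult_closed\<close>)
  finally show ?thesis .
qed

text \<open>The ring-theoretic content of a deformation: h is central and regular, R is h-adically
  complete, and p identifies R / h R with U as a ring. Both the lifting argument and the associated
  graded are developed from this.\<close>

locale deform = R: ring R + U: ring U + red: hcomplete R "\<lambda>x. h \<otimes>\<^bsub>R\<^esub> x" p U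
  for R :: "('r, 'x) ring_scheme" and h :: 'r and p :: "'r \<Rightarrow> 'u" and U :: "('u, 'y) ring_scheme" +
  fixes n :: nat
  assumes h_closed: "h \<in> carrier R"
    and h_comm: "x \<in> carrier R \<Longrightarrow> h \<otimes>\<^bsub>R\<^esub> x = x \<otimes>\<^bsub>R\<^esub> h"
    and p_mult: "x \<in> carrier R \<Longrightarrow> y \<in> carrier R \<Longrightarrow> p (x \<otimes>\<^bsub>R\<^esub> y) = p x \<otimes>\<^bsub>U\<^esub> p y"
    and p_one: "p \<one>\<^bsub>R\<^esub> = \<one>\<^bsub>U\<^esub>"
begin

abbreviation K :: "nat \<Rightarrow> ('r, nat set \<Rightarrow> 'r) module" where "K \<equiv> ext_module R n"
abbreviation Kbar :: "nat \<Rightarrow> ('u, nat set \<Rightarrow> 'u) module" where "Kbar \<equiv> ext_module U n"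

definition reduce :: "nat \<Rightarrow> (nat set \<Rightarrow> 'r) \<Rightarrow> nat set \<Rightarrow> 'u" where
  "reduce m x = (\<lambda>S\<in>ext_index n m. p (x S))"

lemma hcomplete_K: "hcomplete (K m) (\<lambda>x. h \<odot>\<^bsub>K m\<^esub> x) (reduce m) (Kbar m)"
  using hcomplete_ext_module[OF red.hcomplete_axioms, of n m]
  unfolding ext_module_simps reduce_def .

lemmas hred_K = hcomplete.axioms(1)[OF hcomplete_K]

lemma left_module_K: "left_module R (K m)"
  by (rule left_module_ext_module) (rule R.ring_axioms)

lemma left_module_Kbar: "left_module U (Kbar m)"
  by (rule left_module_ext_module) (rule U.ring_axioms)

lemma reduce_smult:
  "a \<in> carrier R \<Longrightarrow> x \<in> carrier (K m) \<Longrightarrow> reduce m (a \<odot>\<^bsub>K m\<^esub> x) = p a \<odot>\<^bsub>Kbar m\<^esub> reduce m x"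
  by (auto simp: reduce_def ext_module_simps p_mult PiE_ext_index_mem cong: restrict_cong)

section \<open>Lifting the differentials\<close>

lemma hmap_linear:
  assumes "hred M (\<lambda>x. h \<odot>\<^bsub>M\<^esub> x) q C" "hred L (\<lambda>x. h \<odot>\<^bsub>L\<^esub> x) q' E"
    and "f \<in> semilinear_hom R id M L" "\<And>x. x \<in> carrier M \<Longrightarrow> q' (f x) = \<delta> (q x)"
  shows "hmap M (\<lambda>x. h \<odot>\<^bsub>M\<^esub> x) q C L (\<lambda>x. h \<odot>\<^bsub>L\<^esub> x) q' E f \<delta>"
  using assms semilinear_homD[OF assms(3)] h_closed
  by (intro hmap.intro hmap_axioms.intro) auto

lemma lift_differential:
  assumes L: "left_module R L" and f: "f \<in> semilinear_hom R id (K m) L"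
    and lk: "lifts_kernel (K m) (reduce m) (Kbar m) L E f \<delta>'"
    and d: "\<delta> \<in> semilinear_hom U id (Kbar (Suc m)) (Kbar m)"
    and dd: "\<And>c. c \<in> carrier (Kbar (Suc m)) \<Longrightarrow> \<delta>' (\<delta> c) = \<zero>\<^bsub>E\<^esub>"
  obtains d where "d \<in> semilinear_hom R id (K (Suc m)) (K m)"
    and "\<And>x. x \<in> carrier (K (Suc m)) \<Longrightarrow> reduce m (d x) = \<delta> (reduce (Suc m) x)"
    and "\<And>x. x \<in> carrier (K (Suc m)) \<Longrightarrow> f (d x) = \<zero>\<^bsub>L\<^esub>"
proof -
  interpret L: left_module R L by fact
  interpret K: left_module R "K m" by (rule left_module_K)
  interpret Kb: left_module U "Kbar m" by (rule left_module_Kbar)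
  interpret hK: hred "K m" "\<lambda>x. h \<odot>\<^bsub>K m\<^esub> x" "reduce m" "Kbar m" by (rule hred_K)
  interpret hK': hred "K (Suc m)" "\<lambda>x. h \<odot>\<^bsub>K (Suc m)\<^esub> x" "reduce (Suc m)" "Kbar (Suc m)" by (rule hred_K)
  let ?I = "ext_index n (Suc m)" and ?b = "ext_basis U n (Suc m)"
  note b = ext_basis_closed[OF U.ring_axioms, of n "Suc m"]
  \<comment> \<open>\<open>\<delta>\<close> of a basis vector is a cycle, so it has a lift killed by
    f. As the module is free, these lifts may be prescribed as values on its basis.\<close>
  have "\<exists>y\<in>carrier (K m). reduce m y = \<delta> (?b S) \<and> f y = \<zero>\<^bsub>L\<^esub>" for S
    using lk dd[OF b] semilinear_homD(1)[OF d b] unfolding lifts_kernel_def by blast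
  then obtain y where y: "\<And>S. y S \<in> carrier (K m)" "\<And>S. reduce m (y S) = \<delta> (?b S)" "\<And>S. f (y S) = \<zero>\<^bsub>L\<^esub>"
    by metis
  define d where "d x = finsum (K m) (\<lambda>S. x S \<odot>\<^bsub>K m\<^esub> y S) ?I" for x
  have xS: "x S \<in> carrier R" if "x \<in> carrier (K (Suc m))" "S \<in> ?I" for x S
    using that by (simp add: ext_module_simps PiE_ext_index_mem)
  have c: "(\<lambda>S. x S \<odot>\<^bsub>K m\<^esub> y S) \<in> ?I \<rightarrow> carrier (K m)" if "x \<in> carrier (K (Suc m))" for x
    using xS that y(1) by (auto intro!: K.smult_closed)
  show ?thesis
  proof
    show "d \<in> semilinear_hom R id (K (Suc m)) (K m)"
      unfolding d_def by (rule linear_extension) (auto intro: left_module_K y)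
  next
    fix x assume x: "x \<in> carrier (K (Suc m))"
    have "reduce m (d x) = finsum (Kbar m) (\<lambda>S. reduce m (x S \<odot>\<^bsub>K m\<^esub> y S)) ?I"
      unfolding d_def
      by (rule finsum_additive(1)[OF K.abelian_group_axioms Kb.abelian_group_axioms])
        (use hK.p_closed hK.p_add c x in auto)
    also have "\<dots> = finsum (Kbar m) (\<lambda>S. reduce (Suc m) x S \<odot>\<^bsub>Kbar m\<^esub> \<delta> (?b S)) ?I"
    proof (rule Kb.finsum_cong')
      fix S assume S: "S \<in> ?I"
      show "reduce m (x S \<odot>\<^bsub>K m\<^esub> y S) = reduce (Suc m) x S \<odot>\<^bsub>Kbar m\<^esub> \<delta> (?b S)"
        using xS[OF x S] S by (simp add: reduce_smult y) (simp add: reduce_def)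
    next
      have "reduce (Suc m) x S \<in> carrier U" if "S \<in> ?I" for S
        using xS[OF x that] that by (simp add: reduce_def red.p_closed)
      then show "(\<lambda>S. reduce (Suc m) x S \<odot>\<^bsub>Kbar m\<^esub> \<delta> (?b S)) \<in> ?I \<rightarrow> carrier (Kbar m)"
        using semilinear_homD(1)[OF d b] by (auto intro!: Kb.smult_closed)
    qed simp
    also have "\<dots> = \<delta> (reduce (Suc m) x)"
      by (rule semilinear_hom_expand[OF left_module_Kbar d, symmetric]) (rule hK'.p_closed[OF x])
    finally show "reduce m (d x) = \<delta> (reduce (Suc m) x)" .
    have "f (d x) = finsum L (\<lambda>S. f (x S \<odot>\<^bsub>K m\<^esub> y S)) ?I"
      unfolding d_def
      by (rule finsum_additive(1)[OF K.abelian_group_axioms L.abelian_group_axioms])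
        (use semilinear_homD[OF f] c x in auto)
    also have "\<dots> = finsum L (\<lambda>S. \<zero>\<^bsub>L\<^esub>) ?I"
      by (rule L.M.finsum_cong') (use xS[OF x] semilinear_homD(3)[OF f] y in \<open>auto simp: L.smult_zero_right\<close>)
    finally show "f (d x) = \<zero>\<^bsub>L\<^esub>" by simp
  qed
qed

theorem lift_resolution:
  fixes \<delta> :: "nat \<Rightarrow> (nat set \<Rightarrow> 'u) \<Rightarrow> nat set \<Rightarrow> 'u"
  assumes N: "left_module R N" and hN: "hred N (\<lambda>x. h \<odot>\<^bsub>N\<^esub> x) q E"
    and eps: "\<epsilon> \<in> semilinear_hom R id (K 0) N"
    and eps_q: "\<And>x. x \<in> carrier (K 0) \<Longrightarrow> q (\<epsilon> x) = \<epsilon>' (reduce 0 x)"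
    and eps_surj: "\<epsilon> ` carrier (K 0) = carrier N"
    and d: "\<And>m. \<delta> m \<in> semilinear_hom U id (Kbar (Suc m)) (Kbar m)"
    and eps_d: "\<And>c. c \<in> carrier (Kbar (Suc 0)) \<Longrightarrow> \<epsilon>' (\<delta> 0 c) = \<zero>\<^bsub>E\<^esub>"
    and dd: "\<And>m c. c \<in> carrier (Kbar (Suc (Suc m))) \<Longrightarrow> \<delta> m (\<delta> (Suc m) c) = \<zero>\<^bsub>Kbar m\<^esub>"
    and exact0: "\<And>c. c \<in> carrier (Kbar 0) \<Longrightarrow> \<epsilon>' c = \<zero>\<^bsub>E\<^esub> \<Longrightarrow> \<exists>b\<in>carrier (Kbar (Suc 0)). \<delta> 0 b = c"
    and exact: "\<And>m c. c \<in> carrier (Kbar (Suc m)) \<Longrightarrow> \<delta> m c = \<zero>\<^bsub>Kbar m\<^esub> \<Longrightarrow>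
      \<exists>b\<in>carrier (Kbar (Suc (Suc m))). \<delta> (Suc m) b = c"
  shows "\<exists>d. left_resolution R N K d \<epsilon> \<and>
    (\<forall>m. \<forall>x\<in>carrier (K (Suc m)). reduce m (d m x) = \<delta> m (reduce (Suc m) x))"
proof -
  interpret N: hred N "\<lambda>x. h \<odot>\<^bsub>N\<^esub> x" q E by fact
  \<comment> \<open>The target L is arbitrary because the map out of \<open>K m\<close> is the
    augmentation for m = 0 and a differential afterwards.\<close>
  have next_lifts: "lifts_kernel (K (Suc m)) (reduce (Suc m)) (Kbar (Suc m)) (K m) (Kbar m) d' (\<delta> m)"
    if d': "d' \<in> semilinear_hom R id (K (Suc m)) (K m)"
      "\<And>x. x \<in> carrier (K (Suc m)) \<Longrightarrow> reduce m (d' x) = \<delta> m (reduce (Suc m) x)"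
      and f: "f \<in> semilinear_hom R id (K m) L" "left_module R L" "hred L (\<lambda>x. h \<odot>\<^bsub>L\<^esub> x) q' E'"
      and fd: "\<And>x. x \<in> carrier (K (Suc m)) \<Longrightarrow> f (d' x) = \<zero>\<^bsub>L\<^esub>"
      and ex: "\<And>x. x \<in> carrier (K m) \<Longrightarrow> f x = \<zero>\<^bsub>L\<^esub> \<Longrightarrow> \<exists>y\<in>carrier (K (Suc m)). d' y = x"
    for m d' f and L :: "('r, 'l, 'w) module_scheme" and q' and E' :: "('e, 'v) ring_scheme"
  proof -
    interpret L: hred L "\<lambda>x. h \<odot>\<^bsub>L\<^esub> x" q' E' by fact
    interpret d': hmap "K (Suc m)" "\<lambda>x. h \<odot>\<^bsub>K (Suc m)\<^esub> x" "reduce (Suc m)" "Kbar (Suc m)"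
      "K m" "\<lambda>x. h \<odot>\<^bsub>K m\<^esub> x" "reduce m" "Kbar m" d' "\<delta> m"
      by (rule hmap_linear, rule hred_K, rule hred_K, rule d'(1), rule d'(2))
    show ?thesis
    proof (rule d'.lifts_kernelI)
      fix x w assume x: "x \<in> carrier (K (Suc m))" "w \<in> carrier (K m)" "d' x = h \<odot>\<^bsub>K m\<^esub> w"
      have "h \<odot>\<^bsub>L\<^esub> f w = f (d' x)" using semilinear_homD(3)[OF f(1) h_closed x(2)] x(3) by simp
      also have "\<dots> = h \<odot>\<^bsub>L\<^esub> \<zero>\<^bsub>L\<^esub>" using fd[OF x(1)] L.eta_zero by simp
      finally have "f w = \<zero>\<^bsub>L\<^esub>"
        using L.eta_inj semilinear_homD(1)[OF f(1) x(2)] by blast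
      then show "\<exists>v\<in>carrier (K (Suc m)). d' v = w" using ex x by blast
    qed
  qed
  have next_exact: "\<exists>y\<in>carrier (K (Suc m)). d' y = x"
    if d': "d' \<in> semilinear_hom R id (K (Suc m)) (K m)"
      "\<And>x. x \<in> carrier (K (Suc m)) \<Longrightarrow> reduce m (d' x) = \<delta> m (reduce (Suc m) x)"
      and f: "f \<in> semilinear_hom R id (K m) L" "hred L (\<lambda>x. h \<odot>\<^bsub>L\<^esub> x) q' E'"
      "\<And>x. x \<in> carrier (K m) \<Longrightarrow> q' (f x) = \<delta>' (reduce m x)"
      and fd: "\<And>x. x \<in> carrier (K (Suc m)) \<Longrightarrow> f (d' x) = \<zero>\<^bsub>L\<^esub>"
      and ex: "\<And>c. c \<in> carrier (Kbar m) \<Longrightarrow> \<delta>' c = \<zero>\<^bsub>E'\<^esub> \<Longrightarrow> \<exists>b\<in>carrier (Kbar (Suc m)). \<delta> m b = c"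
      and x: "x \<in> carrier (K m)" "f x = \<zero>\<^bsub>L\<^esub>"
    for m d' f x \<delta>' and L :: "('r, 'l, 'w) module_scheme" and q' and E' :: "('e, 'v) ring_scheme"
  proof -
    have 1: "hmap (K (Suc m)) (\<lambda>x. h \<odot>\<^bsub>K (Suc m)\<^esub> x) (reduce (Suc m)) (Kbar (Suc m))
      (K m) (\<lambda>x. h \<odot>\<^bsub>K m\<^esub> x) (reduce m) (Kbar m) d' (\<delta> m)"
      by (rule hmap_linear, rule hred_K, rule hred_K, rule d'(1), rule d'(2))
    have 2: "hmap (K m) (\<lambda>x. h \<odot>\<^bsub>K m\<^esub> x) (reduce m) (Kbar m) L (\<lambda>x. h \<odot>\<^bsub>L\<^esub> x) q' E' f \<delta>'"
      by (rule hmap_linear, rule hred_K, rule f(2), rule f(1), rule f(3))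
    show ?thesis
      by (rule exact_lift, rule 1, rule 2, rule hcomplete_K, rule hcomplete_K, rule ex, assumption,
          assumption, rule fd, assumption, rule x(1), rule x(2))
  qed
  interpret e: hmap "K 0" "\<lambda>x. h \<odot>\<^bsub>K 0\<^esub> x" "reduce 0" "Kbar 0" N "\<lambda>x. h \<odot>\<^bsub>N\<^esub> x" q E \<epsilon> \<epsilon>'
    by (rule hmap_linear, rule hred_K, rule hN, rule eps, rule eps_q)
  have lk: "lifts_kernel (K 0) (reduce 0) (Kbar 0) N E \<epsilon> \<epsilon>'"
  proof (rule e.lifts_kernelI)
    fix w assume "w \<in> carrier N"
    then have "w \<in> \<epsilon> ` carrier (K 0)" unfolding eps_surj .
    then show "\<exists>v\<in>carrier (K 0). \<epsilon> v = w" by blast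
  qed
  obtain d0 where d0: "d0 \<in> semilinear_hom R id (K (Suc 0)) (K 0)"
    "\<And>x. x \<in> carrier (K (Suc 0)) \<Longrightarrow> reduce 0 (d0 x) = \<delta> 0 (reduce (Suc 0) x)"
    "\<And>x. x \<in> carrier (K (Suc 0)) \<Longrightarrow> \<epsilon> (d0 x) = \<zero>\<^bsub>N\<^esub>"
    using lift_differential[OF N eps lk d eps_d] by blast
  have e0: "\<exists>y\<in>carrier (K (Suc 0)). d0 y = x" if "x \<in> carrier (K 0)" "\<epsilon> x = \<zero>\<^bsub>N\<^esub>" for x
    by (rule next_exact[OF d0(1,2) eps hN eps_q d0(3) exact0 that])
  \<comment> \<open>The invariant of the recursion: besides reducing to \<open>\<delta> m\<close>, a
    differential must lift cycles, which the choice of the next one consumes.\<close>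
  define good where "good m d' \<longleftrightarrow> d' \<in> semilinear_hom R id (K (Suc m)) (K m) \<and>
    (\<forall>x\<in>carrier (K (Suc m)). reduce m (d' x) = \<delta> m (reduce (Suc m) x)) \<and>
    lifts_kernel (K (Suc m)) (reduce (Suc m)) (Kbar (Suc m)) (K m) (Kbar m) d' (\<delta> m)" for m d'
  define ex where "ex m d' d'' \<longleftrightarrow> (\<forall>x\<in>carrier (K (Suc (Suc m))). d' (d'' x) = \<zero>\<^bsub>K m\<^esub>) \<and>
    (\<forall>x\<in>carrier (K (Suc m)). d' x = \<zero>\<^bsub>K m\<^esub> \<longrightarrow> (\<exists>y\<in>carrier (K (Suc (Suc m))). d'' y = x))"
    for m and d' d'' :: "(nat set \<Rightarrow> 'r) \<Rightarrow> nat set \<Rightarrow> 'r"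
  \<comment> \<open>The clause for m = 0 pins the first differential to \<open>d0\<close>, for which
    exactness against the augmentation has been shown.\<close>
  have "\<exists>D. \<forall>m. (good m (D m) \<and> (m = 0 \<longrightarrow> D m = d0)) \<and> ex m (D m) (D (Suc m))"
  proof (rule dependent_nat_choice, goal_cases)
    case 1
    have "good 0 d0"
      unfolding good_def using d0 next_lifts[OF d0(1,2) eps N hN d0(3) e0] by blast
    then show ?case by blast
  next
    case (2 d' m)
    then have g: "d' \<in> semilinear_hom R id (K (Suc m)) (K m)"
      "\<And>x. x \<in> carrier (K (Suc m)) \<Longrightarrow> reduce m (d' x) = \<delta> m (reduce (Suc m) x)"
      "lifts_kernel (K (Suc m)) (reduce (Suc m)) (Kbar (Suc m)) (K m) (Kbar m) d' (\<delta> m)"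
      by (auto simp: good_def)
    obtain d'' where d'': "d'' \<in> semilinear_hom R id (K (Suc (Suc m))) (K (Suc m))"
      "\<And>x. x \<in> carrier (K (Suc (Suc m))) \<Longrightarrow> reduce (Suc m) (d'' x) = \<delta> (Suc m) (reduce (Suc (Suc m)) x)"
      "\<And>x. x \<in> carrier (K (Suc (Suc m))) \<Longrightarrow> d' (d'' x) = \<zero>\<^bsub>K m\<^esub>"
      using lift_differential[OF left_module_K g(1,3) d dd] by blast
    have e: "\<exists>y\<in>carrier (K (Suc (Suc m))). d'' y = x" if "x \<in> carrier (K (Suc m))" "d' x = \<zero>\<^bsub>K m\<^esub>" for x
      by (rule next_exact[OF d''(1,2) g(1) hred_K g(2) d''(3) exact that])
    have "good (Suc m) d''"
      unfolding good_def using d'' next_lifts[OF d''(1,2) g(1) left_module_K hred_K d''(3) e] by blast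
    moreover have "ex m d' d''" unfolding ex_def using d''(3) e by blast
    ultimately show ?case by auto
  qed
  then obtain D where D: "\<And>m. good m (D m)" "D 0 = d0" "\<And>m. ex m (D m) (D (Suc m))"
    by blast
  have "left_resolution R N K D \<epsilon>"
    unfolding left_resolution_def
  proof (intro conjI allI N left_module_K eps eps_surj)
    show "D m \<in> semilinear_hom R id (K (Suc m)) (K m)" for m using D(1) by (simp add: good_def)
    show "{x \<in> carrier (K 0). \<epsilon> x = \<zero>\<^bsub>N\<^esub>} = D 0 ` carrier (K (Suc 0))"
      using e0 d0(3) semilinear_homD(1)[OF d0(1)] unfolding D(2) by blast
    show "{x \<in> carrier (K (Suc m)). D m x = \<zero>\<^bsub>K m\<^esub>} = D (Suc m) ` carrier (K (Suc (Suc m)))" for m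
    proof -
      have "D (Suc m) \<in> semilinear_hom R id (K (Suc (Suc m))) (K (Suc m))"
        using D(1) by (simp add: good_def)
      from semilinear_homD(1)[OF this] show ?thesis
        using D(3)[of m] unfolding ex_def by blast
    qed
  qed
  then show ?thesis using D(1) unfolding good_def by blast
qed

end

section \<open>Associated graded objects\<close>

text \<open>
  The coset of \<open>\<eta>\<^sup>i x\<close> modulo \<open>\<eta>\<^sup>i\<^sup>+\<^sup>1 M\<close> depends only on \<open>c = p x\<close>; it is the image under \<open>\<eta>\<^sup>i\<close> of
  the fibre of \<open>p\<close> over \<open>c\<close>.
\<close>

definition gr_coset :: "('m, 'x) ring_scheme \<Rightarrow> ('m \<Rightarrow> 'm) \<Rightarrow> ('m \<Rightarrow> 'c) \<Rightarrow> nat \<Rightarrow> 'c \<Rightarrow> 'm set" where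
  "gr_coset M \<eta> p i c = (\<eta> ^^ i) ` {x \<in> carrier M. p x = c}"

context hred
begin

abbreviation F :: "nat \<Rightarrow> 'm set" where "F i \<equiv> (\<eta> ^^ i) ` carrier M"
abbreviation G :: "nat \<Rightarrow> 'm set monoid" where "G i \<equiv> gr_piece M F i"
abbreviation \<kappa> :: "nat \<Rightarrow> 'c \<Rightarrow> 'm set" where "\<kappa> \<equiv> gr_coset M \<eta> p"

lemma etan_closed: "x \<in> carrier M \<Longrightarrow> (\<eta> ^^ i) x \<in> carrier M"
  by (induction i) (auto simp: eta_closed)

lemma etan_add:
  "x \<in> carrier M \<Longrightarrow> y \<in> carrier M \<Longrightarrow> (\<eta> ^^ i) (x \<oplus>\<^bsub>M\<^esub> y) = (\<eta> ^^ i) x \<oplus>\<^bsub>M\<^esub> (\<eta> ^^ i) y"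
  by (induction i) (auto simp: eta_add etan_closed)

lemma etan_inj: "x \<in> carrier M \<Longrightarrow> y \<in> carrier M \<Longrightarrow> (\<eta> ^^ i) x = (\<eta> ^^ i) y \<Longrightarrow> x = y"
  by (induction i) (auto dest: eta_inj[rotated 2] simp: etan_closed)

lemma gr_coset_inj:
  assumes "c \<in> carrier C" "c' \<in> carrier C" "\<kappa> i c = \<kappa> i c'"
  shows "c = c'"
proof -
  obtain x where x: "x \<in> carrier M" "p x = c" using p_surj assms by blast
  then have "(\<eta> ^^ i) x \<in> \<kappa> i c'" using assms by (auto simp: gr_coset_def)
  then obtain y where "y \<in> carrier M" "p y = c'" "(\<eta> ^^ i) x = (\<eta> ^^ i) y" by (auto simp: gr_coset_def)
  then show ?thesis using x etan_inj by metis
qed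

lemma coset_eq_gr_coset:
  assumes x: "x \<in> carrier M" shows "F (Suc i) +>\<^bsub>M\<^esub> ((\<eta> ^^ i) x) = \<kappa> i (p x)"
proof -
  have "(\<eta> ^^ Suc i) z \<oplus>\<^bsub>M\<^esub> (\<eta> ^^ i) x = (\<eta> ^^ i) (\<eta> z \<oplus>\<^bsub>M\<^esub> x)" if "z \<in> carrier M" for z
    using that x by (simp add: etan_add eta_closed funpow_swap1)
  then have "F (Suc i) +>\<^bsub>M\<^esub> ((\<eta> ^^ i) x) = (\<eta> ^^ i) ` (\<lambda>z. \<eta> z \<oplus>\<^bsub>M\<^esub> x) ` carrier M"
    unfolding a_r_coset_def' by (auto simp del: funpow.simps)
  also have "(\<lambda>z. \<eta> z \<oplus>\<^bsub>M\<^esub> x) ` carrier M = {y \<in> carrier M. p y = p x}"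
    using p_eq_iff[OF _ x] x by (auto simp: eta_closed)
  finally show ?thesis by (simp add: gr_coset_def)
qed

lemma gr_coset_zero: "\<kappa> i \<zero>\<^bsub>C\<^esub> = F (Suc i)"
proof -
  have "{x \<in> carrier M. p x = \<zero>\<^bsub>C\<^esub>} = \<eta> ` carrier M"
    using p_zero_iff p_eta eta_closed by blast
  then show ?thesis by (simp add: gr_coset_def image_image funpow_swap1)
qed

lemma G_one: "\<one>\<^bsub>G i\<^esub> = \<kappa> i \<zero>\<^bsub>C\<^esub>"
  unfolding gr_coset_zero by (simp add: gr_piece_def A_FactGroup_def FactGroup_def)

lemma G_carrier: "carrier (G i) = \<kappa> i ` carrier C"
proof -
  have "carrier (G i) = (\<lambda>x. F (Suc i) +>\<^bsub>M\<^esub> ((\<eta> ^^ i) x)) ` carrier M"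
    by (auto simp: gr_piece_def A_FactGroup_def FactGroup_def RCOSETS_def r_coset_def a_r_coset_def)
  also have "\<dots> = (\<lambda>x. \<kappa> i (p x)) ` carrier M"
    by (intro image_cong refl coset_eq_gr_coset)
  also have "\<dots> = \<kappa> i ` carrier C"
    using p_surj p_closed by (auto simp: image_iff)
  finally show ?thesis .
qed

lemma G_mult:
  assumes "a \<in> carrier C" "b \<in> carrier C"
  shows "\<kappa> i a \<otimes>\<^bsub>G i\<^esub> \<kappa> i b = \<kappa> i (a \<oplus>\<^bsub>C\<^esub> b)"
proof -
  have "\<kappa> i a \<otimes>\<^bsub>G i\<^esub> \<kappa> i b = (\<Union>x\<in>\<kappa> i a. \<Union>y\<in>\<kappa> i b. {x \<oplus>\<^bsub>M\<^esub> y})"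
    by (simp add: gr_piece_def A_FactGroup_def FactGroup_def set_mult_def)
  also have "\<dots> = \<kappa> i (a \<oplus>\<^bsub>C\<^esub> b)"
  proof (intro equalityI subsetI)
    fix z assume "z \<in> (\<Union>x\<in>\<kappa> i a. \<Union>y\<in>\<kappa> i b. {x \<oplus>\<^bsub>M\<^esub> y})"
    then obtain x y where "x \<in> carrier M" "y \<in> carrier M" "p x = a" "p y = b"
      "z = (\<eta> ^^ i) x \<oplus>\<^bsub>M\<^esub> (\<eta> ^^ i) y" by (auto simp: gr_coset_def)
    then show "z \<in> \<kappa> i (a \<oplus>\<^bsub>C\<^esub> b)"
      by (auto simp: gr_coset_def etan_add[symmetric] p_add)
  next
    fix z assume "z \<in> \<kappa> i (a \<oplus>\<^bsub>C\<^esub> b)"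
    then obtain w where w: "w \<in> carrier M" "p w = a \<oplus>\<^bsub>C\<^esub> b" "z = (\<eta> ^^ i) w" by (auto simp: gr_coset_def)
    obtain x where x: "x \<in> carrier M" "p x = a" using assms p_surj by blast
    \<comment> \<open>Any preimage of a is completed to a decomposition of w, so the sum of two
      cosets is a full coset.\<close>
    define y where "y = \<ominus>\<^bsub>M\<^esub> x \<oplus>\<^bsub>M\<^esub> w"
    have y: "y \<in> carrier M" "p y = b" "w = x \<oplus>\<^bsub>M\<^esub> y"
      using x w assms by (simp_all add: y_def p_add p_minus M.r_neg2 C.r_neg1)
    then have "z = (\<eta> ^^ i) x \<oplus>\<^bsub>M\<^esub> (\<eta> ^^ i) y" using w x by (simp add: etan_add)
    then show "z \<in> (\<Union>x\<in>\<kappa> i a. \<Union>y\<in>\<kappa> i b. {x \<oplus>\<^bsub>M\<^esub> y})"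
      using x y unfolding gr_coset_def by blast
  qed
  finally show ?thesis .
qed

lemma G_comm_monoid: "comm_monoid (G i)"
  by (rule comm_monoidI) (auto simp: G_carrier G_one G_mult C.a_ac)

lemma G_finprod:
  assumes "a \<in> A \<rightarrow> carrier C"
  shows "finprod (G i) (\<lambda>j. \<kappa> i (a j)) A = \<kappa> i (finsum C a A)"
proof -
  interpret G: comm_monoid "G i" by (rule G_comm_monoid)
  show ?thesis
    using assms
  proof (induction A rule: infinite_finite_induct)
    case (insert j A)
    then have "a \<in> A \<rightarrow> carrier C" "a j \<in> carrier C" by auto
    then show ?case
      using insert G_mult[of "a j" "finsum C a A" i] by (simp add: Pi_iff G_carrier C.finsum_closed)
  qed (auto simp: G_one)
qed

text \<open>Here \<open>up C\<close> serves as \<open>C[h]\<close> for a mere abelian group C; its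
  degree bound has to be matched with the finite support in the associated graded.\<close>

lemma up_iff_finite:
  "c \<in> up C \<longleftrightarrow> c \<in> UNIV \<rightarrow> carrier C \<and> finite {i. c i \<noteq> \<zero>\<^bsub>C\<^esub>}"
  unfolding up_def bound_def finite_nat_set_iff_bounded_le
  by (auto simp: not_less) (meson leI not_le)+

lemma gr_carrier_eq: "gr_carrier M F = (\<lambda>c i. \<kappa> i (c i)) ` up C"
proof (intro equalityI subsetI)
  fix f assume f: "f \<in> gr_carrier M F"
  then have "\<forall>i. \<exists>c. c \<in> carrier C \<and> f i = \<kappa> i c" by (auto simp: gr_carrier_def G_carrier)
  then obtain c where c: "\<And>i. c i \<in> carrier C" "\<And>i. f i = \<kappa> i (c i)" by metis
  have "{i. c i \<noteq> \<zero>\<^bsub>C\<^esub>} = {i. f i \<noteq> \<one>\<^bsub>G i\<^esub>}"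
    using c gr_coset_inj by (auto simp: G_one)
  then have "c \<in> up C" using f c by (auto simp: up_iff_finite gr_carrier_def)
  moreover have "f = (\<lambda>i. \<kappa> i (c i))" using c by auto
  ultimately show "f \<in> (\<lambda>c i. \<kappa> i (c i)) ` up C" by blast
next
  fix f assume "f \<in> (\<lambda>c i. \<kappa> i (c i)) ` up C"
  then obtain c where c: "c \<in> up C" "f = (\<lambda>i. \<kappa> i (c i))" by auto
  then have "{i. f i \<noteq> \<one>\<^bsub>G i\<^esub>} \<subseteq> {i. c i \<noteq> \<zero>\<^bsub>C\<^esub>}" by (auto simp: G_one)
  then show "f \<in> gr_carrier M F"
    using c finite_subset by (auto simp: gr_carrier_def up_iff_finite G_carrier)
qed

lemma gr_coset_seq_bij: "bij_betw (\<lambda>c i. \<kappa> i (c i)) (up C) (gr_carrier M F)"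
  unfolding bij_betw_def gr_carrier_eq
proof (intro conjI refl inj_onI ext)
  fix c c' i assume "c \<in> up C" "c' \<in> up C" and e: "(\<lambda>i. \<kappa> i (c i)) = (\<lambda>i. \<kappa> i (c' i))"
  then have "c i \<in> carrier C" "c' i \<in> carrier C" by (auto simp: up_def)
  then show "c i = c' i" using fun_cong[OF e, of i] gr_coset_inj by blast
qed

lemma gr_class_eq:
  assumes "x \<in> carrier M"
  shows "gr_class M F d ((\<eta> ^^ d) x) = (\<lambda>i. \<kappa> i (if i = d then p x else \<zero>\<^bsub>C\<^esub>))"
proof
  fix i
  show "gr_class M F d ((\<eta> ^^ d) x) i = \<kappa> i (if i = d then p x else \<zero>\<^bsub>C\<^esub>)"
    using coset_eq_gr_coset[OF assms, of d] by (simp add: gr_class_def G_one del: funpow.simps)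
qed

end

text \<open>Powers of h pull out of both arguments, so the pieces j and i - j multiply into the
  piece i through the product of the reductions. The ring multiplication and the module actions are
  both instances.\<close>

lemma bilinear_coset:
  assumes R: "hred R \<zeta> q U" and M: "hred M \<eta> p C"
    and act: "\<And>u x. u \<in> carrier R \<Longrightarrow> x \<in> carrier M \<Longrightarrow> act u x \<in> carrier M"
    and act_zeta: "\<And>u x. u \<in> carrier R \<Longrightarrow> x \<in> carrier M \<Longrightarrow> act (\<zeta> u) x = \<eta> (act u x)"
    and act_eta: "\<And>u x. u \<in> carrier R \<Longrightarrow> x \<in> carrier M \<Longrightarrow> act u (\<eta> x) = \<eta> (act u x)"
    and p_act: "\<And>u x. u \<in> carrier R \<Longrightarrow> x \<in> carrier M \<Longrightarrow> p (act u x) = act' (q u) (p x)"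
    and a: "a \<in> carrier U" and c: "c \<in> carrier C" and j: "j \<le> i"
  shows "(\<Union>u\<in>gr_coset R \<zeta> q j a. \<Union>x\<in>gr_coset M \<eta> p (i - j) c. (\<eta> ^^ Suc i) ` carrier M +>\<^bsub>M\<^esub> act u x)
    = gr_coset M \<eta> p i (act' a c)"
proof -
  interpret R: hred R \<zeta> q U by fact
  interpret M: hred M \<eta> p C by fact
  have 1: "act ((\<zeta> ^^ j) u) x = (\<eta> ^^ j) (act u x)" if "u \<in> carrier R" "x \<in> carrier M" for u x j
    using that by (induction j) (auto simp: act_zeta R.etan_closed)
  have 2: "act u ((\<eta> ^^ j) x) = (\<eta> ^^ j) (act u x)" if "u \<in> carrier R" "x \<in> carrier M" for u x j
    using that by (induction j) (auto simp: act_eta M.etan_closed)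
  have "(\<eta> ^^ Suc i) ` carrier M +>\<^bsub>M\<^esub> act u x = gr_coset M \<eta> p i (act' a c)"
    if uk: "u \<in> gr_coset R \<zeta> q j a" and xk: "x \<in> gr_coset M \<eta> p (i - j) c" for u x
  proof -
    obtain r where r: "r \<in> carrier R" "q r = a" "u = (\<zeta> ^^ j) r"
      using uk by (auto simp: gr_coset_def)
    obtain y where y: "y \<in> carrier M" "p y = c" "x = (\<eta> ^^ (i - j)) y"
      using xk by (auto simp: gr_coset_def)
    note ry = r y
    have "act u x = (\<eta> ^^ j) ((\<eta> ^^ (i - j)) (act r y))"
      using ry by (simp add: 1 2 M.etan_closed act)
    also have "\<dots> = (\<eta> ^^ i) (act r y)"
      using j by (simp add: funpow_add[THEN fun_cong, unfolded o_apply, symmetric])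
    finally show ?thesis
      using M.coset_eq_gr_coset[of "act r y" i] ry act p_act by simp
  qed
  \<comment> \<open>Without representatives the union would be empty instead of a coset.\<close>
  moreover have "gr_coset R \<zeta> q j a \<noteq> {}" "gr_coset M \<eta> p (i - j) c \<noteq> {}"
    using R.p_surj[OF a] M.p_surj[OF c] by (auto simp: gr_coset_def)
  ultimately show ?thesis by auto
qed

lemma gr_map_coset:
  assumes "hmap M \<eta> p C L \<eta>' p' E f \<delta>" and c: "c \<in> carrier C"
  shows "(\<Union>x\<in>gr_coset M \<eta> p i c. (\<eta>' ^^ Suc i) ` carrier L +>\<^bsub>L\<^esub> f x) = gr_coset L \<eta>' p' i (\<delta> c)"
proof -
  interpret f: hmap M \<eta> p C L \<eta>' p' E f \<delta> by fact
  have 1: "f ((\<eta> ^^ i) x) = (\<eta>' ^^ i) (f x)" if "x \<in> carrier M" for x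
    using that by (induction i) (auto simp: f.f_eta f.M.etan_closed)
  have "(\<eta>' ^^ Suc i) ` carrier L +>\<^bsub>L\<^esub> f x = gr_coset L \<eta>' p' i (\<delta> c)" if "x \<in> gr_coset M \<eta> p i c" for x
    using that f.L.coset_eq_gr_coset f.f_closed f.f_p by (auto simp: gr_coset_def 1 simp del: funpow.simps)
  moreover have "gr_coset M \<eta> p i c \<noteq> {}"
    using f.M.p_surj[OF c] by (auto simp: gr_coset_def)
  ultimately show ?thesis by auto
qed

lemma UP_simps:
  "carrier (UP U) = up U"
  "\<lbrakk>a \<in> up U; b \<in> up U\<rbrakk> \<Longrightarrow> a \<otimes>\<^bsub>UP U\<^esub> b = (\<lambda>i. \<Oplus>\<^bsub>U\<^esub>j\<in>{..i}. a j \<otimes>\<^bsub>U\<^esub> b (i - j))"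
  "\<lbrakk>a \<in> up U; b \<in> up U\<rbrakk> \<Longrightarrow> a \<oplus>\<^bsub>UP U\<^esub> b = (\<lambda>i. a i \<oplus>\<^bsub>U\<^esub> b i)"
  "\<one>\<^bsub>UP U\<^esub> = (\<lambda>i. if i = 0 then \<one>\<^bsub>U\<^esub> else \<zero>\<^bsub>U\<^esub>)"
  "\<zero>\<^bsub>UP U\<^esub> = (\<lambda>i. \<zero>\<^bsub>U\<^esub>)"
  "c \<in> carrier U \<Longrightarrow> up_ring.monom (UP U) c d = (\<lambda>i. if i = d then c else \<zero>\<^bsub>U\<^esub>)"
  by (auto simp: UP_def fun_eq_iff)

lemma up_closed: "a \<in> up U \<Longrightarrow> a i \<in> carrier U"
  by (auto simp: up_def)

section \<open>The associated graded of a deformation and of its modules\<close>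

context deform
begin

abbreviation gr_seq :: "(nat \<Rightarrow> 'u) \<Rightarrow> nat \<Rightarrow> 'r set" where
  "gr_seq f \<equiv> (\<lambda>i. gr_coset R (\<lambda>x. h \<otimes>\<^bsub>R\<^esub> x) p i (f i))"

lemma h_lcomm:
  assumes "x \<in> carrier R" "y \<in> carrier R"
  shows "x \<otimes>\<^bsub>R\<^esub> (h \<otimes>\<^bsub>R\<^esub> y) = h \<otimes>\<^bsub>R\<^esub> (x \<otimes>\<^bsub>R\<^esub> y)"
  using assms h_closed h_comm[OF assms(1)] by (simp add: R.m_assoc[symmetric])

lemma hfilt_eq: "hfilt R h = red.F"
proof
  fix i
  have "(h [^]\<^bsub>R\<^esub> i) \<otimes>\<^bsub>R\<^esub> x = ((\<lambda>x. h \<otimes>\<^bsub>R\<^esub> x) ^^ i) x" if "x \<in> carrier R" for x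
    using that
  proof (induction i arbitrary: x)
    case (Suc i)
    from Suc.prems have "(h [^]\<^bsub>R\<^esub> Suc i) \<otimes>\<^bsub>R\<^esub> x = (h [^]\<^bsub>R\<^esub> i) \<otimes>\<^bsub>R\<^esub> (h \<otimes>\<^bsub>R\<^esub> x)"
      using h_closed by (simp add: R.m_assoc)
    also have "\<dots> = ((\<lambda>x. h \<otimes>\<^bsub>R\<^esub> x) ^^ i) (h \<otimes>\<^bsub>R\<^esub> x)"
      using Suc.prems h_closed by (intro Suc.IH) simp
    finally show ?case by (simp add: funpow_swap1)
  qed simp
  then show "hfilt R h i = red.F i" unfolding hfilt_def by (intro image_cong) auto
qed

lemma mfilt_eq:
  assumes "left_module R M"
  shows "mfilt R h M = (\<lambda>i. ((\<lambda>x. h \<odot>\<^bsub>M\<^esub> x) ^^ i) ` carrier M)"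
proof
  fix i
  interpret M: left_module R M by fact
  have "(h [^]\<^bsub>R\<^esub> i) \<odot>\<^bsub>M\<^esub> x = ((\<lambda>x. h \<odot>\<^bsub>M\<^esub> x) ^^ i) x" if "x \<in> carrier M" for x
    using that
  proof (induction i arbitrary: x)
    case (Suc i)
    then have "(h [^]\<^bsub>R\<^esub> Suc i) \<odot>\<^bsub>M\<^esub> x = (h [^]\<^bsub>R\<^esub> i) \<odot>\<^bsub>M\<^esub> (h \<odot>\<^bsub>M\<^esub> x)"
      using h_closed by (simp add: M.smult_assoc)
    also have "\<dots> = ((\<lambda>x. h \<odot>\<^bsub>M\<^esub> x) ^^ i) (h \<odot>\<^bsub>M\<^esub> x)"
      using Suc.prems h_closed by (intro Suc.IH M.smult_closed)
    finally show ?case by (simp add: funpow_swap1)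
  qed (simp add: M.smult_one)
  then show "mfilt R h M i = ((\<lambda>x. h \<odot>\<^bsub>M\<^esub> x) ^^ i) ` carrier M"
    unfolding mfilt_def by (intro image_cong) auto
qed

lemma h_act:
  assumes "left_module R M" "u \<in> carrier R" "x \<in> carrier M"
  shows "(h \<otimes>\<^bsub>R\<^esub> u) \<odot>\<^bsub>M\<^esub> x = h \<odot>\<^bsub>M\<^esub> (u \<odot>\<^bsub>M\<^esub> x)" and "u \<odot>\<^bsub>M\<^esub> (h \<odot>\<^bsub>M\<^esub> x) = h \<odot>\<^bsub>M\<^esub> (u \<odot>\<^bsub>M\<^esub> x)"
proof -
  interpret M: left_module R M by fact
  show 1: "(h \<otimes>\<^bsub>R\<^esub> u) \<odot>\<^bsub>M\<^esub> x = h \<odot>\<^bsub>M\<^esub> (u \<odot>\<^bsub>M\<^esub> x)"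
    using assms h_closed by (simp add: M.smult_assoc)
  show "u \<odot>\<^bsub>M\<^esub> (h \<odot>\<^bsub>M\<^esub> x) = h \<odot>\<^bsub>M\<^esub> (u \<odot>\<^bsub>M\<^esub> x)"
    using assms h_closed 1 by (simp add: M.smult_assoc[symmetric] h_comm)
qed

lemma gr_ring_simps:
  "carrier (gr_ring R h) = gr_carrier R red.F"
  "f \<oplus>\<^bsub>gr_ring R h\<^esub> g = (\<lambda>i. f i \<otimes>\<^bsub>red.G i\<^esub> g i)"
  "f \<otimes>\<^bsub>gr_ring R h\<^esub> g = (\<lambda>i. finprod (red.G i) (\<lambda>j. rcoset_mult R (red.F (Suc i)) (f j) (g (i - j))) {..i})"
  "\<one>\<^bsub>gr_ring R h\<^esub> = gr_class R red.F 0 \<one>\<^bsub>R\<^esub>"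
  by (simp_all add: gr_ring_def Let_def hfilt_eq)

text \<open>As h is regular, each piece is a copy of U through \<open>gr_coset\<close>; by
  \<open>bilinear_coset\<close> the product of the graded ring is then the convolution of
  polynomials.\<close>

theorem gr_ring_iso: "gr_seq \<in> ring_iso (UP U) (gr_ring R h)"
proof (rule ring_iso_memI)
  show "gr_seq f \<in> carrier (gr_ring R h)" if "f \<in> carrier (UP U)" for f
    using that unfolding gr_ring_simps UP_simps red.gr_carrier_eq by blast
  show "bij_betw gr_seq (carrier (UP U)) (carrier (gr_ring R h))"
    unfolding gr_ring_simps UP_simps by (rule red.gr_coset_seq_bij)
  show "gr_seq \<one>\<^bsub>UP U\<^esub> = \<one>\<^bsub>gr_ring R h\<^esub>"
    using red.gr_class_eq[of "\<one>\<^bsub>R\<^esub>" 0] by (simp add: gr_ring_simps UP_simps p_one cong: if_cong)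
next
  fix f g assume "f \<in> carrier (UP U)" "g \<in> carrier (UP U)"
  then have fg: "f \<in> up U" "g \<in> up U" by (simp_all add: UP_simps)
  note cl = up_closed[OF fg(1)] up_closed[OF fg(2)]
  show "gr_seq (f \<oplus>\<^bsub>UP U\<^esub> g) = gr_seq f \<oplus>\<^bsub>gr_ring R h\<^esub> gr_seq g"
    using fg cl by (simp add: gr_ring_simps UP_simps red.G_mult)
  show "gr_seq (f \<otimes>\<^bsub>UP U\<^esub> g) = gr_seq f \<otimes>\<^bsub>gr_ring R h\<^esub> gr_seq g"
  proof
    fix i
    interpret G: comm_monoid "red.G i" by (rule red.G_comm_monoid)
    have "gr_seq (f \<otimes>\<^bsub>UP U\<^esub> g) i = finprod (red.G i) (\<lambda>j. red.\<kappa> i (f j \<otimes>\<^bsub>U\<^esub> g (i - j))) {..i}"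
      using fg cl by (subst red.G_finprod) (auto simp: UP_simps)
    also have "\<dots> = finprod (red.G i) (\<lambda>j. rcoset_mult R (red.F (Suc i)) (gr_seq f j) (gr_seq g (i - j))) {..i}"
    proof (rule G.finprod_cong'[symmetric])
      show "(\<lambda>j. red.\<kappa> i (f j \<otimes>\<^bsub>U\<^esub> g (i - j))) \<in> {..i} \<rightarrow> carrier (red.G i)"
        using cl by (auto simp: red.G_carrier)
      fix j assume "j \<in> {..i}"
      then show "rcoset_mult R (red.F (Suc i)) (gr_seq f j) (gr_seq g (i - j)) = red.\<kappa> i (f j \<otimes>\<^bsub>U\<^esub> g (i - j))"
        unfolding rcoset_mult_def
        by (intro bilinear_coset[where act = "\<lambda>x y. x \<otimes>\<^bsub>R\<^esub> y", OF red.hred_axioms red.hred_axioms])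
          (use cl h_closed in \<open>auto simp: R.m_assoc h_lcomm p_mult\<close>)
    qed simp
    finally show "gr_seq (f \<otimes>\<^bsub>UP U\<^esub> g) i = (gr_seq f \<otimes>\<^bsub>gr_ring R h\<^esub> gr_seq g) i"
      by (simp add: gr_ring_simps)
  qed
qed

lemma gr_module_simps:
  assumes "left_module R M"
  defines "F \<equiv> \<lambda>i. ((\<lambda>x. h \<odot>\<^bsub>M\<^esub> x) ^^ i) ` carrier M"
  shows "carrier (gr_module R h M) = gr_carrier M F"
    "f \<oplus>\<^bsub>gr_module R h M\<^esub> g = (\<lambda>i. f i \<otimes>\<^bsub>gr_piece M F i\<^esub> g i)"
    "a \<odot>\<^bsub>gr_module R h M\<^esub> f = (\<lambda>i. finprod (gr_piece M F i)
      (\<lambda>j. \<Union>u\<in>a j. \<Union>x\<in>f (i - j). F (Suc i) +>\<^bsub>M\<^esub> (u \<odot>\<^bsub>M\<^esub> x)) {..i})"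
  using mfilt_eq[OF assms(1)] by (simp_all add: gr_module_def Let_def F_def)

lemma gr_module_smult:
  assumes M: "left_module R M" and hM: "hred M (\<lambda>x. h \<odot>\<^bsub>M\<^esub> x) q C"
    and act: "\<And>u x. u \<in> carrier R \<Longrightarrow> x \<in> carrier M \<Longrightarrow> q (u \<odot>\<^bsub>M\<^esub> x) = act (p u) (q x)"
    and a: "a \<in> up U" and c: "c \<in> up C"
    and cl: "\<And>u x. u \<in> carrier U \<Longrightarrow> x \<in> carrier C \<Longrightarrow> act u x \<in> carrier C"
  shows "gr_seq a \<odot>\<^bsub>gr_module R h M\<^esub> (\<lambda>i. gr_coset M (\<lambda>x. h \<odot>\<^bsub>M\<^esub> x) q i (c i))
    = (\<lambda>i. gr_coset M (\<lambda>x. h \<odot>\<^bsub>M\<^esub> x) q i (\<Oplus>\<^bsub>C\<^esub>j\<in>{..i}. act (a j) (c (i - j))))"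
proof
  fix i
  interpret M: left_module R M by fact
  interpret hM: hred M "\<lambda>x. h \<odot>\<^bsub>M\<^esub> x" q C by fact
  interpret G: comm_monoid "hM.G i" by (rule hM.G_comm_monoid)
  have acl: "act (a j) (c k) \<in> carrier C" for j k using cl up_closed[OF a] up_closed[OF c] by blast
  have "hM.\<kappa> i (\<Oplus>\<^bsub>C\<^esub>j\<in>{..i}. act (a j) (c (i - j)))
      = finprod (hM.G i) (\<lambda>j. hM.\<kappa> i (act (a j) (c (i - j)))) {..i}"
    using acl by (subst hM.G_finprod) auto
  also have "\<dots> = finprod (hM.G i) (\<lambda>j. \<Union>u\<in>gr_seq a j. \<Union>x\<in>hM.\<kappa> (i - j) (c (i - j)).
      hM.F (Suc i) +>\<^bsub>M\<^esub> (u \<odot>\<^bsub>M\<^esub> x)) {..i}"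
  proof (rule G.finprod_cong'[symmetric])
    show "(\<lambda>j. hM.\<kappa> i (act (a j) (c (i - j)))) \<in> {..i} \<rightarrow> carrier (hM.G i)"
      using acl by (auto simp: hM.G_carrier)
    fix j assume "j \<in> {..i}"
    then show "(\<Union>u\<in>gr_seq a j. \<Union>x\<in>hM.\<kappa> (i - j) (c (i - j)). hM.F (Suc i) +>\<^bsub>M\<^esub> (u \<odot>\<^bsub>M\<^esub> x))
        = hM.\<kappa> i (act (a j) (c (i - j)))"
      by (intro bilinear_coset[OF red.hred_axioms hM])
        (use M.smult_closed h_act[OF M] act up_closed[OF a] up_closed[OF c] in auto)
  qed simp
  finally show "(gr_seq a \<odot>\<^bsub>gr_module R h M\<^esub> (\<lambda>i. hM.\<kappa> i (c i))) i
      = hM.\<kappa> i (\<Oplus>\<^bsub>C\<^esub>j\<in>{..i}. act (a j) (c (i - j)))"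
    by (simp add: gr_module_simps[OF M])
qed

text \<open>The map t presents L as polynomials with coefficients in the reduction C. It is a
  transposition of indices for the exterior modules and the identity for
  \<open>k[h]\<close>.\<close>

lemma gr_module_iso:
  assumes M: "left_module R M" and hM: "hred M (\<lambda>x. h \<odot>\<^bsub>M\<^esub> x) q C"
    and act: "\<And>u x. u \<in> carrier R \<Longrightarrow> x \<in> carrier M \<Longrightarrow> q (u \<odot>\<^bsub>M\<^esub> x) = act (p u) (q x)"
    and cl: "\<And>u x. u \<in> carrier U \<Longrightarrow> x \<in> carrier C \<Longrightarrow> act u x \<in> carrier C"
    and t: "bij_betw t (carrier L) (up C)"
    and t_add: "\<And>x y i. x \<in> carrier L \<Longrightarrow> y \<in> carrier L \<Longrightarrow> t (x \<oplus>\<^bsub>L\<^esub> y) i = t x i \<oplus>\<^bsub>C\<^esub> t y i"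
    and t_smult: "\<And>a x i. a \<in> up U \<Longrightarrow> x \<in> carrier L \<Longrightarrow>
      t (a \<odot>\<^bsub>L\<^esub> x) i = (\<Oplus>\<^bsub>C\<^esub>j\<in>{..i}. act (a j) (t x (i - j)))"
  shows "(\<lambda>x i. gr_coset M (\<lambda>x. h \<odot>\<^bsub>M\<^esub> x) q i (t x i)) \<in> semilinear_iso (UP U) gr_seq L (gr_module R h M)"
proof -
  interpret M: left_module R M by fact
  interpret hM: hred M "\<lambda>x. h \<odot>\<^bsub>M\<^esub> x" q C by fact
  have up: "t x \<in> up C" if "x \<in> carrier L" for x using t that by (auto simp: bij_betw_def)
  have bij: "bij_betw (\<lambda>x i. hM.\<kappa> i (t x i)) (carrier L) (carrier (gr_module R h M))"
    using bij_betw_trans[OF t hM.gr_coset_seq_bij] by (simp add: gr_module_simps[OF M] comp_def)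
  moreover have "(\<lambda>x i. hM.\<kappa> i (t x i)) \<in> semilinear_hom (UP U) gr_seq L (gr_module R h M)"
    unfolding semilinear_hom_def
  proof (intro CollectI conjI ballI)
    show "(\<lambda>x i. hM.\<kappa> i (t x i)) \<in> carrier L \<rightarrow> carrier (gr_module R h M)"
      using bij by (auto simp: bij_betw_def)
    show "(\<lambda>i. hM.\<kappa> i (t (x \<oplus>\<^bsub>L\<^esub> y) i))
        = (\<lambda>i. hM.\<kappa> i (t x i)) \<oplus>\<^bsub>gr_module R h M\<^esub> (\<lambda>i. hM.\<kappa> i (t y i))"
      if "x \<in> carrier L" "y \<in> carrier L" for x y
      using that by (simp add: gr_module_simps[OF M] t_add hM.G_mult up_closed[OF up])
    show "(\<lambda>i. hM.\<kappa> i (t (a \<odot>\<^bsub>L\<^esub> x) i)) = gr_seq a \<odot>\<^bsub>gr_module R h M\<^esub> (\<lambda>i. hM.\<kappa> i (t x i))"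
      if "a \<in> carrier (UP U)" "x \<in> carrier L" for a x
      using gr_module_smult[OF M hM act _ up cl] that by (simp add: t_smult UP_simps)
  qed
  ultimately show ?thesis by (simp add: semilinear_iso_def)
qed

text \<open>A family of polynomials indexed by basis vectors, read as a polynomial whose
  coefficients are families.\<close>

abbreviation tr :: "nat \<Rightarrow> (nat set \<Rightarrow> nat \<Rightarrow> 'u) \<Rightarrow> nat \<Rightarrow> nat set \<Rightarrow> 'u" where
  "tr m x \<equiv> (\<lambda>i. \<lambda>S\<in>ext_index n m. x S i)"

abbreviation gr_ext :: "nat \<Rightarrow> (nat set \<Rightarrow> nat \<Rightarrow> 'u) \<Rightarrow> nat \<Rightarrow> (nat set \<Rightarrow> 'r) set" where
  "gr_ext m x \<equiv> (\<lambda>i. gr_coset (K m) (\<lambda>x. h \<odot>\<^bsub>K m\<^esub> x) (reduce m) i (tr m x i))"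

lemma tr_bij: "bij_betw (tr m) (carrier (ext_module (UP U) n m)) (up (Kbar m))"
proof (rule bij_betw_byWitness[where f' = "\<lambda>c. \<lambda>S\<in>ext_index n m. \<lambda>i. c i S"])
  let ?I = "ext_index n m"
  interpret hK: hred "K m" "\<lambda>x. h \<odot>\<^bsub>K m\<^esub> x" "reduce m" "Kbar m" by (rule hred_K)
  have P: "carrier (ext_module (UP U) n m) = ?I \<rightarrow>\<^sub>E up U" by (simp add: ext_module_simps UP_simps)
  show "\<forall>x\<in>carrier (ext_module (UP U) n m). (\<lambda>S\<in>?I. \<lambda>i. tr m x i S) = x"
  proof
    fix x assume "x \<in> carrier (ext_module (UP U) n m)"
    then have "x S = undefined" if "S \<notin> ?I" for S using that unfolding P by (rule PiE_arb)
    then show "(\<lambda>S\<in>?I. \<lambda>i. tr m x i S) = x" by (simp add: fun_eq_iff restrict_def)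
  qed
  show "\<forall>c\<in>up (Kbar m). tr m (\<lambda>S\<in>?I. \<lambda>i. c i S) = c"
  proof
    fix c assume "c \<in> up (Kbar m)"
    then have "c i \<in> ?I \<rightarrow>\<^sub>E carrier U" for i using up_closed[of c "Kbar m" i] by (simp add: ext_module_simps)
    then have "c i S = undefined" if "S \<notin> ?I" for i S using that by (rule PiE_arb)
    then show "tr m (\<lambda>S\<in>?I. \<lambda>i. c i S) = c" by (simp add: fun_eq_iff restrict_def)
  qed
  show "tr m ` carrier (ext_module (UP U) n m) \<subseteq> up (Kbar m)"
  proof clarify
    fix x assume x: "x \<in> carrier (ext_module (UP U) n m)"
    then have xS: "x S \<in> up U" if "S \<in> ?I" for S using that by (auto simp: P)
    \<comment> \<open>The finitely many polynomials of the family together have only finitely many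
      nonzero coefficients.\<close>
    have "{i. tr m x i \<noteq> \<zero>\<^bsub>Kbar m\<^esub>} \<subseteq> (\<Union>S\<in>?I. {i. x S i \<noteq> \<zero>\<^bsub>U\<^esub>})"
      by (auto simp: ext_module_simps fun_eq_iff split: if_splits)
    moreover have "finite (\<Union>S\<in>?I. {i. x S i \<noteq> \<zero>\<^bsub>U\<^esub>})"
      using xS red.up_iff_finite by auto
    ultimately have "finite {i. tr m x i \<noteq> \<zero>\<^bsub>Kbar m\<^esub>}" by (rule finite_subset)
    then show "tr m x \<in> up (Kbar m)"
      unfolding hK.up_iff_finite using up_closed[OF xS] by (auto simp: ext_module_simps)
  qed
  show "(\<lambda>c. \<lambda>S\<in>?I. \<lambda>i. c i S) ` up (Kbar m) \<subseteq> carrier (ext_module (UP U) n m)"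
  proof clarify
    fix c assume c: "c \<in> up (Kbar m)"
    have cl: "c i S \<in> carrier U" if "S \<in> ?I" for i S
      using up_closed[OF c, of i] that by (auto simp: ext_module_simps)
    have "(\<lambda>i. c i S) \<in> up U" if S: "S \<in> ?I" for S
    proof -
      have "{i. c i S \<noteq> \<zero>\<^bsub>U\<^esub>} \<subseteq> {i. c i \<noteq> \<zero>\<^bsub>Kbar m\<^esub>}" using S by (auto simp: ext_module_simps)
      moreover have "finite {i. c i \<noteq> \<zero>\<^bsub>Kbar m\<^esub>}" using c by (simp add: hK.up_iff_finite)
      ultimately have "finite {i. c i S \<noteq> \<zero>\<^bsub>U\<^esub>}" by (rule finite_subset)
      then show ?thesis using cl S by (simp add: red.up_iff_finite)
    qed
    then show "(\<lambda>S\<in>?I. \<lambda>i. c i S) \<in> carrier (ext_module (UP U) n m)" by (simp add: P)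
  qed
qed

theorem gr_ext_iso: "gr_ext m \<in> semilinear_iso (UP U) gr_seq (ext_module (UP U) n m) (gr_module R h (K m))"
proof (rule gr_module_iso[where act = "\<lambda>u x. u \<odot>\<^bsub>Kbar m\<^esub> x"])
  let ?I = "ext_index n m"
  interpret Kb: left_module U "Kbar m" by (rule left_module_Kbar)
  have P: "carrier (ext_module (UP U) n m) = ?I \<rightarrow>\<^sub>E up U" by (simp add: ext_module_simps UP_simps)
  fix x i assume x: "x \<in> carrier (ext_module (UP U) n m)"
  then have xS: "x S \<in> up U" if "S \<in> ?I" for S using that by (auto simp: P)
  show "tr m (x \<oplus>\<^bsub>ext_module (UP U) n m\<^esub> y) i = tr m x i \<oplus>\<^bsub>Kbar m\<^esub> tr m y i"
    if "y \<in> carrier (ext_module (UP U) n m)" for y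
  proof -
    have "y S \<in> up U" if "S \<in> ?I" for S using that \<open>y \<in> _\<close> by (auto simp: P)
    then show ?thesis using xS by (auto simp: ext_module_simps UP_simps intro!: restrict_ext)
  qed
  show "tr m (a \<odot>\<^bsub>ext_module (UP U) n m\<^esub> x) i = (\<Oplus>\<^bsub>Kbar m\<^esub>j\<in>{..i}. a j \<odot>\<^bsub>Kbar m\<^esub> tr m x (i - j))"
    if a: "a \<in> up U" for a
  proof (rule ext_module_eqI)
    have cl: "(\<lambda>j. a j \<odot>\<^bsub>Kbar m\<^esub> tr m x (i - j)) \<in> {..i} \<rightarrow> carrier (Kbar m)"
      using up_closed[OF a] up_closed[OF xS] by (auto simp: ext_module_simps)
    then show "(\<Oplus>\<^bsub>Kbar m\<^esub>j\<in>{..i}. a j \<odot>\<^bsub>Kbar m\<^esub> tr m x (i - j)) \<in> carrier (Kbar m)"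
      by (rule Kb.finsum_closed)
    show "tr m (a \<odot>\<^bsub>ext_module (UP U) n m\<^esub> x) i \<in> carrier (Kbar m)"
      using a xS up_closed[OF a] up_closed[OF xS]
      by (auto simp: ext_module_simps UP_simps intro!: U.finsum_closed)
    fix S assume S: "S \<in> ?I"
    have "(\<Oplus>\<^bsub>Kbar m\<^esub>j\<in>{..i}. a j \<odot>\<^bsub>Kbar m\<^esub> tr m x (i - j)) S
        = (\<Oplus>\<^bsub>U\<^esub>j\<in>{..i}. (a j \<odot>\<^bsub>Kbar m\<^esub> tr m x (i - j)) S)"
      by (rule finsum_ext_module_apply[OF U.abelian_group_axioms cl S])
    also have "\<dots> = (\<Oplus>\<^bsub>U\<^esub>j\<in>{..i}. a j \<otimes>\<^bsub>U\<^esub> x S (i - j))"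
      using S by (simp add: ext_module_simps)
    finally show "tr m (a \<odot>\<^bsub>ext_module (UP U) n m\<^esub> x) i S
        = (\<Oplus>\<^bsub>Kbar m\<^esub>j\<in>{..i}. a j \<odot>\<^bsub>Kbar m\<^esub> tr m x (i - j)) S"
      using S a xS by (simp add: ext_module_simps UP_simps)
  qed
next
  show "u \<odot>\<^bsub>Kbar m\<^esub> x \<in> carrier (Kbar m)" if "u \<in> carrier U" "x \<in> carrier (Kbar m)" for u x
    using left_module.smult_closed[OF left_module_Kbar] that by blast
qed (use left_module_K hred_K reduce_smult tr_bij in auto)

lemma gr_ext_basis:
  assumes "S \<in> ext_index n m"
  shows "gr_ext m (ext_basis (UP U) n m S) = gr_class (K m) (mfilt R h (K m)) 0 (ext_basis R n m S)"
proof -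
  interpret hK: hred "K m" "\<lambda>x. h \<odot>\<^bsub>K m\<^esub> x" "reduce m" "Kbar m" by (rule hred_K)
  have "tr m (ext_basis (UP U) n m S) i = (if i = 0 then reduce m (ext_basis R n m S) else \<zero>\<^bsub>Kbar m\<^esub>)" for i
    by (auto simp: ext_basis_def UP_simps reduce_def ext_module_simps p_one red.p_zero intro!: restrict_ext)
  then show ?thesis
    using hK.gr_class_eq[OF ext_basis_closed[OF R.ring_axioms], of 0 S]
    by (simp add: mfilt_eq[OF left_module_K])
qed

lemma gr_map_eq:
  assumes "left_module R L" "hmap M \<eta> q C L (\<lambda>x. h \<odot>\<^bsub>L\<^esub> x) q' E f \<delta>" "c \<in> up C"
  shows "gr_map R h L f (\<lambda>i. gr_coset M \<eta> q i (c i)) = (\<lambda>i. gr_coset L (\<lambda>x. h \<odot>\<^bsub>L\<^esub> x) q' i (\<delta> (c i)))"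
  using gr_map_coset[OF assms(2) up_closed[OF assms(3)]]
  by (simp add: gr_map_def mfilt_eq[OF assms(1)])

end

section \<open>Structure constants of a Lie algebra\<close>

text \<open>The position of an element in the increasing list is the number of smaller elements.
  This reconciles the signs by list position in the Koszul formula with those of
  \<open>sg\<close>.\<close>

lemma sum_sorted_list_of_set:
  assumes "finite S"
  shows "(\<Sum>i<card S. f i (sorted_list_of_set S ! i)) = (\<Sum>k\<in>S. f (card {b\<in>S. b < k}) (k::nat))"
proof -
  let ?s = "sorted_list_of_set S"
  have card: "card {b\<in>S. b < ?s ! i} = i" if i: "i < card S" for i
  proof -
    have len: "length ?s = card S" by simp
    have "{b\<in>S. b < ?s ! i} = (!) ?s ` {..<i}"
    proof (intro equalityI subsetI)
      fix b assume "b \<in> {b\<in>S. b < ?s ! i}"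
      then have "b \<in> set ?s" "b < ?s ! i" using assms by auto
      then obtain j where j: "j < card S" "b = ?s ! j" by (metis in_set_conv_nth len)
      have "j < i"
      proof (rule ccontr)
        assume "\<not> j < i"
        then have "?s ! i \<le> ?s ! j" using j len by (intro sorted_nth_mono) auto
        then show False using j \<open>b < ?s ! i\<close> by simp
      qed
      then show "b \<in> (!) ?s ` {..<i}" using j by blast
    next
      fix b assume "b \<in> (!) ?s ` {..<i}"
      then obtain j where j: "j < i" "b = ?s ! j" by auto
      then have "b < ?s ! i"
        using i sorted_wrt_nth_less[OF strict_sorted_list_of_set, of j i S] by simp
      moreover have "b \<in> set ?s" using j i by (metis len less_trans nth_mem)
      ultimately show "b \<in> {b\<in>S. b < ?s ! i}" using assms by simp
    qed
    moreover have "inj_on ((!) ?s) {..<i}"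
      using i by (intro inj_on_nth) auto
    ultimately show ?thesis by (simp add: card_image)
  qed
  have "bij_betw ((!) ?s) {..<card S} S"
    using assms by (intro bij_betw_nth) auto
  then have "(\<Sum>k\<in>S. f (card {b\<in>S. b < k}) k) = (\<Sum>i<card S. f (card {b\<in>S. b < ?s ! i}) (?s ! i))"
    by (rule sum.reindex_bij_betw[symmetric])
  also have "\<dots> = (\<Sum>i<card S. f i (?s ! i))"
    by (intro sum.cong) (auto simp: card)
  finally show ?thesis by simp
qed

lemma sum_swap2: "(\<Sum>a\<in>A. \<Sum>i\<in>B. \<Sum>j\<in>C. G a i j) = (\<Sum>i\<in>B. \<Sum>j\<in>C. \<Sum>a\<in>A. G a i j)"
proof -
  have "(\<Sum>a\<in>A. \<Sum>i\<in>B. \<Sum>j\<in>C. G a i j) = (\<Sum>i\<in>B. \<Sum>a\<in>A. \<Sum>j\<in>C. G a i j)"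
    by (rule sum.swap)
  also have "\<dots> = (\<Sum>i\<in>B. \<Sum>j\<in>C. \<Sum>a\<in>A. G a i j)"
    by (rule sum.cong[OF refl], rule sum.swap)
  finally show ?thesis .
qed

text \<open>The element \<open>t \<otimes> e\<^sub>S\<close>.\<close>

definition delta_at :: "nat set \<Rightarrow> 'm::ab_group_add \<Rightarrow> nat set \<Rightarrow> 'm" where
  "delta_at S t S' = (if S' = S then t else 0)"

lemma iota_delta_at:
  "iota k (delta_at S t) = (if k \<in> S then delta_at (S - {k}) (sg k S t) else (\<lambda>_. 0))"
proof
  fix S'
  show "iota k (delta_at S t) S' = (if k \<in> S then delta_at (S - {k}) (sg k S t) else (\<lambda>_. 0)) S'"
  proof (cases "k \<in> S'")
    case True
    then show ?thesis by (auto simp: iota_def delta_at_def)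
  next
    case False
    then have "insert k S' = S \<longleftrightarrow> k \<in> S \<and> S' = S - {k}" by auto
    then show ?thesis using False sg_remove[of k S k t]
      by (auto simp: iota_def delta_at_def)
  qed
qed

lemma scalar_sign: "scalar ((- 1) ^ card {b\<in>S. b < i}) * x = sg i S x"
  by (cases "even (card {b\<in>S. b < i})") (simp_all add: sg_def scalar_uminus)

section \<open>Structure constants and the Koszul formula for a Lie algebra with a basis\<close>

locale lie_basis = lie_algebra scale bracket
  for scale :: "'k::field_char_0 \<Rightarrow> 'a::ab_group_add \<Rightarrow> 'a" and bracket :: "'a \<Rightarrow> 'a \<Rightarrow> 'a" +
  fixes n :: nat and e :: "nat \<Rightarrow> 'a"
  assumes basis: "finite_basis scale n e"
begin

abbreviation co :: "'a \<Rightarrow> nat \<Rightarrow> 'k" where "co \<equiv> coord scale n e"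
abbreviation incl :: "'a \<Rightarrow> 'k falg" where "incl \<equiv> lie_incl scale n e"

definition struct_const :: "nat \<Rightarrow> nat \<Rightarrow> nat \<Rightarrow> 'k" where
  "struct_const i j a = co (bracket (e i) (e j)) a"

lemma basis_props: "inj_on e {..<n}" "independent (e ` {..<n})" "x \<in> span (e ` {..<n})"
  using basis unfolding finite_basis_def by blast+

lemma co_add: "co (x + y) a = co x a + co y a"
  by (simp add: coord_def representation_add basis_props)

lemma co_scale: "co (scale c x) a = c * co x a"
  by (simp add: coord_def representation_scale basis_props)

lemma co_sum: "co (\<Sum>i\<in>A. f i) a = (\<Sum>i\<in>A. co (f i) a)"
  by (simp add: coord_def representation_sum basis_props)

lemma co_basis: "i < n \<Longrightarrow> j < n \<Longrightarrow> co (e i) j = (if i = j then 1 else 0)"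
  using basis_props(1) by (auto simp: coord_def representation_basis basis_props inj_on_def)

lemma co_uminus: "co (- x) a = - co x a"
  by (simp add: coord_def representation_neg basis_props)

lemma co_expand: "(\<Sum>i<n. scale (co x i) (e i)) = x"
proof -
  have "(\<Sum>b\<in>e ` {..<n}. scale (representation (e ` {..<n}) x b) b) = x"
    by (rule sum_representation_eq) (simp_all add: basis_props)
  then show ?thesis by (simp add: sum.reindex[OF basis_props(1)] coord_def)
qed

lemma bracket_zero_left: "bracket 0 y = 0" and bracket_zero_right: "bracket x 0 = 0"
  using bracket_add_left[of 0 0 y] bracket_add_right[of x 0 0] by auto

lemma bracket_sum_left: "bracket (\<Sum>i\<in>A. f i) y = (\<Sum>i\<in>A. bracket (f i) y)"
  by (induction A rule: infinite_finite_induct) (auto simp: bracket_add_left bracket_zero_left)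

lemma bracket_sum_right: "bracket x (\<Sum>i\<in>A. f i) = (\<Sum>i\<in>A. bracket x (f i))"
  by (induction A rule: infinite_finite_induct) (auto simp: bracket_add_right bracket_zero_right)

lemma bracket_swap: "bracket x y = - bracket y x"
proof -
  have "bracket (x + y) (x + y) = bracket x x + bracket x y + (bracket y x + bracket y y)"
    by (simp only: bracket_add_left bracket_add_right add_ac)
  then show ?thesis by (simp add: bracket_self eq_neg_iff_add_eq_0)
qed

lemma co_double_bracket: "co (bracket (e p) (bracket (e r) (e s))) a = (\<Sum>b<n. struct_const p b a * struct_const r s b)"
proof -
  have "bracket (e r) (e s) = (\<Sum>b<n. scale (struct_const r s b) (e b))"
    by (simp add: struct_const_def co_expand)
  then have "co (bracket (e p) (bracket (e r) (e s))) a = co (bracket (e p) (\<Sum>b<n. scale (struct_const r s b) (e b))) a"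
    by simp
  also have "\<dots> = (\<Sum>b<n. struct_const p b a * struct_const r s b)"
    by (simp add: bracket_sum_right bracket_scale_right co_sum co_scale struct_const_def mult.commute)
  finally show ?thesis .
qed

sublocale lie_constants n struct_const
proof
  show "struct_const p q a = - struct_const q p a" for p q a
    unfolding struct_const_def by (subst bracket_swap) (rule co_uminus)
  show "(\<Sum>b<n. struct_const p b a * struct_const r s b + struct_const r b a * struct_const s p b + struct_const s b a * struct_const p r b) = 0" for p r s a
    using jacobi[of "e p" "e r" "e s"] co_add[of _ _ a]
    by (simp add: sum.distrib co_double_bracket[symmetric])
      (metis (no_types) co_add co_scale mult_zero_left scale_zero_left)
qed

lemma incl_basis: "i < n \<Longrightarrow> incl (e i) = gen i"
proof -
  assume i: "i < n"
  then have "incl (e i) = (\<Sum>j<n. if j = i then gen i else 0)"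
    unfolding lie_incl_def by (intro sum.cong) (auto simp: co_basis)
  then show ?thesis using i by simp
qed

lemma incl_bracket: "incl (bracket (e i) (e j)) = (\<Sum>a<n. scalar (struct_const i j a) * gen a)"
  by (simp add: lie_incl_def struct_const_def)

text \<open>The enveloping ideal is generated by the commutators of all pairs of vectors;
  bilinearity reduces them to the relations between basis vectors.\<close>

lemma incl_commutator:
  "incl x * incl y - incl y * incl x - incl (bracket x y)
    = (\<Sum>i<n. \<Sum>j<n. scalar (co x i * co y j) * rel i j)"
proof -
  have xy: "incl x * incl y = (\<Sum>i<n. \<Sum>j<n. scalar (co x i * co y j) * (gen i * gen j))"
    by (simp add: lie_incl_def sum_product scalar_mult mult.assoc scalar_left_commute[of "gen _"])
  have "incl y * incl x = (\<Sum>j<n. \<Sum>i<n. scalar (co y j * co x i) * (gen j * gen i))"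
    by (simp add: lie_incl_def sum_product scalar_mult mult.assoc scalar_left_commute[of "gen _"])
  also have "\<dots> = (\<Sum>i<n. \<Sum>j<n. scalar (co x i * co y j) * (gen j * gen i))"
    by (subst sum.swap) (simp add: mult.commute[of "co y _"])
  finally have yx: "incl y * incl x = \<dots>" .
  have "bracket x y = bracket (\<Sum>i<n. scale (co x i) (e i)) (\<Sum>j<n. scale (co y j) (e j))"
    by (simp only: co_expand)
  then have "bracket x y = (\<Sum>j<n. \<Sum>i<n. scale (co x i * co y j) (bracket (e i) (e j)))"
    by (simp add: bracket_sum_left bracket_sum_right bracket_scale_left bracket_scale_right
        scale_sum_right mult.commute)
  also have "\<dots> = (\<Sum>i<n. \<Sum>j<n. scale (co x i * co y j) (bracket (e i) (e j)))"
    by (rule sum.swap)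
  finally have "co (bracket x y) a = (\<Sum>i<n. \<Sum>j<n. co x i * co y j * struct_const i j a)" for a
    by (simp add: co_sum co_scale struct_const_def)
  then have "incl (bracket x y) = (\<Sum>a<n. \<Sum>i<n. \<Sum>j<n. scalar (co x i * co y j) * (scalar (struct_const i j a) * gen a))"
    by (simp add: lie_incl_def scalar_sum scalar_mult sum_distrib_right mult.assoc)
  also have "\<dots> = (\<Sum>i<n. \<Sum>j<n. \<Sum>a<n. scalar (co x i * co y j) * (scalar (struct_const i j a) * gen a))"
    by (rule sum_swap2)
  finally have "incl (bracket x y) = (\<Sum>i<n. \<Sum>j<n. scalar (co x i * co y j) * (\<Sum>a<n. scalar (struct_const i j a) * gen a))"
    by (simp add: sum_distrib_left)
  then show ?thesis
    by (simp add: xy yx rel_def right_diff_distrib sum_subtractf)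
qed

lemma wedge_basis:
  assumes "sorted_wrt (<) L" "set L \<subseteq> {..<n}" "finite S" "S \<subseteq> {..<n}"
  shows "wedge co (map e L) S = (if S = set L then 1 else 0)"
  using assms
proof (induction L arbitrary: S)
  case (Cons l L)
  have IH: "wedge co (map e L) (S - {a}) = (if S - {a} = set L then 1 else 0)" for a
    using Cons.prems by (intro Cons.IH) auto
  have "wedge co (map e (l # L)) S = (\<Sum>a\<in>S. if a = l then (if S - {l} = set L then (- 1) ^ card {b\<in>S. b < l} else 0) else 0)"
    using Cons.prems unfolding list.map wedge.simps IH by (intro sum.cong refl) (auto simp: co_basis)
  also have "\<dots> = (if l \<in> S \<and> S - {l} = set L then (- 1) ^ card {b\<in>S. b < l} else 0)"
    using Cons.prems by simp
  also have "\<dots> = (if S = set (l # L) then 1 else 0)"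
  proof -
    have "l \<in> S \<and> S - {l} = set L \<longleftrightarrow> S = set (l # L)" using Cons.prems by auto
    \<comment> \<open>The head of an increasing list is smaller than the rest, so its sign is
      trivial.\<close>
    moreover have "card {b\<in>S. b < l} = 0" if "S = set (l # L)"
      using Cons.prems(1) that by (auto dest: order.asym)
    ultimately show ?thesis by (metis power_0)
  qed
  finally show ?case .
qed auto

text \<open>Deleting positions keeps the list increasing, so the wedge is a single basis vector with
  coefficient 1, and all signs of the Koszul formula stay explicit.\<close>

lemma wedge_remove:
  assumes S: "S \<in> ext_index n l" and S': "S' \<in> ext_index n m" and A: "A \<subseteq> {..<l}"
  shows "wedge co (nths (map e (sorted_list_of_set S)) (- A)) S'
    = (if S' = S - (!) (sorted_list_of_set S) ` A then 1 else 0)"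
proof -
  let ?s = "sorted_list_of_set S"
  have fin: "finite S" "finite S'" using S S' ext_index_finite by auto
  have len: "length ?s = l" using S by (simp add: ext_index_def)
  have "set (nths ?s (- A)) = S - (!) ?s ` A"
  proof -
    have "set (nths ?s (- A)) = {?s ! i | i. i < l \<and> i \<notin> A}"
      unfolding set_nths len by simp
    also have "\<dots> = (!) ?s ` ({..<l} - A)" by blast
    also have "\<dots> = (!) ?s ` {..<l} - (!) ?s ` A"
      using A len by (intro inj_on_image_set_diff[of _ "{..<l}"] inj_on_nth) auto
    also have "(!) ?s ` {..<l} = S"
      using bij_betw_nth[of ?s "{..<l}" S] len fin by (auto simp: bij_betw_def)
    finally show ?thesis .
  qed
  moreover have "sorted_wrt (<) (nths ?s (- A))"
    using strict_sorted_list_of_set[of S] sorted_nths distinct_nthsI strict_sorted_iff by blast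
  moreover have "set (nths ?s (- A)) \<subseteq> {..<n}"
    using set_nths_subset[of ?s "- A"] S fin by (auto simp: ext_index_def)
  ultimately show ?thesis
    using S' fin wedge_basis[of "nths ?s (- A)" S'] by (simp add: nths_map ext_index_def)
qed


text \<open>\<open>koszul_formula\<close> with a representative t in the free algebra instead of its
  class.\<close>

definition koszul_value :: "nat \<Rightarrow> 'k falg \<Rightarrow> 'a list \<Rightarrow> nat set \<Rightarrow> 'k falg" where
  "koszul_value m t Xs S =
    (\<Sum>i\<in>{..m}. (t * incl (Xs ! i)) * scalar ((- 1) ^ i * wedge co (nths Xs (- {i})) S)) +
    (\<Sum>p\<in>{(i, j). i < j \<and> j \<le> m}. t * scalar ((- 1) ^ (fst p + snd p) *
      wedge co (bracket (Xs ! fst p) (Xs ! snd p) # nths Xs (- {fst p, snd p})) S))"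

text \<open>The sign of position i in the list is the sign with which \<open>iota\<close> removes
  the element standing there.\<close>

lemma koszul_value_first:
  assumes S: "S \<in> ext_index n (Suc m)" and S': "S' \<in> ext_index n m"
  defines "Xs \<equiv> map e (sorted_list_of_set S)"
  shows "(\<Sum>i\<in>{..m}. (t * incl (Xs ! i)) * scalar ((- 1) ^ i * wedge co (nths Xs (- {i})) S'))
    = koszul_lin (delta_at S t) S'"
proof -
  let ?s = "sorted_list_of_set S"
  have fin: "finite S" and sub: "S \<subseteq> {..<n}" and card: "card S = Suc m"
    using S ext_index_finite[OF S] by (auto simp: ext_index_def)
  have "?s ! i \<in> S" if "i < Suc m" for i
    using nth_mem[of i ?s] that fin card by simp
  then have "(\<Sum>i\<in>{..m}. (t * incl (Xs ! i)) * scalar ((- 1) ^ i * wedge co (nths Xs (- {i})) S'))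
      = (\<Sum>i<card S. (t * gen (?s ! i)) * scalar ((- 1) ^ i * (if S' = S - {?s ! i} then 1 else 0)))"
    unfolding card lessThan_Suc_atMost Xs_def
    using sub card wedge_remove[OF S S', of "{i}" for i]
    by (intro sum.cong refl) (auto simp: incl_basis subset_iff less_Suc_eq_le)
  also have "\<dots> = (\<Sum>k\<in>S. (t * gen k) * scalar ((- 1) ^ card {b\<in>S. b < k} * (if S' = S - {k} then 1 else 0)))"
    by (rule sum_sorted_list_of_set[OF fin])
  also have "\<dots> = (\<Sum>k\<in>S. iota k (delta_at S t) S' * gen k)"
  proof (intro sum.cong refl)
    fix k assume "k \<in> S"
    show "(t * gen k) * scalar ((- 1) ^ card {b\<in>S. b < k} * (if S' = S - {k} then 1 else 0))
        = iota k (delta_at S t) S' * gen k"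
      using \<open>k \<in> S\<close> scalar_sign[of S k t, symmetric]
      by (simp add: iota_delta_at delta_at_def scalar_commute mult.assoc)
  qed
  also have "\<dots> = (\<Sum>k<n. iota k (delta_at S t) S' * gen k)"
    by (rule sum.mono_neutral_left) (use sub in \<open>auto simp: iota_delta_at\<close>)
  finally show ?thesis by (simp add: koszul_lin_def)
qed

text \<open>The double sum over ordered pairs is symmetric and vanishes on the diagonal, so it is
  twice the sum over p < q. This uses up the factor 1/2 in \<open>koszul_bracket\<close>, and
  elements are then replaced by list positions.\<close>

lemma koszul_value_second:
  assumes S: "S \<in> ext_index n (Suc m)" and S': "S' \<in> ext_index n m"
  defines "Xs \<equiv> map e (sorted_list_of_set S)"
  shows "(\<Sum>p\<in>{(i, j). i < j \<and> j \<le> m}. t * scalar ((- 1) ^ (fst p + snd p) *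
      wedge co (bracket (Xs ! fst p) (Xs ! snd p) # nths Xs (- {fst p, snd p})) S'))
    = koszul_bracket (delta_at S t) S'"
proof -
  let ?s = "sorted_list_of_set S"
  let ?c = "\<lambda>k. card {b\<in>S. b < k}"
  have fin: "finite S" and sub: "S \<subseteq> {..<n}" and card: "card S = Suc m"
    using S ext_index_finite[OF S] by (auto simp: ext_index_def)
  have S'n: "S' \<subseteq> {..<n}" "finite S'" using S' ext_index_finite[OF S'] by (auto simp: ext_index_def)
  have mem: "?s ! i \<in> S" if "i < card S" for i
    using nth_mem[of i ?s] that fin by simp
  have mono: "?s ! i < ?s ! j" if "i < j" "j < card S" for i j
    using that sorted_wrt_nth_less[OF strict_sorted_list_of_set, of i j S] by simp
  have mono_iff: "?s ! i < ?s ! j \<longleftrightarrow> i < j" if "i < card S" "j < card S" for i j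
    using mono[of i j] mono[of j i] that by (cases i j rule: linorder_cases) auto
  \<comment> \<open>The coordinate at S' of the bracket of \<open>e p\<close> and \<open>e q\<close>
    wedged with the basis vector of \<open>S - {p, q}\<close>.\<close>
  define B where "B p q = (\<Sum>a\<in>S'. (- 1) ^ card {b\<in>S'. b < a} * struct_const p q a *
    (if S' - {a} = S - {p, q} then 1 else 0))" for p q
  have wedge: "wedge co (bracket (Xs ! i) (Xs ! j) # nths Xs (- {i, j})) S' = B (?s ! i) (?s ! j)"
    if ij: "i < j" "j < card S" for i j
  proof -
    have "wedge co (nths Xs (- {i, j})) (S' - {a}) = (if S' - {a} = S - {?s ! i, ?s ! j} then 1 else 0)"
      if "a \<in> S'" for a
    proof -
      have "S' - {a} \<in> ext_index n (m - 1)"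
        using S' that S'n by (auto simp: ext_index_def)
      then show ?thesis
        using wedge_remove[OF S, of "S' - {a}" "m - 1" "{i, j}"] ij card by (simp add: Xs_def)
    qed
    then show ?thesis
      using ij by (simp add: B_def struct_const_def Xs_def)
  qed
  define Q where "Q p q = (\<Sum>a<n. scalar (struct_const p q a / 2) * eps a (iota p (iota q (delta_at S t))) S')" for p q
  have Q_sym: "Q q p = Q p q" for p q
  proof -
    have "scalar (struct_const q p a / 2) * eps a (iota q (iota p (delta_at S t))) S'
        = scalar (struct_const p q a / 2) * eps a (iota p (iota q (delta_at S t))) S'" for a
      by (subst iota_iota_fun, subst antisym) (simp add: eps_uminus scalar_uminus)
    then show ?thesis by (simp add: Q_def)
  qed
  have Q_zero: "Q p q = 0" if "p \<notin> S \<or> q \<notin> S \<or> p = q" for p q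
  proof -
    have "iota p (iota q (delta_at S t)) = (\<lambda>_. 0)"
      using that by (auto simp: iota_delta_at iota_def[of p "\<lambda>_. 0"])
    then show ?thesis by (simp add: Q_def)
  qed
  have Q_eq: "Q p q + Q p q = t * scalar ((- 1) ^ (?c p + ?c q) * B p q)" if pq: "p \<in> S" "q \<in> S" "p < q" for p q
  proof -
    \<comment> \<open>q is removed first and exceeds p, so its absence does not affect the sign of
      p.\<close>
    have io: "iota p (iota q (delta_at S t)) = delta_at (S - {p, q}) (sg p S (sg q S t))"
    proof -
      have "p \<in> S - {q}" "S - {q} - {p} = S - {p, q}" using pq by auto
      then show ?thesis using pq by (simp add: iota_delta_at sg_remove)
    qed
    have "Q p q + Q p q = (\<Sum>a<n. scalar (struct_const p q a) * eps a (delta_at (S - {p, q}) (sg p S (sg q S t))) S')"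
      unfolding Q_def io sum.distrib[symmetric] distrib_right[symmetric] scalar_add[symmetric] by simp
    also have "\<dots> = (\<Sum>a\<in>S'. scalar (struct_const p q a) * sg a S' (delta_at (S - {p, q}) (sg p S (sg q S t)) (S' - {a})))"
      by (rule sum.mono_neutral_cong_right) (use S'n in \<open>auto simp: eps_def\<close>)
    also have "\<dots> = (\<Sum>a\<in>S'. scalar ((- 1) ^ (?c p + ?c q) * ((- 1) ^ card {b\<in>S'. b < a} * struct_const p q a *
        (if S' - {a} = S - {p, q} then 1 else 0))) * t)"
    proof (intro sum.cong refl)
      fix a
      let ?k = "card {b\<in>S'. b < a}"
      have "scalar (struct_const p q a) * sg a S' (sg p S (sg q S t))
          = scalar (struct_const p q a) * (scalar ((- 1) ^ ?k) * (scalar ((- 1) ^ ?c p) * (scalar ((- 1) ^ ?c q) * t)))"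
        by (simp only: scalar_sign)
      also have "\<dots> = scalar (struct_const p q a * (- 1) ^ ?k * (- 1) ^ ?c p * (- 1) ^ ?c q) * t"
        by (simp only: scalar_mult mult.assoc)
      also have "struct_const p q a * (- 1) ^ ?k * (- 1) ^ ?c p * (- 1) ^ ?c q
          = (- 1) ^ (?c p + ?c q) * ((- 1) ^ ?k * struct_const p q a)"
        by (simp add: power_add mult_ac)
      finally show "scalar (struct_const p q a) * sg a S' (delta_at (S - {p, q}) (sg p S (sg q S t)) (S' - {a}))
          = scalar ((- 1) ^ (?c p + ?c q) * ((- 1) ^ ?k * struct_const p q a *
            (if S' - {a} = S - {p, q} then 1 else 0))) * t"
        by (simp add: delta_at_def)
    qed
    also have "\<dots> = scalar ((- 1) ^ (?c p + ?c q) * B p q) * t"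
      by (simp only: B_def sum_distrib_left scalar_sum sum_distrib_right)
    finally show ?thesis by (simp add: scalar_commute)
  qed
  have "koszul_bracket (delta_at S t) S' = (\<Sum>p<n. \<Sum>q<n. Q p q)"
    by (simp add: koszul_bracket_def Q_def)
  also have "\<dots> = (\<Sum>p\<in>S. \<Sum>q<n. Q p q)"
    by (rule sum.mono_neutral_right) (use sub Q_zero in auto)
  also have "\<dots> = (\<Sum>p\<in>S. \<Sum>q\<in>S. Q p q)"
    by (intro sum.cong refl sum.mono_neutral_right) (use sub Q_zero in auto)
  also have "\<dots> = (\<Sum>p\<in>S. \<Sum>q\<in>S. (if p < q then Q p q else 0) + (if q < p then Q p q else 0))"
  proof (intro sum.cong refl)
    fix p q
    show "Q p q = (if p < q then Q p q else 0) + (if q < p then Q p q else 0)"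
      using Q_zero[of p q] by (cases p q rule: linorder_cases) auto
  qed
  also have "\<dots> = (\<Sum>p\<in>S. \<Sum>q\<in>S. if p < q then Q p q else 0) + (\<Sum>p\<in>S. \<Sum>q\<in>S. if q < p then Q p q else 0)"
    by (simp only: sum.distrib)
  also have "(\<Sum>p\<in>S. \<Sum>q\<in>S. if q < p then Q p q else 0) = (\<Sum>p\<in>S. \<Sum>q\<in>S. if p < q then Q p q else 0)"
  proof -
    have "(\<Sum>p\<in>S. \<Sum>q\<in>S. if q < p then Q p q else 0) = (\<Sum>p\<in>S. \<Sum>q\<in>S. if p < q then Q q p else 0)"
      by (rule sum.swap)
    also have "\<dots> = (\<Sum>p\<in>S. \<Sum>q\<in>S. if p < q then Q p q else 0)"
      by (intro sum.cong refl if_cong, rule Q_sym)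
    finally show ?thesis .
  qed
  also have "(\<Sum>p\<in>S. \<Sum>q\<in>S. if p < q then Q p q else 0) + \<dots>
      = (\<Sum>p\<in>S. \<Sum>q\<in>S. if p < q then t * scalar ((- 1) ^ (?c p + ?c q) * B p q) else 0)"
    unfolding sum.distrib[symmetric] by (intro sum.cong refl) (use Q_eq in auto)
  also have "\<dots> = (\<Sum>i<card S. \<Sum>j<card S. if ?s ! i < ?s ! j
      then t * scalar ((- 1) ^ (i + j) * B (?s ! i) (?s ! j)) else 0)"
    unfolding sum_sorted_list_of_set[OF fin, of "\<lambda>i p. \<Sum>j<card S. if p < ?s ! j
      then t * scalar ((- 1) ^ (i + j) * B p (?s ! j)) else 0"]
  proof (rule sum.cong[OF refl])
    fix p
    show "(\<Sum>q\<in>S. if p < q then t * scalar ((- 1) ^ (?c p + ?c q) * B p q) else 0)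
        = (\<Sum>j<card S. if p < ?s ! j then t * scalar ((- 1) ^ (?c p + j) * B p (?s ! j)) else 0)"
      by (rule sum_sorted_list_of_set[OF fin, of
            "\<lambda>j q. if p < q then t * scalar ((- 1) ^ (?c p + j) * B p q) else 0", symmetric])
  qed
  also have "\<dots> = (\<Sum>i<card S. \<Sum>j<card S. if i < j
      then t * scalar ((- 1) ^ (i + j) * B (?s ! i) (?s ! j)) else 0)"
    by (intro sum.cong refl) (simp add: mono_iff)
  also have "\<dots> = (\<Sum>p\<in>{..<card S} \<times> {..<card S}. if fst p < snd p
      then t * scalar ((- 1) ^ (fst p + snd p) * B (?s ! fst p) (?s ! snd p)) else 0)"
    by (simp add: sum.cartesian_product case_prod_unfold)
  also have "\<dots> = (\<Sum>p\<in>{(i, j). i < j \<and> j \<le> m}. t * scalar ((- 1) ^ (fst p + snd p) * B (?s ! fst p) (?s ! snd p)))"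
    by (rule sum.mono_neutral_cong_right) (use card in auto)
  also have "\<dots> = (\<Sum>p\<in>{(i, j). i < j \<and> j \<le> m}. t * scalar ((- 1) ^ (fst p + snd p) *
      wedge co (bracket (Xs ! fst p) (Xs ! snd p) # nths Xs (- {fst p, snd p})) S'))"
    by (intro sum.cong refl) (use wedge card in \<open>auto simp del: wedge.simps\<close>)
  finally show ?thesis by simp
qed

text \<open>A family vanishing off the index set is the sum of its parts
  \<open>delta_at S (x S)\<close>, and additivity of the differential reduces the claim to a single
  basis wedge.\<close>

lemma sum_koszul_value:
  assumes x: "supp n (Suc m) UNIV x" and S': "S' \<in> ext_index n m"
  shows "(\<Sum>S\<in>ext_index n (Suc m). koszul_value m (x S) (map e (sorted_list_of_set S)) S') = koszul_free x S'"
proof -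
  have add: "koszul_free (\<lambda>S'. \<Sum>S\<in>A. F S S') S' = (\<Sum>S\<in>A. koszul_free (F S) S')" for A :: "nat set set" and F
    by (induction A rule: infinite_finite_induct) (simp_all add: koszul_free_add koszul_free_zero)
  have "x = (\<lambda>S'. \<Sum>S\<in>ext_index n (Suc m). delta_at S (x S) S')"
    using x by (auto simp: fun_eq_iff delta_at_def supp_def)
  then have "koszul_free x S' = koszul_free (\<lambda>S'. \<Sum>S\<in>ext_index n (Suc m). delta_at S (x S) S') S'" by simp
  also have "\<dots> = (\<Sum>S\<in>ext_index n (Suc m). koszul_free (delta_at S (x S)) S')" by (rule add)
  also have "\<dots> = (\<Sum>S\<in>ext_index n (Suc m). koszul_value m (x S) (map e (sorted_list_of_set S)) S')"
    using S' by (intro sum.cong refl) (simp only: koszul_value_def koszul_free_def koszul_value_first koszul_value_second)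
  finally show ?thesis by simp
qed

end

section \<open>The enveloping algebra and its Koszul complex\<close>

lemma ring_of_subring:
  fixes A :: "'r::ring_1 set"
  assumes "0 \<in> A" "1 \<in> A" "\<And>x y. x \<in> A \<Longrightarrow> y \<in> A \<Longrightarrow> x + y \<in> A"
    "\<And>x. x \<in> A \<Longrightarrow> - x \<in> A" "\<And>x y. x \<in> A \<Longrightarrow> y \<in> A \<Longrightarrow> x * y \<in> A"
  shows "ring \<lparr>carrier = A, mult = (*), one = 1, zero = 0, add = (+)\<rparr>"
proof (rule ringI)
  show "abelian_group \<lparr>carrier = A, mult = (*), one = 1, zero = 0, add = (+)\<rparr>"
  proof (rule abelian_groupI)
    fix x assume "x \<in> carrier \<lparr>carrier = A, mult = (*), one = 1, zero = 0, add = (+)\<rparr>"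
    then show "\<exists>y\<in>carrier \<lparr>carrier = A, mult = (*), one = 1, zero = 0, add = (+)\<rparr>.
        y \<oplus>\<^bsub>\<lparr>carrier = A, mult = (*), one = 1, zero = 0, add = (+)\<rparr>\<^esub> x
          = \<zero>\<^bsub>\<lparr>carrier = A, mult = (*), one = 1, zero = 0, add = (+)\<rparr>\<^esub>"
      using assms by (intro bexI[of _ "- x"]) auto
  qed (use assms in \<open>auto simp: add_ac\<close>)
  show "Group.monoid \<lparr>carrier = A, mult = (*), one = 1, zero = 0, add = (+)\<rparr>"
    by (rule monoidI) (use assms in \<open>auto simp: mult.assoc\<close>)
qed (auto simp: algebra_simps)

lemma tensor_alg_simps [simp]:
  "mult (tensor_alg n) = (*)" "one (tensor_alg n) = 1" "zero (tensor_alg n) = 0" "add (tensor_alg n) = (+)"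
  "mult (tensor_alg_h n) = (*)" "one (tensor_alg_h n) = 1" "zero (tensor_alg_h n) = 0" "add (tensor_alg_h n) = (+)"
  by (simp_all add: tensor_alg_def tensor_alg_h_def)

lemma tensor_alg_h_carrier: "t \<in> carrier (tensor_alg_h n) \<longleftrightarrow> (\<forall>r. fps_nth t r \<in> carrier (tensor_alg n))"
  by (simp add: tensor_alg_h_def)

lemma carrier_tensor_algI: "t \<in> trunc n q \<Longrightarrow> t \<in> carrier (tensor_alg n)"
  by (auto simp: carrier_tensor_alg_eq)

lemma carrier_tensor_algE:
  assumes "t \<in> carrier (tensor_alg n)" obtains q where "t \<in> trunc n q"
  using assms by (auto simp: carrier_tensor_alg_eq)

lemma tensor_alg_mult: "x \<in> carrier (tensor_alg n) \<Longrightarrow> y \<in> carrier (tensor_alg n) \<Longrightarrow> x * y \<in> carrier (tensor_alg n)"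
  by (elim carrier_tensor_algE) (rule carrier_tensor_algI[OF trunc_mult_le[OF _ _ le_SucI[OF order_refl]]])

lemma linset_tensor_alg: "linset (carrier (tensor_alg n))"
  unfolding linset_def
proof (intro conjI ballI allI)
  fix x y :: "'a falg" assume "x \<in> carrier (tensor_alg n)" "y \<in> carrier (tensor_alg n)"
  then obtain p q where "x \<in> trunc n p" "y \<in> trunc n q" by (elim carrier_tensor_algE)
  then have "x \<in> trunc n (p + q)" "y \<in> trunc n (p + q)" by (auto intro: trunc_mono)
  then show "x + y \<in> carrier (tensor_alg n)" by (intro carrier_tensor_algI trunc_add)
next
  fix x :: "'a falg" and c assume "x \<in> carrier (tensor_alg n)"
  then show "scalar c * x \<in> carrier (tensor_alg n)"
    by (elim carrier_tensor_algE) (rule carrier_tensor_algI[OF trunc_scalar_mult])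
qed (rule carrier_tensor_algI[OF trunc_zero[of n 0]])

lemma tensor_alg_closed:
  "0 \<in> carrier (tensor_alg n)" "1 \<in> carrier (tensor_alg n)" "scalar c \<in> carrier (tensor_alg n)"
  "i < n \<Longrightarrow> gen i \<in> carrier (tensor_alg n)"
  using linset_zero[OF linset_tensor_alg] carrier_tensor_algI[OF trunc_one[of n 0]]
    carrier_tensor_algI[OF trunc_scalar[of c n 0]] carrier_tensor_algI[OF trunc_gen[of i n]] by auto

lemma ring_tensor_alg: "ring (tensor_alg n :: 'k::field falg ring)"
proof -
  have "ring \<lparr>carrier = carrier (tensor_alg n :: 'k falg ring), mult = (*), one = 1, zero = 0, add = (+)\<rparr>"
    by (rule ring_of_subring)
      (auto intro: tensor_alg_closed tensor_alg_mult linset_add[OF linset_tensor_alg] linset_uminus[OF linset_tensor_alg])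
  then show ?thesis by (simp add: tensor_alg_def)
qed

lemma tensor_alg_h_mult:
  assumes "x \<in> carrier (tensor_alg_h n)" "y \<in> carrier (tensor_alg_h n)"
  shows "x * y \<in> carrier (tensor_alg_h n)"
  using assms unfolding tensor_alg_h_carrier fps_mult_nth
  by (intro allI linset_sum[OF linset_tensor_alg] tensor_alg_mult) auto

lemma tensor_alg_h_add: "x \<in> carrier (tensor_alg_h n) \<Longrightarrow> y \<in> carrier (tensor_alg_h n) \<Longrightarrow> x + y \<in> carrier (tensor_alg_h n)"
  and tensor_alg_h_uminus: "x \<in> carrier (tensor_alg_h n) \<Longrightarrow> - x \<in> carrier (tensor_alg_h n)"
  by (auto simp: tensor_alg_h_carrier intro: linset_add[OF linset_tensor_alg] linset_uminus[OF linset_tensor_alg])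

lemma tensor_alg_h_closed:
  "0 \<in> carrier (tensor_alg_h n)" "1 \<in> carrier (tensor_alg_h n)" "fps_X \<in> carrier (tensor_alg_h n)"
  "scalar_h f \<in> carrier (tensor_alg_h n)"
  "t \<in> carrier (tensor_alg n) \<Longrightarrow> fps_const t \<in> carrier (tensor_alg_h n)"
  by (auto simp: tensor_alg_h_carrier tensor_alg_closed scalar_h_def fps_X_def)

lemma ring_tensor_alg_h: "ring (tensor_alg_h n :: 'k::field falg fps ring)"
proof -
  have "ring \<lparr>carrier = carrier (tensor_alg_h n :: 'k falg fps ring), mult = (*), one = 1, zero = 0, add = (+)\<rparr>"
    by (rule ring_of_subring)
      (auto intro: tensor_alg_h_closed tensor_alg_h_mult tensor_alg_h_add tensor_alg_h_uminus)
  then show ?thesis by (simp add: tensor_alg_h_def)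
qed

lemma a_inv_tensor_alg_h: "x \<in> carrier (tensor_alg_h n) \<Longrightarrow> \<ominus>\<^bsub>tensor_alg_h n\<^esub> x = - x"
  using abelian_group.minus_equality[OF ring.is_abelian_group[OF ring_tensor_alg_h[of n]], of "- x" x]
    tensor_alg_h_uminus by auto

lemma idealI_additive:
  assumes R: "ring R" and I: "I \<subseteq> carrier R" "\<zero>\<^bsub>R\<^esub> \<in> I"
    and add: "\<And>a b. a \<in> I \<Longrightarrow> b \<in> I \<Longrightarrow> a \<oplus>\<^bsub>R\<^esub> b \<in> I"
    and l: "\<And>a x. a \<in> I \<Longrightarrow> x \<in> carrier R \<Longrightarrow> x \<otimes>\<^bsub>R\<^esub> a \<in> I"
    and r: "\<And>a x. a \<in> I \<Longrightarrow> x \<in> carrier R \<Longrightarrow> a \<otimes>\<^bsub>R\<^esub> x \<in> I"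
  shows "ideal I R"
proof (rule idealI[OF R _ l r])
  interpret ring R by fact
  show "subgroup I (add_monoid R)"
  proof (rule add.subgroupI)
    fix a assume a: "a \<in> I"
    then have "\<ominus>\<^bsub>R\<^esub> a = (\<ominus>\<^bsub>R\<^esub> \<one>\<^bsub>R\<^esub>) \<otimes>\<^bsub>R\<^esub> a" using I by (auto simp: l_minus)
    then show "\<ominus>\<^bsub>R\<^esub> a \<in> I" using l[OF a] by simp
  qed (use I add in auto)
qed

lemma (in ideal) quotient_props:
  shows "carrier (R Quot I) = (+>) I ` carrier R"
    and "a \<in> carrier R \<Longrightarrow> b \<in> carrier R \<Longrightarrow> I +> (a \<oplus> b) = (I +> a) \<oplus>\<^bsub>R Quot I\<^esub> (I +> b)"
    and "a \<in> carrier R \<Longrightarrow> b \<in> carrier R \<Longrightarrow> I +> (a \<otimes> b) = (I +> a) \<otimes>\<^bsub>R Quot I\<^esub> (I +> b)"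
    and "I +> \<one> = \<one>\<^bsub>R Quot I\<^esub>"
    and "a \<in> carrier R \<Longrightarrow> I +> a = \<zero>\<^bsub>R Quot I\<^esub> \<longleftrightarrow> a \<in> I"
proof -
  show "carrier (R Quot I) = (+>) I ` carrier R"
    by (auto simp: FactRing_def A_RCOSETS_def' )
  show "a \<in> carrier R \<Longrightarrow> b \<in> carrier R \<Longrightarrow> I +> (a \<oplus> b) = (I +> a) \<oplus>\<^bsub>R Quot I\<^esub> (I +> b)"
    and "a \<in> carrier R \<Longrightarrow> b \<in> carrier R \<Longrightarrow> I +> (a \<otimes> b) = (I +> a) \<otimes>\<^bsub>R Quot I\<^esub> (I +> b)"
    and "I +> \<one> = \<one>\<^bsub>R Quot I\<^esub>"
    using rcos_ring_hom by (auto simp: ring_hom_def)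
  have "\<zero>\<^bsub>R Quot I\<^esub> = I" by (simp add: FactRing_def)
  then show "a \<in> carrier R \<Longrightarrow> I +> a = \<zero>\<^bsub>R Quot I\<^esub> \<longleftrightarrow> a \<in> I"
    using rcos_const_imp_mem a_rcos_const by auto
qed

section \<open>The enveloping ideal through relations of bounded length\<close>

context lie_basis
begin

abbreviation U :: "'k falg set ring" where "U \<equiv> env_alg scale bracket n e"
abbreviation cls :: "'k falg \<Rightarrow> 'k falg set" where "cls \<equiv> env_class scale bracket n e"

definition J :: "'k falg set" where "J = (\<Union>q. relid q)"

lemma relid_mult_left:
  assumes "x \<in> relid q" "t \<in> trunc n p" shows "t * x \<in> relid (p + q)"
  using assms(1)
proof (induction x rule: relid.induct)
  case (relid_step x i j u v a)
  have "t * Poly_Mapping.single (FWord u) a \<in> trunc n (p + length u)"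
    using relid_step assms(2) by (intro trunc_mult_le[OF _ trunc_single[of u n "Suc (length u)"]]) auto
  moreover have "Poly_Mapping.single (FWord v) 1 \<in> trunc n (Suc (length v))"
    using relid_step by (intro trunc_single) auto
  ultimately have "(t * Poly_Mapping.single (FWord u) a) * rel i j * Poly_Mapping.single (FWord v) 1 \<in> relid (p + q)"
    by (rule relid_words) (use relid_step in auto)
  then show ?case
    using relid_step by (simp add: distrib_left mult.assoc relid_add)
qed (simp add: relid_zero)

lemma relid_mult_right:
  assumes "x \<in> relid q" "t \<in> trunc n p" shows "x * t \<in> relid (p + q)"
  using assms(1)
proof (induction x rule: relid.induct)
  case (relid_step x i j u v a)
  have "Poly_Mapping.single (FWord v) 1 * t \<in> trunc n (length v + p)"
    using relid_step assms(2) by (intro trunc_mult_le[OF trunc_single[of v n "Suc (length v)"]]) auto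
  moreover have "Poly_Mapping.single (FWord u) a \<in> trunc n (Suc (length u))"
    using relid_step by (intro trunc_single) auto
  ultimately have "Poly_Mapping.single (FWord u) a * rel i j * (Poly_Mapping.single (FWord v) 1 * t) \<in> relid (p + q)"
    by (intro relid_words) (use relid_step in auto)
  then show ?case
    using relid_step by (simp add: distrib_right mult.assoc relid_add)
qed (simp add: relid_zero)

lemma relid_trunc: "x \<in> relid q \<Longrightarrow> x \<in> trunc n q"
proof (induction x rule: relid.induct)
  case (relid_step x i j u v a)
  have "rel i j \<in> trunc n 3"
  proof -
    have "gen i * gen j \<in> trunc n 3" "gen j * gen i \<in> trunc n 3"
      using relid_step by (auto intro!: trunc_mult_le[OF trunc_gen trunc_gen])
    moreover have "(\<Sum>a<n. scalar (struct_const i j a) * gen a) \<in> trunc n 3"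
      by (intro trunc_sum trunc_scalar_mult trunc_mono[OF trunc_gen]) auto
    ultimately show ?thesis unfolding rel_def by (intro trunc_diff)
  qed
  then have "Poly_Mapping.single (FWord u) a * rel i j \<in> trunc n (length u + 3)"
    using relid_step by (intro trunc_mult_le[OF trunc_single[of u n "Suc (length u)"]]) auto
  then have "Poly_Mapping.single (FWord u) a * rel i j * Poly_Mapping.single (FWord v) 1 \<in> trunc n q"
    using relid_step by (intro trunc_mult_le[OF _ trunc_single[of v n "Suc (length v)"]]) auto
  then show ?case using relid_step by auto
qed simp

lemma ideal_J: "ideal J (tensor_alg n)"
proof (rule idealI_additive[OF ring_tensor_alg])
  show "J \<subseteq> carrier (tensor_alg n)"
    unfolding J_def by (blast intro: carrier_tensor_algI relid_trunc)
  show "\<zero>\<^bsub>tensor_alg n\<^esub> \<in> J" by (auto simp: J_def relid_zero)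
  fix a x :: "'k falg" assume a: "a \<in> J" and x: "x \<in> carrier (tensor_alg n)"
  then obtain p q where "x \<in> trunc n p" "a \<in> relid q" by (auto simp: J_def elim!: carrier_tensor_algE)
  then show "x \<otimes>\<^bsub>tensor_alg n\<^esub> a \<in> J" "a \<otimes>\<^bsub>tensor_alg n\<^esub> x \<in> J"
    unfolding J_def using relid_mult_left[of a q x p] relid_mult_right[of a q x p] by auto
next
  fix a b :: "'k falg" assume "a \<in> J" "b \<in> J"
  then obtain p q where "a \<in> relid p" "b \<in> relid q" by (auto simp: J_def)
  then have "a \<in> relid (p + q)" "b \<in> relid (p + q)" by (auto intro: relid_mono)
  then show "a \<oplus>\<^bsub>tensor_alg n\<^esub> b \<in> J" by (auto simp: J_def intro: relid_add)
qed

lemma incl_closed: "incl x \<in> carrier (tensor_alg n)"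
  unfolding lie_incl_def
  by (intro linset_sum[OF linset_tensor_alg] linset_scalar[OF linset_tensor_alg] tensor_alg_closed) simp

text \<open>The link from the enveloping algebra to the filtered computations: membership in the
  ideal means membership in some level \<open>relid q\<close>, and finitely many such conditions
  have a common level.\<close>

lemma env_ideal_eq: "env_ideal scale bracket n e = J"
proof -
  let ?G = "{incl x * incl y - incl y * incl x - incl (bracket x y) | x y. True}"
  interpret T: ring "tensor_alg n :: 'k falg ring" by (rule ring_tensor_alg)
  have G: "?G \<subseteq> carrier (tensor_alg n)"
    by (auto intro!: linset_diff[OF linset_tensor_alg] tensor_alg_mult incl_closed)
  have "rel i j \<in> relid 3" if "i < n" "j < n" for i j
    using relid_word[of i j "[]" "[]" 3 1] that by (simp add: zero_fword_def[symmetric])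
  then have "?G \<subseteq> J"
    unfolding incl_commutator J_def
    by (auto intro!: exI[of _ 3] linset_sum[OF linset_relid] relid_scalar)
  then have 1: "genideal (tensor_alg n) ?G \<subseteq> J" by (rule T.genideal_minimal[OF ideal_J])
  interpret I: ideal "genideal (tensor_alg n) ?G" "tensor_alg n" by (rule T.genideal_ideal[OF G])
  have rel: "rel i j \<in> genideal (tensor_alg n) ?G" if "i < n" "j < n" for i j
  proof -
    have "rel i j = incl (e i) * incl (e j) - incl (e j) * incl (e i) - incl (bracket (e i) (e j))"
      using that by (simp add: rel_def incl_basis incl_bracket)
    then show ?thesis using T.genideal_self[OF G] by blast
  qed
  have "x \<in> genideal (tensor_alg n) ?G" if "x \<in> relid q" for x q
    using that
  proof (induction x rule: relid.induct)
    case relid_zero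
    show ?case using I.zero_closed by simp
  next
    case (relid_step x i j u v a)
    have c: "Poly_Mapping.single (FWord u) a \<in> carrier (tensor_alg n)" "Poly_Mapping.single (FWord v) 1 \<in> carrier (tensor_alg n)"
      using relid_step by (auto intro!: carrier_tensor_algI[OF trunc_single[OF _ lessI]])
    have "Poly_Mapping.single (FWord u) a * rel i j \<in> genideal (tensor_alg n) ?G"
      using I.I_l_closed[OF rel[of i j] c(1)] relid_step by simp
    from I.I_r_closed[OF this c(2)]
    have "Poly_Mapping.single (FWord u) a * rel i j * Poly_Mapping.single (FWord v) 1 \<in> genideal (tensor_alg n) ?G"
      by simp
    then show ?case using I.a_closed relid_step by auto
  qed
  then have "J \<subseteq> genideal (tensor_alg n) ?G" by (auto simp: J_def)
  then show ?thesis using 1 by (simp add: env_ideal_def)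
qed

interpretation env: ideal J "tensor_alg n" by (rule ideal_J)

lemma U_eq: "U = tensor_alg n Quot J" and cls_eq: "cls t = J +>\<^bsub>tensor_alg n\<^esub> t"
  by (simp_all add: env_alg_def env_class_def env_ideal_eq)

lemma ring_U: "ring U"
  unfolding U_eq by (rule env.quotient_is_ring)

lemma cls_props:
  shows U_carrier: "carrier U = cls ` carrier (tensor_alg n)"
    and cls_add: "a \<in> carrier (tensor_alg n) \<Longrightarrow> b \<in> carrier (tensor_alg n) \<Longrightarrow> cls (a + b) = cls a \<oplus>\<^bsub>U\<^esub> cls b"
    and cls_mult: "a \<in> carrier (tensor_alg n) \<Longrightarrow> b \<in> carrier (tensor_alg n) \<Longrightarrow> cls (a * b) = cls a \<otimes>\<^bsub>U\<^esub> cls b"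
    and cls_zero_iff: "a \<in> carrier (tensor_alg n) \<Longrightarrow> cls a = \<zero>\<^bsub>U\<^esub> \<longleftrightarrow> a \<in> J"
  using env.quotient_props unfolding U_eq cls_eq[abs_def] by auto

lemma cls_closed: "t \<in> carrier (tensor_alg n) \<Longrightarrow> cls t \<in> carrier U"
  by (simp add: U_carrier)

lemma cls_zero: "cls 0 = \<zero>\<^bsub>U\<^esub>"
  by (simp add: cls_zero_iff tensor_alg_closed) (simp add: J_def relid_zero exI[of _ 0])

lemma cls_eqI:
  assumes "a \<in> carrier (tensor_alg n)" "b \<in> carrier (tensor_alg n)" "a - b \<in> J"
  shows "cls a = cls b"
proof -
  interpret U: ring U by (rule ring_U)
  have ab: "a - b \<in> carrier (tensor_alg n)" using assms linset_diff[OF linset_tensor_alg] by blast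
  then have "cls ((a - b) + b) = cls (a - b) \<oplus>\<^bsub>U\<^esub> cls b" using assms by (intro cls_add)
  also have "cls (a - b) = \<zero>\<^bsub>U\<^esub>" using assms ab by (simp add: cls_zero_iff)
  finally show ?thesis using cls_closed[OF assms(2)] by simp
qed

lemma cls_sum:
  assumes "\<And>i. i \<in> A \<Longrightarrow> f i \<in> carrier (tensor_alg n)"
  shows "(\<Oplus>\<^bsub>U\<^esub>i\<in>A. cls (f i)) = cls (\<Sum>i\<in>A. f i)"
proof -
  interpret U: ring U by (rule ring_U)
  show ?thesis
    using assms
  proof (induction A rule: infinite_finite_induct)
    case (insert a A)
    then show ?case
      by (simp add: cls_add cls_closed Pi_iff linset_sum[OF linset_tensor_alg])
  qed (simp_all add: cls_zero)
qed

text \<open>Relations have no constant term, so the constant coefficient is the same on the whole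
  coset and \<open>the_elem\<close> is taken of a singleton.\<close>

lemma env_counit_cls:
  assumes "t \<in> carrier (tensor_alg n)" shows "env_counit (cls t) = Poly_Mapping.lookup t 0"
proof -
  have "cls t = (\<lambda>j. j + t) ` J"
    unfolding cls_eq a_r_coset_def' by auto
  moreover have "Poly_Mapping.lookup (j + t) 0 = Poly_Mapping.lookup t 0" if "j \<in> J" for j
    using that relid_lookup_zero by (auto simp: J_def lookup_add)
  moreover have "0 \<in> J" by (auto simp: J_def intro: relid_zero)
  ultimately have "(\<lambda>t. Poly_Mapping.lookup t 0) ` cls t = {Poly_Mapping.lookup t 0}"
    by (auto simp: image_image)
  then show ?thesis by (simp add: env_counit_def)
qed

end

section \<open>Exactness of the Koszul complex over the enveloping algebra\<close>

context lie_basis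
begin

abbreviation T :: "'k falg set" where "T \<equiv> carrier (tensor_alg n)"
abbreviation kos :: "nat \<Rightarrow> (nat set \<Rightarrow> 'k falg set) \<Rightarrow> nat set \<Rightarrow> 'k falg set" where
  "kos \<equiv> koszul_diff scale bracket n e"
abbreviation ecls :: "nat \<Rightarrow> (nat set \<Rightarrow> 'k falg) \<Rightarrow> nat set \<Rightarrow> 'k falg set" where
  "ecls m x \<equiv> (\<lambda>S\<in>ext_index n m. cls (x S))"

lemma ecls_closed: "(\<And>S. S \<in> ext_index n m \<Longrightarrow> x S \<in> T) \<Longrightarrow> ecls m x \<in> carrier (ext_module U n m)"
  by (auto simp: ext_module_simps cls_closed)

lemma ecls_add:
  assumes "\<And>S. S \<in> ext_index n m \<Longrightarrow> x S \<in> T" "\<And>S. S \<in> ext_index n m \<Longrightarrow> y S \<in> T"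
  shows "ecls m x \<oplus>\<^bsub>ext_module U n m\<^esub> ecls m y = ecls m (\<lambda>S. x S + y S)"
  unfolding ext_module_simps by (rule restrict_ext) (simp add: assms cls_add)

lemma ecls_sum:
  assumes "\<And>i S. i \<in> A \<Longrightarrow> S \<in> ext_index n m \<Longrightarrow> f i S \<in> T"
  shows "(\<Oplus>\<^bsub>ext_module U n m\<^esub>i\<in>A. ecls m (f i)) = ecls m (\<lambda>S. \<Sum>i\<in>A. f i S)"
proof (rule ext_module_eqI)
  interpret M: left_module U "ext_module U n m" by (rule left_module_ext_module[OF ring_U])
  have c: "(\<lambda>i. ecls m (f i)) \<in> A \<rightarrow> carrier (ext_module U n m)"
    using assms by (auto intro!: ecls_closed)
  then show "(\<Oplus>\<^bsub>ext_module U n m\<^esub>i\<in>A. ecls m (f i)) \<in> carrier (ext_module U n m)"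
    by (rule M.finsum_closed)
  show "ecls m (\<lambda>S. \<Sum>i\<in>A. f i S) \<in> carrier (ext_module U n m)"
    using assms by (auto intro!: ecls_closed linset_sum[OF linset_tensor_alg])
  fix S assume S: "S \<in> ext_index n m"
  have "(\<Oplus>\<^bsub>ext_module U n m\<^esub>i\<in>A. ecls m (f i)) S = (\<Oplus>\<^bsub>U\<^esub>i\<in>A. ecls m (f i) S)"
    by (rule finsum_ext_module_apply[OF ring.is_abelian_group[OF ring_U] c S])
  also have "\<dots> = (\<Oplus>\<^bsub>U\<^esub>i\<in>A. cls (f i S))" using S by simp
  also have "\<dots> = cls (\<Sum>i\<in>A. f i S)" by (rule cls_sum) (use assms S in auto)
  finally show "(\<Oplus>\<^bsub>ext_module U n m\<^esub>i\<in>A. ecls m (f i)) S = ecls m (\<lambda>S. \<Sum>i\<in>A. f i S) S"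
    using S by simp
qed

lemma ext_tensor_cls:
  assumes "a \<in> T"
  shows "ext_tensor U (\<lambda>c. cls (scalar c)) n m (cls a) \<omega> = ecls m (\<lambda>S. a * scalar (\<omega> S))"
  unfolding ext_tensor_def by (rule restrict_ext) (simp add: cls_mult assms tensor_alg_closed)

lemma koszul_formula_cls:
  assumes a: "a \<in> T"
  shows "koszul_formula scale bracket n e m (cls a) Xs = ecls m (koszul_value m a Xs)"
proof -
  have c: "a * incl x * scalar z \<in> T" "a * scalar z \<in> T" for x z
    using a by (auto intro!: tensor_alg_mult incl_closed tensor_alg_closed)
  show ?thesis
    unfolding koszul_formula_def Let_def koszul_value_def
    by (simp only: cls_mult[OF a incl_closed, symmetric] ext_tensor_cls[OF a]
        ext_tensor_cls[OF tensor_alg_mult[OF a incl_closed]] ecls_sum c ecls_add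
        linset_sum[OF linset_tensor_alg])
qed

lemma koszul_free_closed: "(\<And>S. x S \<in> T) \<Longrightarrow> koszul_free x S \<in> T"
  unfolding koszul_free_def koszul_lin_def
  by (intro linset_add[OF linset_tensor_alg] linset_sum[OF linset_tensor_alg] tensor_alg_mult
      linset_iota[OF linset_tensor_alg] koszul_bracket_linset[OF linset_tensor_alg] tensor_alg_closed) auto

text \<open>Transports the Koszul differential to the free algebra. Representatives vanish off the
  index set, so the sum over basis vectors in \<open>koszul_diff\<close> becomes
  \<open>koszul_free\<close> of the whole family.\<close>

lemma kos_cls:
  assumes x: "supp n (Suc m) T x"
  shows "kos m (ecls (Suc m) x) = ecls m (koszul_free x)"
proof -
  let ?I = "ext_index n (Suc m)"
  interpret M: left_module U "ext_module U n m" by (rule left_module_ext_module[OF ring_U])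
  have xT: "x S \<in> T" for S using x by (simp add: supp_def)
  have kT: "koszul_value m a Xs S \<in> T" if "a \<in> T" for a Xs S
    unfolding koszul_value_def using that
    by (intro linset_add[OF linset_tensor_alg] linset_sum[OF linset_tensor_alg])
      (auto intro!: tensor_alg_mult incl_closed tensor_alg_closed)
  have "kos m (ecls (Suc m) x)
      = (\<Oplus>\<^bsub>ext_module U n m\<^esub>S\<in>?I. ecls m (koszul_value m (x S) (map e (sorted_list_of_set S))))"
    unfolding koszul_diff_def
    by (rule M.finsum_cong') (auto simp: koszul_formula_cls xT intro!: ecls_closed kT)
  also have "\<dots> = ecls m (\<lambda>S'. \<Sum>S\<in>?I. koszul_value m (x S) (map e (sorted_list_of_set S)) S')"
    by (rule ecls_sum) (intro kT xT)
  also have "\<dots> = ecls m (koszul_free x)"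
    by (rule restrict_ext) (use x in \<open>simp add: sum_koszul_value supp_def\<close>)
  finally show ?thesis .
qed

lemma ecls_rep:
  assumes X: "X \<in> carrier (ext_module U n m)"
  obtains x q where "supp n m (trunc n q) x" "X = ecls m x"
proof -
  have "\<forall>S\<in>ext_index n m. \<exists>t. t \<in> T \<and> X S = cls t"
    using X by (auto simp: ext_module_simps U_carrier dest: PiE_mem)
  then obtain t where t: "\<And>S. S \<in> ext_index n m \<Longrightarrow> t S \<in> T \<and> X S = cls (t S)" by metis
  then have "\<forall>S\<in>ext_index n m. \<exists>q. t S \<in> trunc n q" by (meson carrier_tensor_algE)
  then obtain q where q: "\<And>S. S \<in> ext_index n m \<Longrightarrow> t S \<in> trunc n (q S)" by metis
  define x where "x S = (if S \<in> ext_index n m then t S else 0)" for S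
  \<comment> \<open>A common length bound for the finitely many coefficients.\<close>
  have "q S \<le> (\<Sum>S\<in>ext_index n m. q S)" if "S \<in> ext_index n m" for S
    using that by (intro member_le_sum) auto
  then have "supp n m (trunc n (\<Sum>S\<in>ext_index n m. q S)) x"
    using q trunc_mono by (fastforce simp: supp_def x_def)
  moreover have "X = ecls m x"
    using X t by (intro ext_module_eqI[OF X] ecls_closed) (auto simp: x_def)
  ultimately show ?thesis using that by blast
qed

lemma supp_trunc_T: "supp n m (trunc n q) x \<Longrightarrow> supp n m T x"
  using carrier_tensor_algI by (auto simp: supp_def)

lemma kos_hom: "kos m \<in> semilinear_hom U id (ext_module U n (Suc m)) (ext_module U n m)"
  unfolding semilinear_hom_def
proof (intro CollectI conjI ballI)
  show "kos m \<in> carrier (ext_module U n (Suc m)) \<rightarrow> carrier (ext_module U n m)"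
  proof
    fix X assume "X \<in> carrier (ext_module U n (Suc m))"
    then obtain x q where x: "supp n (Suc m) (trunc n q) x" "X = ecls (Suc m) x" by (rule ecls_rep)
    show "kos m X \<in> carrier (ext_module U n m)"
      unfolding x(2) kos_cls[OF supp_trunc_T[OF x(1)]]
      using supp_trunc_T[OF x(1)] by (intro ecls_closed koszul_free_closed) (simp add: supp_def)
  qed
next
  fix X Y assume X: "X \<in> carrier (ext_module U n (Suc m))" and Y: "Y \<in> carrier (ext_module U n (Suc m))"
  obtain x q where "supp n (Suc m) (trunc n q) x" and Xx: "X = ecls (Suc m) x" using X by (rule ecls_rep)
  then have x: "supp n (Suc m) T x" by (blast intro: supp_trunc_T)
  obtain y q where "supp n (Suc m) (trunc n q) y" and Yy: "Y = ecls (Suc m) y" using Y by (rule ecls_rep)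
  then have y: "supp n (Suc m) T y" by (blast intro: supp_trunc_T)
  have xy: "supp n (Suc m) T (\<lambda>S. x S + y S)"
    using x y by (auto simp: supp_def intro: linset_add[OF linset_tensor_alg])
  have T: "x S \<in> T" "y S \<in> T" for S using x y by (auto simp: supp_def)
  show "kos m (X \<oplus>\<^bsub>ext_module U n (Suc m)\<^esub> Y) = kos m X \<oplus>\<^bsub>ext_module U n m\<^esub> kos m Y"
    unfolding Xx Yy by (simp only: ecls_add T kos_cls[OF x] kos_cls[OF y] kos_cls[OF xy] koszul_free_closed koszul_free_add)
next
  fix u X assume u: "u \<in> carrier U" and X: "X \<in> carrier (ext_module U n (Suc m))"
  obtain x q where "supp n (Suc m) (trunc n q) x" and Xx: "X = ecls (Suc m) x" using X by (rule ecls_rep)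
  then have x: "supp n (Suc m) T x" by (blast intro: supp_trunc_T)
  obtain a where a: "a \<in> T" "u = cls a" using u by (auto simp: U_carrier)
  have T: "x S \<in> T" for S using x by (simp add: supp_def)
  have ax: "supp n (Suc m) T (\<lambda>S. a * x S)"
    using x a by (auto simp: supp_def intro: tensor_alg_mult)
  have sm: "cls a \<odot>\<^bsub>ext_module U n l\<^esub> ecls l y = ecls l (\<lambda>S. a * y S)" if "\<And>S. y S \<in> T" for l y
    unfolding ext_module_simps by (rule restrict_ext) (simp add: cls_mult a that)
  show "kos m (u \<odot>\<^bsub>ext_module U n (Suc m)\<^esub> X) = id u \<odot>\<^bsub>ext_module U n m\<^esub> kos m X"
    unfolding Xx a(2) id_apply by (simp only: sm T kos_cls[OF x] kos_cls[OF ax] koszul_free_closed koszul_free_mult_left)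
qed

lemma ecls_zero_iff:
  assumes "\<And>S. x S \<in> T"
  shows "ecls m x = \<zero>\<^bsub>ext_module U n m\<^esub> \<longleftrightarrow> (\<forall>S\<in>ext_index n m. x S \<in> J)"
  unfolding ext_module_simps using assms cls_zero_iff
  by (auto simp: fun_eq_iff restrict_def)

lemma kos_kos:
  assumes "X \<in> carrier (ext_module U n (Suc (Suc m)))"
  shows "kos m (kos (Suc m) X) = \<zero>\<^bsub>ext_module U n m\<^esub>"
proof -
  obtain x q where x: "supp n (Suc (Suc m)) (trunc n q) x" and X: "X = ecls (Suc (Suc m)) x"
    using assms by (rule ecls_rep)
  have xT: "x S \<in> T" for S using supp_trunc_T[OF x] by (simp add: supp_def)
  have "supp n (Suc m) UNIV (koszul_free x)" using x by (intro supp_koszul_free) (simp add: supp_def)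
  then have k: "supp n (Suc m) T (koszul_free x)" using koszul_free_closed[of x, OF xT] by (simp add: supp_def)
  have "koszul_free (koszul_free x) S \<in> relid (q + 2)" for S
    using x by (intro koszul_free_koszul_free_relid) (simp add: supp_def)
  then have "\<forall>S\<in>ext_index n m. koszul_free (koszul_free x) S \<in> J" by (auto simp: J_def)
  then show ?thesis
    unfolding X kos_cls[OF supp_trunc_T[OF x]] kos_cls[OF k]
    by (subst ecls_zero_iff) (auto intro: koszul_free_closed xT)
qed

text \<open>Classes carry no length bounds, so a total degree is chosen that is large enough for x
  and for the finitely many relations witnessing the cycle condition. The set A will be the index
  set one degree below, or empty in degree 0.\<close>

lemma ecls_exact:
  assumes x: "supp n m (trunc n q) x" and cycle: "\<And>S. S \<in> A \<Longrightarrow> koszul_free x S \<in> J" "\<And>S. S \<notin> A \<Longrightarrow> koszul_free x S = 0"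
    and fin: "finite A" and const: "m = 0 \<Longrightarrow> Poly_Mapping.lookup (x {}) 0 = 0"
  shows "\<exists>Y\<in>carrier (ext_module U n (Suc m)). kos m Y = ecls m x"
proof -
  have "\<forall>S\<in>A. \<exists>r. koszul_free x S \<in> relid r" using cycle(1) by (auto simp: J_def)
  then obtain r where r: "\<And>S. S \<in> A \<Longrightarrow> koszul_free x S \<in> relid (r S)" by metis
  \<comment> \<open>The summand m makes up for the subtraction in \<open>N - m\<close>.\<close>
  define N where "N = q + sum r A + m"
  have "r S \<le> Suc N - m" if "S \<in> A" for S
    using member_le_sum[of S A r] that fin by (simp add: N_def)
  then have "koszul_free x S \<in> relid (Suc N - m)" for S
    using relid_mono[OF r[of S]] cycle(2)[of S] by (cases "S \<in> A") (auto simp: relid_zero)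
  moreover have "supp n m (trunc n (N - m)) x"
    using x by (auto simp: supp_def N_def intro: trunc_mono)
  ultimately obtain y where y: "supp n (Suc m) (trunc n (N - Suc m)) y" "\<And>S. x S - koszul_free y S \<in> relid (N - m)"
    using relid_exact[of m N x] const by blast
  have xT: "x S \<in> T" for S using supp_trunc_T[OF x] by (simp add: supp_def)
  have yT: "y S \<in> T" for S using supp_trunc_T[OF y(1)] by (simp add: supp_def)
  have "cls (koszul_free y S) = cls (x S)" for S
    using y(2) by (intro cls_eqI[symmetric] xT koszul_free_closed yT) (auto simp: J_def)
  then have "kos m (ecls (Suc m) y) = ecls m x"
    unfolding kos_cls[OF supp_trunc_T[OF y(1)]] by simp
  then show ?thesis using ecls_closed[of "Suc m" y] yT by blast
qed

lemma kos_exact: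
  assumes X: "X \<in> carrier (ext_module U n (Suc m))" and z: "kos m X = \<zero>\<^bsub>ext_module U n m\<^esub>"
  shows "\<exists>Y\<in>carrier (ext_module U n (Suc (Suc m))). kos (Suc m) Y = X"
proof -
  obtain x q where x: "supp n (Suc m) (trunc n q) x" and Xx: "X = ecls (Suc m) x"
    using X by (rule ecls_rep)
  have xT: "x S \<in> T" for S using supp_trunc_T[OF x] by (simp add: supp_def)
  have "ecls m (koszul_free x) = \<zero>\<^bsub>ext_module U n m\<^esub>"
    using z unfolding Xx kos_cls[OF supp_trunc_T[OF x]] .
  then have 1: "koszul_free x S \<in> J" if "S \<in> ext_index n m" for S
    using that by (subst (asm) ecls_zero_iff) (auto intro: koszul_free_closed xT)
  have "supp n m UNIV (koszul_free x)" using x by (intro supp_koszul_free) (simp add: supp_def)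
  then have 2: "koszul_free x S = 0" if "S \<notin> ext_index n m" for S using that by (simp add: supp_def)
  show ?thesis unfolding Xx by (rule ecls_exact[OF x 1 2]) auto
qed

lemma empty_ext_index: "{} \<in> ext_index n 0"
  by (simp add: ext_index_def)

text \<open>In exterior degree 0 there is no vector to remove; the cycle condition is void there,
  and the augmentation takes its place.\<close>

lemma koszul_free_degree_0:
  assumes f: "supp n 0 A f" shows "koszul_free f S = 0"
proof -
  have "insert i S' \<notin> ext_index n 0" for i S'
  proof
    assume a: "insert i S' \<in> ext_index n 0"
    then have "card (insert i S') = 0" by (simp only: ext_index_def mem_Collect_eq)
    then show False using ext_index_finite[OF a] card_0_eq[of "insert i S'"] by blast
  qed
  then have "f (insert i S') = 0" for i S' using f by (simp add: supp_def)
  then have i: "iota i f = (\<lambda>S. 0)" for i by (simp add: iota_def fun_eq_iff)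
  have "iota p (\<lambda>S. 0) = (\<lambda>S. 0 :: 'k falg)" for p by (simp add: fun_eq_iff)
  then show ?thesis by (simp add: koszul_free_def koszul_lin_def koszul_bracket_def i)
qed

lemma kos_exact_0:
  assumes X: "X \<in> carrier (ext_module U n 0)" and z: "env_counit (X {}) = 0"
  shows "\<exists>Y\<in>carrier (ext_module U n (Suc 0)). kos 0 Y = X"
proof -
  obtain x q where x: "supp n 0 (trunc n q) x" and Xx: "X = ecls 0 x"
    using X by (rule ecls_rep)
  have "x {} \<in> T" using supp_trunc_T[OF x] by (simp add: supp_def)
  then have "Poly_Mapping.lookup (x {}) 0 = 0"
    using z env_counit_cls empty_ext_index by (simp add: Xx)
  then show ?thesis
    unfolding Xx using koszul_free_degree_0[OF x] by (intro ecls_exact[OF x, of "{}"]) auto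
qed

lemma env_counit_kos:
  assumes "X \<in> carrier (ext_module U n (Suc 0))"
  shows "env_counit (kos 0 X {}) = 0"
proof -
  obtain x q where x: "supp n (Suc 0) (trunc n q) x" and Xx: "X = ecls (Suc 0) x"
    using assms by (rule ecls_rep)
  have xT: "x S \<in> T" for S using supp_trunc_T[OF x] by (simp add: supp_def)
  have "Poly_Mapping.lookup (koszul_free x {}) 0 = 0"
    by (simp add: koszul_free_empty lookup_sum lookup_mult_zero lookup_gen_zero)
  then show ?thesis
    unfolding Xx kos_cls[OF supp_trunc_T[OF x]]
    using env_counit_cls[OF koszul_free_closed[of x, OF xT]] empty_ext_index by simp
qed

end

section \<open>The deformed algebra\<close>

lemma poly_tensor_closed:
  fixes P :: "'k::field mpoly"
  assumes "\<And>m. m \<in> Poly_Mapping.keys P \<Longrightarrow> Poly_Mapping.keys m \<subseteq> {..<n}"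
  shows "poly_tensor n P \<in> carrier (tensor_alg n)"
proof -
  have pow: "(gen i ^ k :: 'k falg) \<in> carrier (tensor_alg n)" if "i < n" for i k
    using that by (induction k) (auto intro: tensor_alg_closed tensor_alg_mult)
  have prod: "(prod_list (map (\<lambda>i. gen i ^ Poly_Mapping.lookup m i) L) :: 'k falg) \<in> carrier (tensor_alg n)"
    if "set L \<subseteq> {..<n}" for m L
    using that by (induction L) (auto intro: tensor_alg_closed tensor_alg_mult pow)
  show ?thesis
    unfolding poly_tensor_def
    by (intro linset_sum[OF linset_tensor_alg] tensor_alg_mult tensor_alg_closed prod) auto
qed

lemma lookup_prod_list_zero: "Poly_Mapping.lookup (prod_list L) 0 = prod_list (map (\<lambda>t. Poly_Mapping.lookup t 0) (L :: 'k::field falg list))"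
  by (induction L) (auto simp: lookup_mult_zero)

lemma lookup_power_zero: "Poly_Mapping.lookup ((t :: 'k::field falg) ^ k) 0 = Poly_Mapping.lookup t 0 ^ k"
  by (induction k) (auto simp: lookup_mult_zero)

text \<open>Each monomial contains some variable, so its tensor has a factor without constant term,
  and constant terms are multiplicative.\<close>

lemma poly_tensor_lookup_zero:
  assumes "\<And>m. m \<in> Poly_Mapping.keys P \<Longrightarrow> Poly_Mapping.keys m \<subseteq> {..<n} \<and> Poly_Mapping.keys m \<noteq> {}"
  shows "Poly_Mapping.lookup (poly_tensor n P) 0 = 0"
proof -
  have "Poly_Mapping.lookup (prod_list (map (\<lambda>i. gen i ^ Poly_Mapping.lookup m i) [0..<n]) :: 'a falg) 0 = 0"
    if m: "m \<in> Poly_Mapping.keys P" for m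
  proof -
    obtain i where i: "i \<in> Poly_Mapping.keys m" using assms[OF m] by blast
    have "i < n" using i assms[OF m] by blast
    moreover have "Poly_Mapping.lookup m i \<noteq> 0" using i by (metis in_keys_iff)
    ultimately have "0 \<in> set (map (\<lambda>i. Poly_Mapping.lookup (gen i ^ Poly_Mapping.lookup m i :: 'a falg) 0) [0..<n])"
      by (force simp: lookup_power_zero lookup_gen_zero)
    then show ?thesis
      unfolding lookup_prod_list_zero map_map o_def by (simp only: prod_list_zero_iff)
  qed
  then show ?thesis
    by (simp add: poly_tensor_def lookup_sum lookup_mult_zero)
qed

section \<open>The augmentation of the completed tensor algebra\<close>

definition augm :: "'k::field falg fps \<Rightarrow> 'k fps" where
  "augm t = Abs_fps (\<lambda>r. Poly_Mapping.lookup (fps_nth t r) 0)"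

lemma augm_add: "augm (s + t) = augm s + augm t"
  and augm_diff: "augm (s - t) = augm s - augm t"
  by (simp_all add: augm_def fps_eq_iff lookup_add lookup_minus)

lemma augm_mult: "augm (s * t) = augm s * augm t"
  by (simp add: augm_def fps_eq_iff fps_mult_nth lookup_sum lookup_mult_zero)

lemma augm_zero: "augm 0 = 0"
  by (simp add: augm_def fps_eq_iff)

lemma augm_const: "augm (fps_const t) = fps_const (Poly_Mapping.lookup t 0)"
  by (simp add: augm_def fps_eq_iff)

lemma augm_X_power: "augm (fps_X ^ N * t) = fps_X ^ N * augm t"
  by (simp add: augm_def fps_eq_iff fps_X_power_mult_nth)

lemma augm_scalar_h: "augm (scalar_h f) = f"
  by (simp add: augm_def scalar_h_def scalar_def fps_eq_iff)

lemma scalar_h_X: "scalar_h fps_X = fps_X"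
  by (simp add: scalar_h_def fps_eq_iff fps_X_def)

section \<open>Closures of ideals in the h-adic topology\<close>

lemma tensor_alg_h_pow: "x \<in> carrier (tensor_alg_h n) \<Longrightarrow> x [^]\<^bsub>tensor_alg_h n\<^esub> (N::nat) = x ^ N"
proof -
  interpret Th: ring "tensor_alg_h n :: 'a falg fps ring" by (rule ring_tensor_alg_h)
  show "x [^]\<^bsub>tensor_alg_h n\<^esub> (N::nat) = x ^ N"
    by (induction N) (simp_all add: power_commutes)
qed

lemma hfilt_tensor_alg_h: "hfilt (tensor_alg_h n) fps_X N = (\<lambda>t. fps_X ^ N * t) ` carrier (tensor_alg_h n)"
  by (simp add: hfilt_def tensor_alg_h_pow tensor_alg_h_closed)

lemma hclosure_tensor_alg_h:
  assumes "I \<subseteq> carrier (tensor_alg_h n)"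
  shows "x \<in> hclosure (tensor_alg_h n) fps_X I \<longleftrightarrow> x \<in> carrier (tensor_alg_h n) \<and>
    (\<forall>N. \<exists>y\<in>I. \<exists>t\<in>carrier (tensor_alg_h n). x - y = fps_X ^ N * t)"
proof -
  have "x \<ominus>\<^bsub>tensor_alg_h n\<^esub> y = x - y" if "y \<in> I" for y
    using assms that by (auto simp: a_minus_def a_inv_tensor_alg_h)
  then show ?thesis
    unfolding hclosure_def hfilt_tensor_alg_h by (auto simp: image_iff)
qed

text \<open>Multiplying an approximation modulo \<open>h^N\<close> gives an approximation of the
  product: h is central, so the error keeps its factor \<open>h^N\<close> from either side.\<close>

lemma ideal_hclosure:
  assumes I: "ideal I (tensor_alg_h n :: 'k::field falg fps ring)"
  shows "ideal (hclosure (tensor_alg_h n) fps_X I) (tensor_alg_h n)"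
proof -
  let ?Th = "tensor_alg_h n :: 'k falg fps ring"
  interpret I: ideal I ?Th by fact
  have sub: "I \<subseteq> carrier ?Th" by (rule I.a_subset)
  note I_add = additive_subgroup.a_closed[OF ideal.axioms(1)[OF I]]
  note cl = hclosure_tensor_alg_h[OF sub]
  show ?thesis
  proof (rule idealI_additive[OF ring_tensor_alg_h])
    show "hclosure ?Th fps_X I \<subseteq> carrier ?Th" by (auto simp: hclosure_def)
    have "(0 :: 'k falg fps) - 0 = fps_X ^ N * 0" for N by simp
    moreover have "0 \<in> I" using additive_subgroup.zero_closed[OF ideal.axioms(1)[OF I]] by simp
    ultimately show "\<zero>\<^bsub>?Th\<^esub> \<in> hclosure ?Th fps_X I"
      unfolding cl by (auto simp: tensor_alg_h_closed intro!: bexI[of _ 0])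
  next
    fix a b assume a: "a \<in> hclosure ?Th fps_X I" and b: "b \<in> hclosure ?Th fps_X I"
    show "a \<oplus>\<^bsub>?Th\<^esub> b \<in> hclosure ?Th fps_X I"
      unfolding cl
    proof (intro conjI allI)
      fix N
      obtain y t where y: "y \<in> I" "t \<in> carrier ?Th" "a - y = fps_X ^ N * t" using a unfolding cl by blast
      obtain z s where z: "z \<in> I" "s \<in> carrier ?Th" "b - z = fps_X ^ N * s" using b unfolding cl by blast
      have "(a + b) - (y + z) = (a - y) + (b - z)" by simp
      also have "\<dots> = fps_X ^ N * (t + s)" by (simp only: y z distrib_left)
      finally have "(a + b) - (y + z) = fps_X ^ N * (t + s)" .
      moreover have "y + z \<in> I" using I_add[OF y(1) z(1)] by simp
      moreover have "t + s \<in> carrier ?Th" using y z tensor_alg_h_add by blast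
      ultimately show "\<exists>y\<in>I. \<exists>t\<in>carrier ?Th. a \<oplus>\<^bsub>?Th\<^esub> b - y = fps_X ^ N * t"
        unfolding tensor_alg_simps by blast
    qed (use a b cl tensor_alg_h_add in auto)
  next
    fix a x assume a: "a \<in> hclosure ?Th fps_X I" and x: "x \<in> carrier ?Th"
    show "x \<otimes>\<^bsub>?Th\<^esub> a \<in> hclosure ?Th fps_X I"
      unfolding cl
    proof (intro conjI allI)
      fix N
      obtain y t where y: "y \<in> I" "t \<in> carrier ?Th" "a - y = fps_X ^ N * t" using a unfolding cl by blast
      have "x * a - x * y = (x * fps_X ^ N) * t" by (simp add: y mult.assoc flip: right_diff_distrib)
      also have "\<dots> = fps_X ^ N * (x * t)" by (simp only: fps_mult_fps_X_power_commute[symmetric] mult.assoc)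
      finally have "x * a - x * y = fps_X ^ N * (x * t)" .
      moreover have "x * y \<in> I" using I.I_l_closed y x by fastforce
      moreover have "x * t \<in> carrier ?Th" using y x tensor_alg_h_mult by blast
      ultimately show "\<exists>y\<in>I. \<exists>t\<in>carrier ?Th. x \<otimes>\<^bsub>?Th\<^esub> a - y = fps_X ^ N * t"
        unfolding tensor_alg_simps by blast
    qed (use a x cl tensor_alg_h_mult in auto)
    show "a \<otimes>\<^bsub>?Th\<^esub> x \<in> hclosure ?Th fps_X I"
      unfolding cl
    proof (intro conjI allI)
      fix N
      obtain y t where y: "y \<in> I" "t \<in> carrier ?Th" "a - y = fps_X ^ N * t" using a unfolding cl by blast
      have "a * x - y * x = fps_X ^ N * (t * x)" by (simp add: y mult.assoc[symmetric] flip: left_diff_distrib)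
      moreover have "y * x \<in> I" using I.I_r_closed y x by fastforce
      moreover have "t * x \<in> carrier ?Th" using y x tensor_alg_h_mult by blast
      ultimately show "\<exists>y\<in>I. \<exists>t\<in>carrier ?Th. a \<otimes>\<^bsub>?Th\<^esub> x - y = fps_X ^ N * t"
        unfolding tensor_alg_simps by blast
    qed (use a x cl tensor_alg_h_mult in auto)
  qed
qed

text \<open>The two conditions put every relation into the kernel of the map killing all generators,
  which makes the trivial module well defined.\<close>

locale augmented_relations =
  fixes n :: nat and g :: "nat \<Rightarrow> nat \<Rightarrow> 'k::field_char_0 mpoly fps"
  assumes g_vars: "i < n \<Longrightarrow> j < n \<Longrightarrow> series_in_vars n (g i j)"
    and g_order: "i < n \<Longrightarrow> j < n \<Longrightarrow> X_order (g i j) \<ge> 1"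
begin

abbreviation Th :: "'k falg fps ring" where "Th \<equiv> tensor_alg_h n"
abbreviation R :: "'k falg fps set ring" where "R \<equiv> def_alg n g"
abbreviation dcl :: "'k falg fps \<Rightarrow> 'k falg fps set" where "dcl \<equiv> def_class n g"

definition gens :: "'k falg fps set" where
  "gens = {fps_const (gen i) * fps_const (gen j) - fps_const (gen j) * fps_const (gen i)
        - series_tensor n (g i j) | i j. i < n \<and> j < n}"

lemma g_keys:
  assumes "i < n" "j < n" "m \<in> Poly_Mapping.keys (fps_nth (g i j) r)"
  shows "Poly_Mapping.keys m \<subseteq> {..<n} \<and> Poly_Mapping.keys m \<noteq> {}"
proof
  show "Poly_Mapping.keys m \<subseteq> {..<n}"
    using g_vars[OF assms(1,2)] assms(3) by (auto simp: series_in_vars_def)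
  have "1 \<le> enat (\<Sum>i\<in>Poly_Mapping.keys m. Poly_Mapping.lookup m i)"
    using g_order[OF assms(1,2)] assms(3) unfolding X_order_def le_INF_iff by blast
  then show "Poly_Mapping.keys m \<noteq> {}" by (auto simp: one_enat_def)
qed

lemma gens_closed: "gens \<subseteq> carrier Th"
proof -
  have series: "series_tensor n (g i j) \<in> carrier Th" if "i < n" "j < n" for i j
    using poly_tensor_closed[of "fps_nth (g i j) _" n] g_keys[OF that]
    by (simp add: tensor_alg_h_carrier series_tensor_def)
  have diff: "x - y \<in> carrier Th" if "x \<in> carrier Th" "y \<in> carrier Th" for x y
    using tensor_alg_h_add[OF that(1) tensor_alg_h_uminus[OF that(2)]] by simp
  show ?thesis
    unfolding gens_def
    by (clarify, intro diff series tensor_alg_h_mult tensor_alg_h_closed tensor_alg_closed)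
qed

lemma def_ideal_eq: "def_ideal n g = hclosure Th fps_X (genideal Th gens)"
  by (simp add: def_ideal_def gens_def)

lemma augm_gens: "t \<in> gens \<Longrightarrow> augm t = 0"
proof -
  assume "t \<in> gens"
  then obtain i j where ij: "i < n" "j < n" "t = fps_const (gen i) * fps_const (gen j)
    - fps_const (gen j) * fps_const (gen i) - series_tensor n (g i j)" by (auto simp: gens_def)
  have "Poly_Mapping.lookup (poly_tensor n (fps_nth (g i j) r)) 0 = 0" for r
    by (rule poly_tensor_lookup_zero, rule g_keys[OF ij(1,2)])
  then have "augm (series_tensor n (g i j)) = 0"
    by (simp add: augm_def series_tensor_def fps_eq_iff)
  then show "augm t = 0"
    by (simp add: ij augm_diff augm_mult augm_const lookup_gen_zero del: fps_const_mult)
qed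

lemma ideal_def_ideal: "ideal (def_ideal n g) Th"
  unfolding def_ideal_eq
  by (intro ideal_hclosure ring.genideal_ideal[OF ring_tensor_alg_h] gens_closed)

text \<open>The kernel of \<open>augm\<close> is an ideal, and it is closed: each coefficient of
  \<open>augm t\<close> depends on t only modulo a power of h.\<close>

lemma augm_def_ideal: "t \<in> def_ideal n g \<Longrightarrow> augm t = 0"
proof -
  assume t: "t \<in> def_ideal n g"
  interpret Th: ring Th by (rule ring_tensor_alg_h)
  have "ideal {t \<in> carrier Th. augm t = 0} Th"
    by (rule idealI_additive[OF ring_tensor_alg_h])
      (auto simp: tensor_alg_h_closed tensor_alg_h_add tensor_alg_h_mult augm_add augm_mult augm_zero)
  then have sub: "genideal Th gens \<subseteq> {t \<in> carrier Th. augm t = 0}"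
    by (rule Th.genideal_minimal) (use gens_closed augm_gens in auto)
  show "augm t = 0"
  proof (rule fps_ext)
    fix r
    have "genideal Th gens \<subseteq> carrier Th" using sub by blast
    \<comment> \<open>Working modulo \<open>h^(r + 1)\<close> determines the coefficients up to the
      index r.\<close>
    then obtain y s where y: "y \<in> genideal Th gens" "t - y = fps_X ^ Suc r * s"
      using t unfolding def_ideal_eq by (subst (asm) hclosure_tensor_alg_h) blast+
    have "augm t = augm t - augm y" using y sub by auto
    also have "\<dots> = fps_X ^ Suc r * augm s" by (simp only: augm_diff[symmetric] y augm_X_power)
    finally show "fps_nth (augm t) r = fps_nth 0 r"
      by (simp only: fps_X_power_mult_nth) simp
  qed
qed

interpretation D: ideal "def_ideal n g" Th by (rule ideal_def_ideal)

lemma R_eq: "R = Th Quot def_ideal n g" and dcl_eq: "dcl t = def_ideal n g +>\<^bsub>Th\<^esub> t"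
  by (simp_all add: def_alg_def def_class_def)

lemma ring_R: "ring R"
  unfolding R_eq by (rule D.quotient_is_ring)

lemma dcl_props:
  shows R_carrier: "carrier R = dcl ` carrier Th"
    and dcl_add: "a \<in> carrier Th \<Longrightarrow> b \<in> carrier Th \<Longrightarrow> dcl (a + b) = dcl a \<oplus>\<^bsub>R\<^esub> dcl b"
    and dcl_mult: "a \<in> carrier Th \<Longrightarrow> b \<in> carrier Th \<Longrightarrow> dcl (a * b) = dcl a \<otimes>\<^bsub>R\<^esub> dcl b"
    and dcl_one: "dcl 1 = \<one>\<^bsub>R\<^esub>"
  using D.quotient_props unfolding R_eq dcl_eq[abs_def] by auto

lemma dcl_closed: "t \<in> carrier Th \<Longrightarrow> dcl t \<in> carrier R"
  by (simp add: R_carrier)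

lemma def_counit_dcl:
  assumes "t \<in> carrier Th" shows "def_counit (dcl t) = augm t"
proof -
  have "dcl t = (\<lambda>j. j + t) ` def_ideal n g"
    unfolding dcl_eq a_r_coset_def' by auto
  moreover have "augm (j + t) = augm t" if "j \<in> def_ideal n g" for j
    using augm_def_ideal[OF that] by (simp add: augm_add)
  moreover have "0 \<in> def_ideal n g"
    using additive_subgroup.zero_closed[OF ideal.axioms(1)[OF ideal_def_ideal]] by simp
  ultimately have "augm ` dcl t = {augm t}" by (auto simp: image_image)
  then show ?thesis by (simp add: def_counit_def augm_def[abs_def])
qed

lemma def_counit_props:
  assumes "u \<in> carrier R" "v \<in> carrier R"
  shows "def_counit (u \<oplus>\<^bsub>R\<^esub> v) = def_counit u + def_counit v"
    and "def_counit (u \<otimes>\<^bsub>R\<^esub> v) = def_counit u * def_counit v"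
proof -
  obtain a b where ab: "a \<in> carrier Th" "b \<in> carrier Th" "u = dcl a" "v = dcl b"
    using assms by (auto simp: R_carrier)
  show "def_counit (u \<oplus>\<^bsub>R\<^esub> v) = def_counit u + def_counit v"
    using ab tensor_alg_h_add[OF ab(1,2)] by (simp add: dcl_add[symmetric] def_counit_dcl augm_add)
  show "def_counit (u \<otimes>\<^bsub>R\<^esub> v) = def_counit u * def_counit v"
    using ab tensor_alg_h_mult[OF ab(1,2)] by (simp add: dcl_mult[symmetric] def_counit_dcl augm_mult)
qed

abbreviation h :: "'k falg fps set" where "h \<equiv> dcl fps_X"

lemma h_closed: "h \<in> carrier R"
  by (intro dcl_closed tensor_alg_h_closed)

lemma h_comm: "x \<in> carrier R \<Longrightarrow> h \<otimes>\<^bsub>R\<^esub> x = x \<otimes>\<^bsub>R\<^esub> h"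
proof -
  assume "x \<in> carrier R"
  then obtain t where t: "t \<in> carrier Th" "x = dcl t" by (auto simp: R_carrier)
  then show "h \<otimes>\<^bsub>R\<^esub> x = x \<otimes>\<^bsub>R\<^esub> h"
    by (simp add: dcl_mult[symmetric] tensor_alg_h_closed fps_mult_fps_X_commute)
qed

lemma hfilt_1: "hfilt R h 1 = (\<lambda>x. h \<otimes>\<^bsub>R\<^esub> x) ` carrier R"
proof -
  interpret R: ring R by (rule ring_R)
  show ?thesis using h_closed by (simp add: hfilt_def)
qed

text \<open>Centrality of h makes h R a two-sided ideal, so the quotient in
  \<open>is_deformation\<close> is a quotient ring.\<close>

lemma ideal_hfilt_1: "ideal (hfilt R h 1) R"
proof -
  interpret R: ring R by (rule ring_R)
  show ?thesis
    unfolding hfilt_1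
  proof (rule idealI_additive[OF ring_R])
    show "\<zero>\<^bsub>R\<^esub> \<in> (\<lambda>x. h \<otimes>\<^bsub>R\<^esub> x) ` carrier R"
      using h_closed by (intro image_eqI[of _ _ "\<zero>\<^bsub>R\<^esub>"]) auto
  next
    fix a b assume "a \<in> (\<lambda>x. h \<otimes>\<^bsub>R\<^esub> x) ` carrier R" "b \<in> (\<lambda>x. h \<otimes>\<^bsub>R\<^esub> x) ` carrier R"
    then obtain x y where xy: "x \<in> carrier R" "y \<in> carrier R" "a = h \<otimes>\<^bsub>R\<^esub> x" "b = h \<otimes>\<^bsub>R\<^esub> y" by auto
    then show "a \<oplus>\<^bsub>R\<^esub> b \<in> (\<lambda>x. h \<otimes>\<^bsub>R\<^esub> x) ` carrier R"
      using h_closed by (intro image_eqI[of _ _ "x \<oplus>\<^bsub>R\<^esub> y"]) (auto simp: R.r_distr)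
  next
    fix a z assume "a \<in> (\<lambda>x. h \<otimes>\<^bsub>R\<^esub> x) ` carrier R" and z: "z \<in> carrier R"
    then obtain x where x: "x \<in> carrier R" "a = h \<otimes>\<^bsub>R\<^esub> x" by auto
    have "z \<otimes>\<^bsub>R\<^esub> (h \<otimes>\<^bsub>R\<^esub> x) = h \<otimes>\<^bsub>R\<^esub> (z \<otimes>\<^bsub>R\<^esub> x)"
      using x z h_closed h_comm[OF z] by (simp add: R.m_assoc[symmetric])
    then show "z \<otimes>\<^bsub>R\<^esub> a \<in> (\<lambda>x. h \<otimes>\<^bsub>R\<^esub> x) ` carrier R" using x z by auto
    have "h \<otimes>\<^bsub>R\<^esub> x \<otimes>\<^bsub>R\<^esub> z = h \<otimes>\<^bsub>R\<^esub> (x \<otimes>\<^bsub>R\<^esub> z)" using x z h_closed by (simp add: R.m_assoc)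
    then show "a \<otimes>\<^bsub>R\<^esub> z \<in> (\<lambda>x. h \<otimes>\<^bsub>R\<^esub> x) ` carrier R" using x z by auto
  qed (use h_closed in auto)
qed

end

text \<open>
  A module of the form \<open>V[[h]]\<close> is complete: the coordinates of the solution \<open>t\<^sub>i = \<Sum>\<^sub>j h\<^sup>j y\<^sub>i\<^sub>+\<^sub>j\<close> are
  finite sums of coordinates of the \<open>y\<^sub>j\<close>.
\<close>

lemma hcomplete_of_coordinates:
  fixes \<phi> :: "'r \<Rightarrow> nat \<Rightarrow> 'v::ab_group_add"
  assumes M: "abelian_group M" "abelian_group C"
    and bij: "bij_betw \<phi> (carrier M) UNIV"
    and add: "\<And>x y. x \<in> carrier M \<Longrightarrow> y \<in> carrier M \<Longrightarrow> \<phi> (x \<oplus>\<^bsub>M\<^esub> y) = (\<lambda>r. \<phi> x r + \<phi> y r)"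
    and eta_closed: "\<And>x. x \<in> carrier M \<Longrightarrow> \<eta> x \<in> carrier M"
    and eta: "\<And>x r. x \<in> carrier M \<Longrightarrow> \<phi> (\<eta> x) r = (if r = 0 then 0 else \<phi> x (r - 1))"
    and p: "\<And>x. x \<in> carrier M \<Longrightarrow> p x \<in> carrier C"
      "\<And>x y. x \<in> carrier M \<Longrightarrow> y \<in> carrier M \<Longrightarrow> p (x \<oplus>\<^bsub>M\<^esub> y) = p x \<oplus>\<^bsub>C\<^esub> p y"
      "\<And>c. c \<in> carrier C \<Longrightarrow> \<exists>x\<in>carrier M. p x = c"
      "\<And>x. x \<in> carrier M \<Longrightarrow> p x = \<zero>\<^bsub>C\<^esub> \<longleftrightarrow> (\<exists>y\<in>carrier M. x = \<eta> y)"
  shows "hcomplete M \<eta> p C"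
proof -
  interpret M: abelian_group M by fact
  interpret C: abelian_group C by fact
  have inj: "x = y" if "x \<in> carrier M" "y \<in> carrier M" "\<And>r. \<phi> x r = \<phi> y r" for x y
    using bij that by (auto simp: bij_betw_def inj_on_def fun_eq_iff)
  have surj: "\<exists>x\<in>carrier M. \<phi> x = f" for f
    using bij unfolding bij_betw_def by (metis UNIV_I image_iff)
  have zero: "\<phi> \<zero>\<^bsub>M\<^esub> r = 0" for r using fun_cong[OF add[of "\<zero>\<^bsub>M\<^esub>" "\<zero>\<^bsub>M\<^esub>"], of r] by simp
  show ?thesis
  proof
    show "\<eta> x \<in> carrier M" "p x \<in> carrier C" if "x \<in> carrier M" for x using that eta_closed p by auto
    show "\<eta> (x \<oplus>\<^bsub>M\<^esub> y) = \<eta> x \<oplus>\<^bsub>M\<^esub> \<eta> y" if "x \<in> carrier M" "y \<in> carrier M" for x y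
      using that by (intro inj) (auto simp: eta_closed add eta)
    show "x = y" if "x \<in> carrier M" "y \<in> carrier M" "\<eta> x = \<eta> y" for x y
    proof (rule inj[OF that(1,2)])
      fix r show "\<phi> x r = \<phi> y r" using eta[OF that(1), of "Suc r"] eta[OF that(2), of "Suc r"] that(3) by simp
    qed
  next
    fix y :: "nat \<Rightarrow> 'r" assume y: "y \<in> UNIV \<rightarrow> carrier M"
    have "\<forall>i. \<exists>t. t \<in> carrier M \<and> \<phi> t = (\<lambda>r. \<Sum>j\<le>r. \<phi> (y (i + j)) (r - j))" using surj by blast
    then obtain t where t: "\<And>i. t i \<in> carrier M" "\<And>i. \<phi> (t i) = (\<lambda>r. \<Sum>j\<le>r. \<phi> (y (i + j)) (r - j))" by metis
    have t_eq: "t i = y i \<oplus>\<^bsub>M\<^esub> \<eta> (t (Suc i))" for i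
    proof (rule inj)
      show "t i \<in> carrier M" "y i \<oplus>\<^bsub>M\<^esub> \<eta> (t (Suc i)) \<in> carrier M" using t(1) y eta_closed by auto
      fix r
      have yi: "y i \<in> carrier M" using y by auto
      \<comment> \<open>For r = 0 the shift contributes nothing; otherwise the term j = 0 comes from
        \<open>y i\<close> and the remaining sum belongs to \<open>t (Suc i)\<close>.\<close>
      show "\<phi> (t i) r = \<phi> (y i \<oplus>\<^bsub>M\<^esub> \<eta> (t (Suc i))) r"
        by (cases r) (simp_all add: add[OF yi eta_closed[OF t(1)]] eta[OF t(1)] t(2) sum.atMost_Suc_shift del: sum.atMost_Suc)
    qed
    show "\<exists>t\<in>UNIV \<rightarrow> carrier M. \<forall>i. t i = y i \<oplus>\<^bsub>M\<^esub> \<eta> (t (Suc i))"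
    proof (rule bexI[of _ t])
      show "\<forall>i. t i = y i \<oplus>\<^bsub>M\<^esub> \<eta> (t (Suc i))" using t_eq by blast
      show "t \<in> UNIV \<rightarrow> carrier M" using t(1) by blast
    qed
  next
    fix x :: "nat \<Rightarrow> 'r" assume x: "x \<in> UNIV \<rightarrow> carrier M" and e: "\<And>i. x i = \<eta> (x (Suc i))"
    have xi: "x i \<in> carrier M" for i using x by auto
    \<comment> \<open>The coefficient r + 1 of one member is the coefficient r of the next, hence
      all indices i are treated together.\<close>
    have "\<forall>i. \<phi> (x i) r = 0" for r
    proof (induction r)
      case 0
      show ?case
      proof
        fix i show "\<phi> (x i) 0 = 0" by (subst e) (simp add: eta[OF xi])
      qed
    next
      case (Suc r)
      show ?case
      proof
        fix i show "\<phi> (x i) (Suc r) = 0" by (subst e) (simp add: eta[OF xi] Suc)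
      qed
    qed
    then show "x 0 = \<zero>\<^bsub>M\<^esub>" by (intro inj xi) (auto simp: zero)
  qed (use p in auto)
qed

section \<open>The deformed enveloping algebra and its resolution\<close>

locale deformed_enveloping = lie_basis scale bracket n e + augmented_relations n g
  for scale :: "'k::field_char_0 \<Rightarrow> 'a::ab_group_add \<Rightarrow> 'a" and bracket :: "'a \<Rightarrow> 'a \<Rightarrow> 'a"
    and n :: nat and e :: "nat \<Rightarrow> 'a" and g :: "nat \<Rightarrow> nat \<Rightarrow> 'k mpoly fps" +
  fixes scaleV :: "'k \<Rightarrow> 'v::ab_group_add \<Rightarrow> 'v"
  assumes deformation: "is_deformation scaleV scale bracket n e g"
begin

text \<open>p is the projection modulo h followed by the given isomorphism \<open>\<theta>\<close>.
  Topological freeness supplies injectivity, completeness and separatedness for h. The values of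
  \<open>\<theta>\<close> on letters and scalars determine p on constants, and the higher
  coefficients of t contribute multiples of h.\<close>

lemma reduction:
  "\<exists>p. deform R h p U \<and> (\<forall>t\<in>carrier Th. p (dcl t) = cls (fps_nth t 0))"
proof -
  let ?H = "hfilt R h 1"
  interpret R: ring R by (rule ring_R)
  interpret U: ring U by (rule ring_U)
  interpret H: ideal ?H R by (rule ideal_hfilt_1)
  obtain \<phi> where V: "vector_space scaleV" and \<phi>: "bij_betw \<phi> (carrier R) (UNIV :: (nat \<Rightarrow> 'v) set)"
    "\<And>x y. x \<in> carrier R \<Longrightarrow> y \<in> carrier R \<Longrightarrow> \<phi> (x \<oplus>\<^bsub>R\<^esub> y) = (\<lambda>r. \<phi> x r + \<phi> y r)"
    "\<And>c x. x \<in> carrier R \<Longrightarrow>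
      \<phi> (dcl (scalar_h c) \<otimes>\<^bsub>R\<^esub> x) = (\<lambda>r. \<Sum>i\<le>r. scaleV (fps_nth c i) (\<phi> x (r - i)))"
    using deformation unfolding is_deformation_def topologically_free_def by blast
  obtain \<theta> where \<theta>: "\<theta> \<in> ring_iso (R Quot ?H) U"
    "\<And>i. i < n \<Longrightarrow> \<theta> (?H +>\<^bsub>R\<^esub> dcl (fps_const (gen i))) = cls (gen i)"
    "\<And>c. \<theta> (?H +>\<^bsub>R\<^esub> dcl (fps_const (scalar c))) = cls (scalar c)"
    using deformation unfolding is_deformation_def Let_def by blast
  define p where "p x = \<theta> (?H +>\<^bsub>R\<^esub> x)" for x
  note scaleV = module.scale_zero_left[OF module_iff_vector_space[THEN iffD2, OF V]] vector_space.vector_space_assms(4)[OF V]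
  have \<theta>_hom: "\<theta> \<in> ring_hom (R Quot ?H) U" and \<theta>_bij: "bij_betw \<theta> (carrier (R Quot ?H)) (carrier U)"
    using \<theta>(1) by (auto simp: ring_iso_def)
  note q = H.quotient_props
  have qc: "?H +>\<^bsub>R\<^esub> x \<in> carrier (R Quot ?H)" if "x \<in> carrier R" for x using that q(1) by blast
  have p_closed: "p x \<in> carrier U" if "x \<in> carrier R" for x
    using ring_hom_closed[OF \<theta>_hom qc[OF that]] by (simp add: p_def)
  have p_add: "p (x \<oplus>\<^bsub>R\<^esub> y) = p x \<oplus>\<^bsub>U\<^esub> p y" if "x \<in> carrier R" "y \<in> carrier R" for x y
    using ring_hom_add[OF \<theta>_hom qc[OF that(1)] qc[OF that(2)]] q(2)[OF that] by (simp add: p_def)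
  have p_mult: "p (x \<otimes>\<^bsub>R\<^esub> y) = p x \<otimes>\<^bsub>U\<^esub> p y" if "x \<in> carrier R" "y \<in> carrier R" for x y
    using ring_hom_mult[OF \<theta>_hom qc[OF that(1)] qc[OF that(2)]] q(3)[OF that] by (simp add: p_def)
  have p_one: "p \<one>\<^bsub>R\<^esub> = \<one>\<^bsub>U\<^esub>"
    using ring_hom_one[OF \<theta>_hom] q(4) by (simp add: p_def)
  have \<theta>_zero: "\<theta> \<zero>\<^bsub>R Quot ?H\<^esub> = \<zero>\<^bsub>U\<^esub>"
    by (rule ring_hom_zero[OF \<theta>_hom H.quotient_is_ring ring_U])
  have p_zero_iff: "p x = \<zero>\<^bsub>U\<^esub> \<longleftrightarrow> (\<exists>y\<in>carrier R. x = h \<otimes>\<^bsub>R\<^esub> y)" if x: "x \<in> carrier R" for x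
  proof -
    have z: "\<zero>\<^bsub>R Quot ?H\<^esub> \<in> carrier (R Quot ?H)"
      using ring.ring_simprules(2)[OF H.quotient_is_ring] .
    have "p x = \<zero>\<^bsub>U\<^esub> \<longleftrightarrow> ?H +>\<^bsub>R\<^esub> x = \<zero>\<^bsub>R Quot ?H\<^esub>"
      unfolding p_def \<theta>_zero[symmetric]
      using \<theta>_bij qc[OF x] z by (auto simp: bij_betw_def inj_on_def)
    also have "\<dots> \<longleftrightarrow> x \<in> ?H" by (rule q(5)[OF x])
    finally show ?thesis unfolding hfilt_1 by auto
  qed
  have p_surj: "\<exists>x\<in>carrier R. p x = c" if "c \<in> carrier U" for c
  proof -
    have "c \<in> \<theta> ` carrier (R Quot ?H)" using \<theta>_bij that by (simp add: bij_betw_def)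
    then show ?thesis unfolding q(1) p_def by auto
  qed
  \<comment> \<open>The structure map sends the series h to the class of \<open>fps_X\<close>, so
    the formula for the action of \<open>k[[h]]\<close> on coordinates becomes a shift.\<close>
  have shift: "\<phi> (h \<otimes>\<^bsub>R\<^esub> x) r = (if r = 0 then 0 else \<phi> x (r - 1))" if "x \<in> carrier R" for x r
  proof -
    have "\<phi> (h \<otimes>\<^bsub>R\<^esub> x) r = (\<Sum>i\<le>r. scaleV (fps_nth fps_X i) (\<phi> x (r - i)))"
      using fun_cong[OF \<phi>(3)[OF that, of fps_X], of r] by (simp add: scalar_h_X)
    also have "\<dots> = (\<Sum>i\<le>r. if i = 1 then \<phi> x (r - 1) else 0)"
      by (intro sum.cong refl) (auto simp: fps_X_def scaleV)
    finally show ?thesis by auto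
  qed
  have "hcomplete R (\<lambda>x. h \<otimes>\<^bsub>R\<^esub> x) p U"
    by (rule hcomplete_of_coordinates[OF R.abelian_group_axioms U.abelian_group_axioms \<phi>(1,2)])
      (use h_closed shift p_closed p_add p_surj p_zero_iff in auto)
  then have "deform R h p U"
    by (intro deform.intro deform_axioms.intro ring_R ring_U h_closed h_comm p_mult p_one)
  moreover have "p (dcl t) = cls (fps_nth t 0)" if t: "t \<in> carrier Th" for t
  proof -
    have const_mult: "p (dcl (fps_const (a * b))) = p (dcl (fps_const a)) \<otimes>\<^bsub>U\<^esub> p (dcl (fps_const b))"
      if "a \<in> T" "b \<in> T" for a b
    proof -
      have c: "fps_const a \<in> carrier Th" "fps_const b \<in> carrier Th"
        using that by (simp_all add: tensor_alg_h_closed)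
      show ?thesis
        unfolding fps_const_mult[symmetric] dcl_mult[OF c] by (rule p_mult[OF dcl_closed dcl_closed]) (rule c)+
    qed
    have word: "p (dcl (fps_const (Poly_Mapping.single (FWord u) c))) = cls (Poly_Mapping.single (FWord u) c)"
      if "set u \<subseteq> {..<n}" for u c
      using that
    proof (induction u rule: rev_induct)
      case Nil
      then show ?case using \<theta>(3)[of c] by (simp add: p_def scalar_def flip: zero_fword_def)
    next
      case (snoc k u)
      have uc: "Poly_Mapping.single (FWord u) c \<in> T" and k: "gen k \<in> T"
        using snoc.prems by (auto intro: carrier_tensor_algI[OF trunc_single[OF _ lessI]] tensor_alg_closed)
      have "Poly_Mapping.single (FWord (u @ [k])) c = Poly_Mapping.single (FWord u) c * gen k"
        by (simp add: gen_def mult_single)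
      then show ?case
        using snoc const_mult[OF uc k] \<theta>(2)[of k] cls_mult[OF uc k] by (simp add: p_def)
    qed
    have const: "a \<in> T \<and> p (dcl (fps_const a)) = cls a" if a: "a \<in> T" for a
    proof -
      obtain q where "a \<in> trunc n q" using a by (rule carrier_tensor_algE)
      then show ?thesis
      proof (induction a rule: trunc_induct)
        case (single u c)
        then show ?case using word by (auto intro: carrier_tensor_algI[OF trunc_single[OF _ lessI]])
      next
        case (add x y)
        then have c: "fps_const x \<in> carrier Th" "fps_const y \<in> carrier Th"
          by (simp_all add: tensor_alg_h_closed)
        have "p (dcl (fps_const (x + y))) = p (dcl (fps_const x)) \<oplus>\<^bsub>U\<^esub> p (dcl (fps_const y))"
          unfolding fps_const_add[symmetric] dcl_add[OF c] by (rule p_add[OF dcl_closed dcl_closed]) (rule c)+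
        then have "p (dcl (fps_const (x + y))) = cls (x + y)"
          using add by (simp add: cls_add)
        then show ?case using add linset_add[OF linset_tensor_alg] by blast
      next
        case zero
        then show ?case using word[of "[]" 0] by (simp add: tensor_alg_closed)
      qed
    qed
    let ?s = "fps_shift 1 t"
    have s: "?s \<in> carrier Th" "fps_const (fps_nth t 0) \<in> carrier Th" "fps_nth t 0 \<in> T"
      using t by (auto simp: tensor_alg_h_carrier tensor_alg_closed)
    have "t = fps_const (fps_nth t 0) + fps_X * ?s"
      by (auto simp: fps_eq_iff)
    then have "dcl t = dcl (fps_const (fps_nth t 0)) \<oplus>\<^bsub>R\<^esub> (h \<otimes>\<^bsub>R\<^esub> dcl ?s)"
      using s dcl_add[OF s(2) tensor_alg_h_mult[OF tensor_alg_h_closed(3) s(1)]]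
        dcl_mult[OF tensor_alg_h_closed(3) s(1)] by simp
    moreover have "p (h \<otimes>\<^bsub>R\<^esub> dcl ?s) = \<zero>\<^bsub>U\<^esub>"
      using p_zero_iff[of "h \<otimes>\<^bsub>R\<^esub> dcl ?s"] h_closed dcl_closed[OF s(1)] by blast
    ultimately show ?thesis
      using const[OF s(3)] s h_closed dcl_closed p_closed by (simp add: p_add cls_closed)
  qed
  ultimately show ?thesis by blast
qed

lemma trivial_def_module_simps:
  "carrier (trivial_def_module :: ('k falg fps set, 'k fps) module) = UNIV"
  "\<zero>\<^bsub>trivial_def_module :: ('k falg fps set, 'k fps) module\<^esub> = 0"
  "x \<oplus>\<^bsub>trivial_def_module :: ('k falg fps set, 'k fps) module\<^esub> y = x + y"
  "u \<odot>\<^bsub>trivial_def_module :: ('k falg fps set, 'k fps) module\<^esub> x = def_counit u * x"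
  by (simp_all add: trivial_def_module_def)

lemma type_ring_simps:
  "carrier (type_ring :: 'k ring) = UNIV" "\<zero>\<^bsub>type_ring :: 'k ring\<^esub> = 0" "\<one>\<^bsub>type_ring :: 'k ring\<^esub> = 1"
  "x \<oplus>\<^bsub>type_ring :: 'k ring\<^esub> y = x + y" "x \<otimes>\<^bsub>type_ring :: 'k ring\<^esub> y = x * y"
  by (simp_all add: type_ring_def)

abbreviation N :: "('k falg fps set, 'k fps) module" where "N \<equiv> trivial_def_module"

lemma def_counit_one: "def_counit \<one>\<^bsub>R\<^esub> = 1"
  unfolding dcl_one[symmetric] def_counit_dcl[OF tensor_alg_h_closed(2)]
  by (simp add: augm_def fps_eq_iff lookup_one_zero)

lemma def_counit_h: "def_counit h = fps_X"
  using def_counit_dcl[OF tensor_alg_h_closed(3)] augm_scalar_h[of fps_X] by (simp add: scalar_h_X)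

lemma left_module_N: "left_module R N"
proof (intro left_module.intro left_module_axioms.intro ring_R)
  show "abelian_group N"
  proof (rule abelian_groupI)
    fix x assume "x \<in> carrier N"
    show "\<exists>y\<in>carrier N. y \<oplus>\<^bsub>N\<^esub> x = \<zero>\<^bsub>N\<^esub>"
      by (rule bexI[of _ "- x"]) (simp_all add: trivial_def_module_simps)
  qed (simp_all add: trivial_def_module_simps add_ac)
qed (simp_all add: trivial_def_module_simps def_counit_props def_counit_one algebra_simps)

lemma abelian_group_type_ring: "abelian_group (type_ring :: 'k ring)"
proof (rule abelian_groupI)
  fix x assume "x \<in> carrier (type_ring :: 'k ring)"
  show "\<exists>y\<in>carrier (type_ring :: 'k ring). y \<oplus>\<^bsub>type_ring\<^esub> x = \<zero>\<^bsub>type_ring\<^esub>"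
    by (rule bexI[of _ "- x"]) (simp_all add: type_ring_simps)
qed (simp_all add: type_ring_simps add_ac)

text \<open>The class of h acts on \<open>k[[h]]\<close> through the counit, that is, as
  \<open>fps_X\<close>; this is injective, and the constant coefficient is the reduction modulo
  it.\<close>

lemma hred_N: "hred N (\<lambda>x. h \<odot>\<^bsub>N\<^esub> x) (\<lambda>f. fps_nth f 0) (type_ring :: 'k ring)"
proof (intro hred.intro hred_axioms.intro left_module.axioms(2)[OF left_module_N] abelian_group_type_ring)
  fix x y :: "'k fps"
  show "x = y" if "h \<odot>\<^bsub>N\<^esub> x = h \<odot>\<^bsub>N\<^esub> y"
    using that by (simp add: trivial_def_module_simps def_counit_h)
  have "(\<exists>y. x = fps_X * y) \<longleftrightarrow> fps_nth x 0 = 0"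
  proof
    assume "fps_nth x 0 = 0"
    then have "x = fps_X * fps_shift 1 x" by (auto simp: fps_eq_iff)
    then show "\<exists>y. x = fps_X * y" by blast
  qed auto
  then show "(fps_nth x 0 = \<zero>\<^bsub>type_ring\<^esub>) = (\<exists>y\<in>carrier N. x = h \<odot>\<^bsub>N\<^esub> y)"
    by (simp add: trivial_def_module_simps def_counit_h type_ring_simps)
next
  fix c :: 'k
  show "\<exists>x\<in>carrier N. fps_nth x 0 = c"
    by (rule bexI[of _ "fps_const c"]) (simp_all add: trivial_def_module_simps)
qed (simp_all add: trivial_def_module_simps type_ring_simps algebra_simps)

text \<open>With the counit at the empty set as augmentation, \<open>lift_resolution\<close> applies
  to the Koszul complex. The associated graded differentials are then computed from the reductions,
  which are the Koszul differentials by construction.\<close>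

theorem resolution:
  "\<exists>d \<epsilon>. left_resolution R N (def_ext_module n g) d \<epsilon> \<and> gr_is_koszul scale bracket n e g d \<epsilon>"
proof -
  obtain p where "deform R h p U" and p_dcl: "\<And>t. t \<in> carrier Th \<Longrightarrow> p (dcl t) = cls (fps_nth t 0)"
    using reduction by blast
  then interpret deform R h p U n by simp
  let ?k = "type_ring :: 'k ring"
  define \<epsilon> :: "(nat set \<Rightarrow> 'k falg fps set) \<Rightarrow> 'k fps" where "\<epsilon> x = def_counit (x {})" for x
  define \<epsilon>' :: "(nat set \<Rightarrow> 'k falg set) \<Rightarrow> 'k" where "\<epsilon>' c = env_counit (c {})" for c
  \<comment> \<open>Both counits read off the coefficient of the empty word, so reduction modulo h
    matches them.\<close>
  have counit: "fps_nth (def_counit u) 0 = env_counit (p u)" if u: "u \<in> carrier R" for u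
  proof -
    obtain t where t: "t \<in> carrier Th" "u = dcl t" using u by (auto simp: R_carrier)
    then have "fps_nth t 0 \<in> T" by (simp add: tensor_alg_h_carrier)
    then show ?thesis using t by (simp add: def_counit_dcl p_dcl env_counit_cls augm_def)
  qed
  have eps: "\<epsilon> \<in> semilinear_hom R id (K 0) N"
    unfolding semilinear_hom_def \<epsilon>_def
    using empty_ext_index
    by (auto simp: trivial_def_module_simps ext_module_simps def_counit_props PiE_ext_index_mem)
  have eps_q: "fps_nth (\<epsilon> x) 0 = \<epsilon>' (reduce 0 x)" if "x \<in> carrier (K 0)" for x
    using that empty_ext_index counit by (simp add: \<epsilon>_def \<epsilon>'_def reduce_def ext_module_simps PiE_ext_index_mem)
  have eps_surj: "\<epsilon> ` carrier (K 0) = carrier N"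
  proof -
    have "f \<in> \<epsilon> ` carrier (K 0)" for f
    proof (rule image_eqI[of _ _ "\<lambda>S\<in>ext_index n 0. dcl (scalar_h f)"])
      show "f = \<epsilon> (\<lambda>S\<in>ext_index n 0. dcl (scalar_h f))"
        unfolding \<epsilon>_def restrict_apply'[OF empty_ext_index] def_counit_dcl[OF tensor_alg_h_closed(4)]
        by (rule augm_scalar_h[symmetric])
      show "(\<lambda>S\<in>ext_index n 0. dcl (scalar_h f)) \<in> carrier (K 0)"
        using dcl_closed[OF tensor_alg_h_closed(4)] by (simp add: ext_module_simps)
    qed
    then show ?thesis unfolding trivial_def_module_simps by blast
  qed
  have "\<exists>d. left_resolution R N K d \<epsilon> \<and>
    (\<forall>m. \<forall>x\<in>carrier (K (Suc m)). reduce m (d m x) = kos m (reduce (Suc m) x))"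
  proof (rule lift_resolution)
    show "hred N (\<lambda>x. h \<odot>\<^bsub>N\<^esub> x) (\<lambda>f. fps_nth f 0) ?k" by (rule hred_N)
    show "\<epsilon>' (kos 0 c) = \<zero>\<^bsub>?k\<^esub>" if "c \<in> carrier (Kbar (Suc 0))" for c
      using env_counit_kos[OF that] by (simp add: \<epsilon>'_def type_ring_simps)
    show "\<exists>b\<in>carrier (Kbar (Suc 0)). kos 0 b = c" if "c \<in> carrier (Kbar 0)" "\<epsilon>' c = \<zero>\<^bsub>?k\<^esub>" for c
      using kos_exact_0[OF that(1)] that(2) by (simp add: \<epsilon>'_def type_ring_simps)
  qed (fact left_module_N eps eps_q eps_surj kos_hom kos_kos kos_exact)+
  then obtain d where d: "left_resolution R N K d \<epsilon>"
    and d_pm: "\<And>m x. x \<in> carrier (K (Suc m)) \<Longrightarrow> reduce m (d m x) = kos m (reduce (Suc m) x)"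
    by blast
  have d_hom: "d m \<in> semilinear_hom R id (K (Suc m)) (K m)" for m
    using d by (simp add: left_resolution_def)
  have env_counit_zero: "env_counit \<zero>\<^bsub>U\<^esub> = 0"
    using env_counit_cls[OF tensor_alg_closed(1)] by (simp add: cls_zero)
  define \<chi> :: "(nat \<Rightarrow> 'k) \<Rightarrow> nat \<Rightarrow> 'k fps set"
    where "\<chi> c = (\<lambda>i. gr_coset N (\<lambda>x. h \<odot>\<^bsub>N\<^esub> x) (\<lambda>f. fps_nth f 0) i (c i))" for c
  interpret hN: hred N "\<lambda>x. h \<odot>\<^bsub>N\<^esub> x" "\<lambda>f. fps_nth f 0" ?k by (rule hred_N)
  have T_const: "cls t = p (dcl (fps_const t))" "dcl (fps_const t) \<in> carrier R" if "t \<in> T" for t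
    using that p_dcl[of "fps_const t"] dcl_closed by (simp_all add: tensor_alg_h_closed)
  have alg: "gr_alg_identification scale bracket n e g gr_seq"
  proof -
    have 0: "gr_seq (up_ring.monom (UP U) (cls t) 0) = gr_class R (hfilt R h) 0 (dcl (fps_const t))"
      if "t \<in> T" for t
      using red.gr_class_eq[OF T_const(2)[OF that], of 0] cls_closed[OF that] T_const(1)[OF that]
      by (simp add: hfilt_eq UP_simps cong: if_cong)
    have 1: "gr_seq (up_ring.monom (UP U) \<one>\<^bsub>U\<^esub> 1) = gr_class R (hfilt R h) 1 h"
      using red.gr_class_eq[OF R.one_closed, of 1] h_closed
      by (simp add: hfilt_eq UP_simps p_one cong: if_cong)
    show ?thesis
      unfolding gr_alg_identification_def Let_def
      by (intro conjI allI impI gr_ring_iso 0 1 tensor_alg_closed)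
  qed
  have chi: "\<chi> \<in> semilinear_iso (UP U) gr_seq trivial_poly_module (gr_module R h N)"
    unfolding \<chi>_def
  proof (rule gr_module_iso[where act = "\<lambda>u x. env_counit u * x" and t = "\<lambda>x. x", OF left_module_N hred_N])
    show "bij_betw (\<lambda>x. x) (carrier trivial_poly_module) (up ?k)"
      by (simp add: trivial_poly_module_def UP_simps bij_betw_def)
    show "fps_nth (u \<odot>\<^bsub>N\<^esub> x) 0 = env_counit (p u) * fps_nth x 0" if "u \<in> carrier R" for u x
      using counit[OF that] by (simp add: trivial_def_module_simps)
    fix x :: "nat \<Rightarrow> 'k" assume x: "x \<in> carrier trivial_poly_module"
    then have xu: "x \<in> up ?k" by (simp add: trivial_poly_module_def UP_simps)
    show "(x \<oplus>\<^bsub>trivial_poly_module\<^esub> y) i = x i \<oplus>\<^bsub>?k\<^esub> y i" if "y \<in> carrier trivial_poly_module" for y i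
      using that xu by (simp add: trivial_poly_module_def UP_simps)
    show "(a \<odot>\<^bsub>trivial_poly_module\<^esub> x) i = (\<Oplus>\<^bsub>?k\<^esub>j\<in>{..i}. env_counit (a j) * x (i - j))" if a: "a \<in> up U" for a i
    proof -
      have "{i. env_counit (a i) \<noteq> 0} \<subseteq> {i. a i \<noteq> \<zero>\<^bsub>U\<^esub>}" using env_counit_zero by auto
      moreover have "finite {i. a i \<noteq> \<zero>\<^bsub>U\<^esub>}" using a by (simp add: red.up_iff_finite)
      ultimately have "finite {i. env_counit (a i) \<noteq> 0}" by (rule finite_subset)
      then have "(\<lambda>i. env_counit (a i)) \<in> up ?k" by (simp add: hN.up_iff_finite type_ring_simps)
      then show ?thesis using xu by (simp add: trivial_poly_module_def UP_simps type_ring_simps)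
    qed
  qed (simp add: type_ring_simps)
  have chi_one: "\<chi> \<one>\<^bsub>trivial_poly_module\<^esub> = gr_class N (mfilt R h N) 0 1"
    using hN.gr_class_eq[of 1 0]
    by (simp add: \<chi>_def mfilt_eq[OF left_module_N] trivial_poly_module_def UP_simps
        trivial_def_module_simps type_ring_simps cong: if_cong)
  have tr_up: "tr m x \<in> up (Kbar m)" if "x \<in> carrier (ext_module (UP U) n m)" for m x
    using tr_bij[of m] that by (auto simp: bij_betw_def)
  have diff: "gr_map R h (K m) (d m) (gr_ext (Suc m) x) = gr_ext m (koszul_diff_h scale bracket n e m x)"
    if x: "x \<in> carrier (ext_module (UP U) n (Suc m))" for m x
  proof -
    have "hmap (K (Suc m)) (\<lambda>x. h \<odot>\<^bsub>K (Suc m)\<^esub> x) (reduce (Suc m)) (Kbar (Suc m))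
      (K m) (\<lambda>x. h \<odot>\<^bsub>K m\<^esub> x) (reduce m) (Kbar m) (d m) (kos m)"
      by (rule hmap_linear, rule hred_K, rule hred_K, rule d_hom, rule d_pm)
    from gr_map_eq[OF left_module_K this tr_up[OF x]]
    have "gr_map R h (K m) (d m) (gr_ext (Suc m) x)
        = (\<lambda>i. gr_coset (K m) (\<lambda>x. h \<odot>\<^bsub>K m\<^esub> x) (reduce m) i (kos m (tr (Suc m) x i)))" .
    \<comment> \<open>\<open>koszul_diff_h\<close> acts on each power of h separately, so after
      transposition it is the Koszul differential of each coefficient.\<close>
    moreover have "tr m (koszul_diff_h scale bracket n e m x) i = kos m (tr (Suc m) x i)" for i
    proof (rule ext_module_eqI)
      show c: "kos m (tr (Suc m) x i) \<in> carrier (Kbar m)"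
        using semilinear_homD(1)[OF kos_hom up_closed[OF tr_up[OF x]]] .
      then show "tr m (koszul_diff_h scale bracket n e m x) i \<in> carrier (Kbar m)"
        by (auto simp: ext_module_simps koszul_diff_h_def PiE_ext_index_mem)
    qed (simp add: koszul_diff_h_def)
    ultimately show ?thesis by simp
  qed
  have aug: "gr_map R h N \<epsilon> (gr_ext 0 x) = \<chi> (koszul_aug_h x)"
    if x: "x \<in> carrier (ext_module (UP U) n 0)" for x
  proof -
    have "hmap (K 0) (\<lambda>x. h \<odot>\<^bsub>K 0\<^esub> x) (reduce 0) (Kbar 0) N (\<lambda>x. h \<odot>\<^bsub>N\<^esub> x) (\<lambda>f. fps_nth f 0) ?k \<epsilon> \<epsilon>'"
      by (rule hmap_linear, rule hred_K, rule hred_N, rule eps, rule eps_q)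
    from gr_map_eq[OF left_module_N this tr_up[OF x]]
    show ?thesis using empty_ext_index by (simp add: \<chi>_def koszul_aug_h_def \<epsilon>'_def)
  qed
  have "gr_is_koszul scale bracket n e g d \<epsilon>"
    unfolding gr_is_koszul_def Let_def def_ext_module_def
    using alg gr_ext_iso gr_ext_basis chi chi_one diff aug
    by (intro exI[of _ gr_seq] exI[of _ gr_ext] exI[of _ \<chi>]) auto
  then show ?thesis using d by (auto simp: def_ext_module_def[abs_def])
qed

end

theorem theorem6p2p1:
  fixes scale :: "'k::field_char_0 \<Rightarrow> 'a::ab_group_add \<Rightarrow> 'a"
    and bracket :: "'a \<Rightarrow> 'a \<Rightarrow> 'a"
    and n :: nat
    and e :: "nat \<Rightarrow> 'a"
    and C :: "nat \<Rightarrow> nat \<Rightarrow> nat \<Rightarrow> 'k"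
    and g :: "nat \<Rightarrow> nat \<Rightarrow> 'k mpoly fps"
    and scaleV :: "'k \<Rightarrow> 'v::ab_group_add \<Rightarrow> 'v"
  assumes lie: "lie_algebra scale bracket"
    and basis: "finite_basis scale n e"
    and structure_constants:
      "\<And>i j. i < n \<Longrightarrow> j < n \<Longrightarrow> bracket (e i) (e j) = (\<Sum>a<n. scale (C i j a) (e a))"
    and g_vars: "\<And>i j. i < n \<Longrightarrow> j < n \<Longrightarrow> series_in_vars n (g i j)"
    and g_order: "\<And>i j. i < n \<Longrightarrow> j < n \<Longrightarrow> X_order (g i j) \<ge> 1"
    and g_mod_h: "\<And>i j. i < n \<Longrightarrow> j < n \<Longrightarrow>
      \<exists>t \<in> carrier (tensor_alg_h n).
        series_tensor n (g i j) - (\<Sum>a<n. fps_const (scalar (C i j a) * gen a)) = fps_X * t"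
    and deformation: "is_deformation scaleV scale bracket n e g"
  shows "\<exists>d \<epsilon>.
    left_resolution (def_alg n g) trivial_def_module (def_ext_module n g) d \<epsilon> \<and>
    gr_is_koszul scale bracket n e g d \<epsilon>"
proof -
  interpret deformed_enveloping scale bracket n e g scaleV
  proof (intro deformed_enveloping.intro lie_basis.intro lie_basis_axioms.intro
      augmented_relations.intro deformed_enveloping_axioms.intro)
  qed (fact lie basis g_vars g_order deformation)+
  show ?thesis by (rule resolution)
qed

end
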